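(* Let $H=H_0+H_{imp}$ be a quantum impurity model with impurity size $m$. For $\tau\ge0$ let $Q_\tau$ be the orthogonal projector onto the subspace spanned by eigenvectors of $H_0$ with eigenvalue at most $\tau$. Let $\psi$ be any normalized ground state of $H$. Then $$\|(I-Q_\tau)\psi\|\le 2\exp\!\left[-\frac{\tau}{4}\log\!\left(\frac{\tau}{8em}\right)\right]$$ for all $\tau\ge 8em$, where $e=\exp(1)$.
   Context: Let $\mathcal{H}_n$ be the Fock space of $n$ fermionic modes with operators $a_j^\dagger,a_j$. Majorana operators: $c_{2j-1}=a_j+a_j^\dagger$, $c_{2j}=-i(a_j-a_j^\dagger)$, satisfying $c_pc_q+c_qc_p=2\delta_{pq}I$. A quantum impurity model is $H=H_0+H_{imp}$ with $H_0=\frac{\|h\|_1}{4}I+\frac{i}{4}\sum_{p,q=1}^{2n}h_{pq}c_pc_q$, $h$ a real antisymmetric $2n\times2n$ matrix with operator norm $\|h\|\le1$ ($\|h\|_1$ is the trace norm), and $H_{imp}=\sum_{x\in\{0,1\}^m,|x|\text{ even}}g_xc_1^{x_1}\cdots c_m^{x_m}$ an arbitrary Hermitian operator of this form ($m$ = impurity size). *)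

theory Defs
  imports Complex_Main "Jordan_Normal_Form.Schur_Decomposition"
begin

text \<open>Fock space of n fermionic modes: C^(2^n), basis vector k encodes the
occupation numbers of the modes: mode j (1 \<le> j \<le> n) is occupied iff bit (j-1) of k is 1.\<close>

definition occ :: "nat \<Rightarrow> nat \<Rightarrow> nat" where
  "occ k i = k div 2 ^ i mod 2"

text \<open>Annihilation operator a_j (Jordan-Wigner), for 1 \<le> j \<le> n.\<close>
definition ann :: "nat \<Rightarrow> nat \<Rightarrow> complex mat" where
  "ann n j = mat (2 ^ n) (2 ^ n) (\<lambda>(r, c).
     if occ c (j - 1) = 1 \<and> r = c - 2 ^ (j - 1)
     then (-1) ^ (\<Sum>i<j - 1. occ c i) else 0)"

definition cre :: "nat \<Rightarrow> nat \<Rightarrow> complex mat" where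
  "cre n j = mat_adjoint (ann n j)"

definition maj :: "nat \<Rightarrow> nat \<Rightarrow> complex mat" where
  "maj n p = (if odd p then ann n ((p + 1) div 2) + cre n ((p + 1) div 2)
              else (- \<i>) \<cdot>\<^sub>m (ann n (p div 2) - cre n (p div 2)))"

definition maj_monomial :: "nat \<Rightarrow> bool list \<Rightarrow> complex mat" where
  "maj_monomial n x = foldr (\<lambda>i M. (if x ! i then maj n (i + 1) else 1\<^sub>m (2 ^ n)) * M)
      [0..<length x] (1\<^sub>m (2 ^ n))"

definition hamming_weight :: "bool list \<Rightarrow> nat" where
  "hamming_weight x = length (filter id x)"

definition rvnorm :: "real vec \<Rightarrow> real" where
  "rvnorm v = sqrt (v \<bullet> v)"

definition op_norm_le_one :: "real mat \<Rightarrow> bool" where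
  "op_norm_le_one h = (\<forall>v \<in> carrier_vec (dim_col h). rvnorm (h *\<^sub>v v) \<le> rvnorm v)"

definition mtrace :: "real mat \<Rightarrow> real" where
  "mtrace P = (\<Sum>i<dim_row P. P $$ (i, i))"

definition trace_norm :: "real mat \<Rightarrow> real" where
  "trace_norm h = mtrace (THE P. P \<in> carrier_mat (dim_col h) (dim_col h) \<and> transpose_mat P = P
      \<and> (\<forall>v \<in> carrier_vec (dim_col h). 0 \<le> v \<bullet> (P *\<^sub>v v))
      \<and> P * P = transpose_mat h * h)"

definition H_free :: "nat \<Rightarrow> real mat \<Rightarrow> complex mat" where
  "H_free n h = (complex_of_real (trace_norm h / 4)) \<cdot>\<^sub>m 1\<^sub>m (2 ^ n) +
     mat (2 ^ n) (2 ^ n) (\<lambda>(r, s). (\<i> / 4) *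
        (\<Sum>p\<in>{1..2*n}. \<Sum>q\<in>{1..2*n}. complex_of_real (h $$ (p - 1, q - 1)) *
            (maj n p * maj n q) $$ (r, s)))"

definition H_imp :: "nat \<Rightarrow> nat \<Rightarrow> (bool list \<Rightarrow> complex) \<Rightarrow> complex mat" where
  "H_imp n m g = mat (2 ^ n) (2 ^ n) (\<lambda>(r, s).
     \<Sum>x\<in>{x. length x = m \<and> even (hamming_weight x)}. g x * maj_monomial n x $$ (r, s))"

definition hermitian :: "complex mat \<Rightarrow> bool" where
  "hermitian A = (A \<in> carrier_mat (dim_row A) (dim_row A) \<and> mat_adjoint A = A)"

definition cvnorm :: "complex vec \<Rightarrow> real" where
  "cvnorm v = sqrt (\<Sum>i<dim_vec v. (cmod (v $ i))\<^sup>2)"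

definition ground_state :: "complex mat \<Rightarrow> complex vec \<Rightarrow> bool" where
  "ground_state H psi = (psi \<in> carrier_vec (dim_row H) \<and> cvnorm psi = 1 \<and>
     (\<exists>E::real. H *\<^sub>v psi = complex_of_real E \<cdot>\<^sub>v psi \<and>
        (\<forall>\<mu> v. v \<in> carrier_vec (dim_row H) \<and> v \<noteq> 0\<^sub>v (dim_row H) \<and> H *\<^sub>v v = \<mu> \<cdot>\<^sub>v v
              \<longrightarrow> E \<le> Re \<mu>)))"

definition low_space :: "complex mat \<Rightarrow> real \<Rightarrow> complex vec set" where
  "low_space A \<tau> = {w. \<exists>vs. (\<forall>v\<in>set vs. v \<in> carrier_vec (dim_row A) \<and>
        (\<exists>\<mu>::real. \<mu> \<le> \<tau> \<and> A *\<^sub>v v = complex_of_real \<mu> \<cdot>\<^sub>v v))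
      \<and> w = foldr (+) vs (0\<^sub>v (dim_row A))}"

definition orth_proj :: "nat \<Rightarrow> complex vec set \<Rightarrow> complex mat" where
  "orth_proj N W = (THE Q. Q \<in> carrier_mat N N \<and> Q * Q = Q \<and> mat_adjoint Q = Q \<and>
      (\<lambda>v. Q *\<^sub>v v) ` carrier_vec N = W)"

end

theory Submission
  imports Defs "HOL-Library.Function_Algebras" "HOL-Analysis.L2_Norm"
begin

text \<open>
  Let \<open>h'\<close> be \<open>h\<close> with its first \<open>m\<close> rows and columns set to zero, and let \<open>B\<close> be the free Hamiltonian of
  \<open>h'\<close>, shifted to have ground energy 0. Then \<open>H\<^sub>0 = B + V\<close> where \<open>\<parallel>V\<parallel> \<le> m\<close> and \<open>V\<close> raises the
  \<open>B\<close>-energy by at most one, while \<open>D = H\<^bsub>imp\<^esub>\<close> commutes with \<open>B\<close>. As the lowest eigenspace of \<open>D\<close>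
  meets the kernel of \<open>B\<close>, a trial state there gives \<open>D \<ge> E - m\<close>, so the eigenvalue equation
  \<open>(B + D - E) \<psi> = - V \<psi>\<close>, projected to \<open>B > t\<close>, yields
  \<open>(t - m) \<parallel>P\<^bsub>B>t\<^esub> \<psi>\<parallel> \<le> m \<parallel>P\<^bsub>B>t-1\<^esub> \<psi>\<parallel>\<close>. In the same way
  \<open>\<tau> \<parallel>R x\<parallel> \<le> \<parallel>R B x\<parallel> + \<parallel>R V x\<parallel>\<close>, for the spectral projection \<open>R\<close> of \<open>H\<^sub>0\<close> above \<open>\<tau>\<close> and \<open>x\<close> of
  \<open>B\<close>-energy at most \<open>t\<close>, controls the overlap of low \<open>B\<close>-energy with high \<open>H\<^sub>0\<close>-energy. Splitting \<open>\<psi>\<close> at \<open>B\<close>-energy \<open>\<tau>/2\<close> and iterating each recursion about \<open>\<tau>/4\<close> times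
  bounds both pieces by \<open>(8em/\<tau>)\<^bsup>\<tau>/4\<^esup>\<close>.

  Vectors are functions on \<open>nat\<close> vanishing outside \<open>{..<N}\<close>, so that sums of vectors and compositions of
  operators need no carrier conditions.
\<close>

section \<open>Finite-dimensional spectral theory\<close>

text \<open>The impurity term may be arbitrarily large and need not commute with
  \<open>H\<^sub>0\<close>, so it cannot be treated as a perturbation. Once the impurity is
  decoupled, \<open>D\<close> enters only through \<open>D \<ge> E - m\<close>: the unknown
  \<open>E\<close> cancels and no estimate depends on the norm of \<open>D\<close> or on
  \<open>n\<close>. The kernel of \<open>B\<close> meets the lowest eigenspace of \<open>D\<close>
  because the annihilators of the modes of \<open>B\<close> with nonzero energy commute with
  \<open>D\<close>: a common eigenvector of least \<open>B\<close>-energy must be killed by all of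
  them.

  The bound m for \<open>V\<close> has two halves: m/2 for the deleted entries of \<open>h\<close>,
  and m/2 for the difference of the two vacuum energies, by the variational principle.
  \<open>V\<close> raises the energy by at most one since each of its quadratic terms contains an
  impurity Majorana, which commutes with \<open>B\<close>; the other factor changes the energy by
  eigenvalues of i h', at most 1.

  For \<open>t \<ge> \<tau>/4\<close> the first recursion has ratio
  \<open>m/(t - m) \<le> 8m/\<tau>\<close>; the second, used for \<open>t \<le> 3\<tau>/4\<close>,
  has ratio \<open>m/(\<tau> - t) \<le> 4m/\<tau>\<close>. Both are below
  \<open>8em/\<tau>\<close>.\<close>

definition smul :: "complex \<Rightarrow> (nat \<Rightarrow> complex) \<Rightarrow> nat \<Rightarrow> complex"  (infixr "*\<^sub>c" 75)
  where "a *\<^sub>c f = (\<lambda>i. a * f i)"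

lemma smul_apply [simp]: "(a *\<^sub>c f) i = a * f i"
  by (simp add: smul_def)

lemma sum_fun_apply: "(\<Sum>k\<in>A. f k) i = (\<Sum>k\<in>A. f k i)" for f :: "'b \<Rightarrow> 'c \<Rightarrow> 'a::comm_monoid_add"
  by (induction A rule: infinite_finite_induct) auto

lemma smul_simps [simp]:
  "1 *\<^sub>c f = f" "0 *\<^sub>c f = 0" "a *\<^sub>c 0 = 0" "a *\<^sub>c (b *\<^sub>c f) = (a * b) *\<^sub>c f"
  by (auto simp: fun_eq_iff)

lemma smul_distribs:
  "a *\<^sub>c (f + g) = a *\<^sub>c f + a *\<^sub>c g" "a *\<^sub>c (f - g) = a *\<^sub>c f - a *\<^sub>c g"
  "(a + b) *\<^sub>c f = a *\<^sub>c f + b *\<^sub>c f" "(a - b) *\<^sub>c f = a *\<^sub>c f - b *\<^sub>c f"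
  by (auto simp: fun_eq_iff algebra_simps)

lemma smul_sum: "a *\<^sub>c (\<Sum>k\<in>A. f k) = (\<Sum>k\<in>A. a *\<^sub>c f k)"
  by (auto simp: fun_eq_iff sum_fun_apply sum_distrib_left)

definition vsp :: "nat \<Rightarrow> (nat \<Rightarrow> complex) set"
  where "vsp N = {f. \<forall>i\<ge>N. f i = 0}"

lemma vsp_simps [simp]:
  "0 \<in> vsp N" "f \<in> vsp N \<Longrightarrow> g \<in> vsp N \<Longrightarrow> f + g \<in> vsp N"
  "f \<in> vsp N \<Longrightarrow> g \<in> vsp N \<Longrightarrow> f - g \<in> vsp N"
  "f \<in> vsp N \<Longrightarrow> a *\<^sub>c f \<in> vsp N"
  by (auto simp: vsp_def)

lemma vsp_sum [simp]: "(\<And>k. k \<in> A \<Longrightarrow> f k \<in> vsp N) \<Longrightarrow> (\<Sum>k\<in>A. f k) \<in> vsp N"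
  by (auto simp: vsp_def sum_fun_apply)

definition ip :: "nat \<Rightarrow> (nat \<Rightarrow> complex) \<Rightarrow> (nat \<Rightarrow> complex) \<Rightarrow> complex"
  where "ip N f g = (\<Sum>i<N. cnj (f i) * g i)"

lemma ip_simps:
  "ip N f (g + h) = ip N f g + ip N f h" "ip N (f + g) h = ip N f h + ip N g h"
  "ip N f (g - h) = ip N f g - ip N f h" "ip N (f - g) h = ip N f h - ip N g h"
  "ip N f (a *\<^sub>c g) = a * ip N f g" "ip N (a *\<^sub>c f) g = cnj a * ip N f g"
  "ip N 0 g = 0" "ip N f 0 = 0"
  by (auto simp: ip_def algebra_simps sum.distrib sum_subtractf sum_distrib_left)

lemma ip_sum_right: "ip N f (\<Sum>k\<in>A. g k) = (\<Sum>k\<in>A. ip N f (g k))"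
  by (induction A rule: infinite_finite_induct) (simp_all add: ip_simps del: plus_fun_apply zero_fun_apply)

lemma ip_sum_left: "ip N (\<Sum>k\<in>A. g k) f = (\<Sum>k\<in>A. ip N (g k) f)"
  by (induction A rule: infinite_finite_induct) (simp_all add: ip_simps del: plus_fun_apply zero_fun_apply)

lemma cnj_ip: "cnj (ip N f g) = ip N g f"
  by (simp add: ip_def mult.commute)

definition nrm :: "nat \<Rightarrow> (nat \<Rightarrow> complex) \<Rightarrow> real"
  where "nrm N f = L2_set (\<lambda>i. cmod (f i)) {..<N}"

lemma nrm_nonneg [simp]: "0 \<le> nrm N f"
  by (simp add: nrm_def)

lemma nrm_sq: "(nrm N f)\<^sup>2 = (\<Sum>i<N. (cmod (f i))\<^sup>2)"
  by (simp add: nrm_def L2_set_def sum_nonneg)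

lemma ip_self: "ip N f f = of_real ((nrm N f)\<^sup>2)"
  unfolding ip_def nrm_sq of_real_sum
  by (intro sum.cong refl) (simp only: complex_norm_square mult.commute)

lemma nrm_eq_0: "f \<in> vsp N \<Longrightarrow> nrm N f = 0 \<longleftrightarrow> f = 0"
  by (auto simp: nrm_def L2_set_eq_0_iff vsp_def fun_eq_iff) (metis lessThan_iff linorder_not_le)

lemma nrm_zero [simp]: "nrm N 0 = 0"
  by (simp add: nrm_def L2_set_0')

lemma nrm_smul: "nrm N (a *\<^sub>c f) = cmod a * nrm N f"
  by (simp add: nrm_def norm_mult L2_set_right_distrib)

lemma nrm_triangle: "nrm N (f + g) \<le> nrm N f + nrm N g"
proof -
  have "nrm N (f + g) \<le> L2_set (\<lambda>i. cmod (f i) + cmod (g i)) {..<N}"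
    unfolding nrm_def by (intro L2_set_mono) (auto simp: norm_triangle_ineq)
  also have "\<dots> \<le> nrm N f + nrm N g"
    unfolding nrm_def by (rule L2_set_triangle_ineq)
  finally show ?thesis .
qed

lemma nrm_sum: "nrm N (\<Sum>k\<in>A. f k) \<le> (\<Sum>k\<in>A. nrm N (f k))"
  by (induction A rule: infinite_finite_induct) (simp_all add: order_trans[OF nrm_triangle] del: plus_fun_apply zero_fun_apply)

lemma cauchy_schwarz: "cmod (ip N f g) \<le> nrm N f * nrm N g"
proof -
  have "cmod (ip N f g) \<le> (\<Sum>i<N. \<bar>cmod (f i)\<bar> * \<bar>cmod (g i)\<bar>)"
    unfolding ip_def by (rule order_trans[OF norm_sum]) (simp add: norm_mult)
  also have "\<dots> \<le> nrm N f * nrm N g"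
    unfolding nrm_def by (rule L2_set_mult_ineq)
  finally show ?thesis .
qed

definition clin :: "((nat \<Rightarrow> complex) \<Rightarrow> nat \<Rightarrow> complex) \<Rightarrow> bool"
  where "clin T \<longleftrightarrow> (\<forall>f g. T (f + g) = T f + T g) \<and> (\<forall>a f. T (a *\<^sub>c f) = a *\<^sub>c T f)"

lemma clinI: "(\<And>f g. T (f + g) = T f + T g) \<Longrightarrow> (\<And>a f. T (a *\<^sub>c f) = a *\<^sub>c T f) \<Longrightarrow> clin T"
  by (simp add: clin_def)

lemma clin_add: "clin T \<Longrightarrow> T (f + g) = T f + T g"
  and clin_smul: "clin T \<Longrightarrow> T (a *\<^sub>c f) = a *\<^sub>c T f"
  by (simp_all add: clin_def)

lemma clin_zero: "clin T \<Longrightarrow> T 0 = 0"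
  using clin_smul[of T 0 0] by simp

lemma clin_diff: "clin T \<Longrightarrow> T (f - g) = T f - T g"
  by (metis add_diff_cancel_right' clin_add diff_add_cancel)

lemma clin_sum: "clin T \<Longrightarrow> T (\<Sum>k\<in>A. f k) = (\<Sum>k\<in>A. T (f k))"
  by (induction A rule: infinite_finite_induct) (auto simp: clin_add clin_zero)

definition opr :: "nat \<Rightarrow> ((nat \<Rightarrow> complex) \<Rightarrow> nat \<Rightarrow> complex) \<Rightarrow> bool"
  where "opr N T \<longleftrightarrow> clin T \<and> (\<forall>x\<in>vsp N. T x \<in> vsp N)"

definition selfadj :: "nat \<Rightarrow> ((nat \<Rightarrow> complex) \<Rightarrow> nat \<Rightarrow> complex) \<Rightarrow> bool"
  where "selfadj N T \<longleftrightarrow> opr N T \<and> (\<forall>x\<in>vsp N. \<forall>y\<in>vsp N. ip N x (T y) = ip N (T x) y)"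

lemma selfadjD:
  assumes "selfadj N T"
  shows "opr N T" "clin T" "x \<in> vsp N \<Longrightarrow> T x \<in> vsp N"
    "x \<in> vsp N \<Longrightarrow> y \<in> vsp N \<Longrightarrow> ip N (T x) y = ip N x (T y)"
  using assms by (auto simp: selfadj_def opr_def)

text \<open>\<open>L\<close> is left free instead of being \<open>N\<close>: every argument runs
  through \<open>ortho\<close> and \<open>expand\<close>, which spares a dimension count.\<close>

locale eigenbasis =
  fixes N :: nat and T :: "(nat \<Rightarrow> complex) \<Rightarrow> nat \<Rightarrow> complex"
    and L :: nat and e :: "nat \<Rightarrow> nat \<Rightarrow> complex" and d :: "nat \<Rightarrow> real"
  assumes opr: "opr N T"
    and e_vsp [simp]: "k < L \<Longrightarrow> e k \<in> vsp N"
    and eigen: "k < L \<Longrightarrow> T (e k) = of_real (d k) *\<^sub>c e k"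
    and ortho: "j < L \<Longrightarrow> k < L \<Longrightarrow> ip N (e j) (e k) = (if j = k then 1 else 0)"
    and expand: "x \<in> vsp N \<Longrightarrow> x = (\<Sum>k<L. ip N (e k) x *\<^sub>c e k)"

section \<open>Diagonalisation of self-adjoint operators\<close>

lemma unit_fun_expand:
  assumes "x \<in> vsp N"
  shows "x = (\<Sum>j<N. x j *\<^sub>c (\<lambda>i. of_bool (i = j)))"
proof
  fix i
  show "x i = (\<Sum>j<N. x j *\<^sub>c (\<lambda>i. of_bool (i = j))) i"
    using assms by (cases "i < N") (auto simp: sum_fun_apply vsp_def of_bool_def if_distrib cong: if_cong)
qed

text \<open>Schur triangularisation \<open>A = P B P\<^sup>-\<^sup>1\<close>, kept only as a flag of invariant subspaces.\<close>

lemma triangular_basis: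
  assumes T: "opr N T"
  shows "\<exists>p b. (\<forall>k<N. p k \<in> vsp N \<and> T (p k) = (\<Sum>j\<le>k. b j k *\<^sub>c p j))
    \<and> (\<forall>x\<in>vsp N. \<exists>c. x = (\<Sum>k<N. c k *\<^sub>c p k))"
proof -
  note lin = T[unfolded opr_def, THEN conjunct1]
  define A where "A = mat N N (\<lambda>(i, j). T (\<lambda>i. of_bool (i = j)) i)"
  have A: "A \<in> carrier_mat N N" by (simp add: A_def)
  have TA: "T x i = (\<Sum>j<N. A $$ (i, j) * x j)" if "x \<in> vsp N" "i < N" for x i
  proof -
    have "T x i = T (\<Sum>j<N. x j *\<^sub>c (\<lambda>i. of_bool (i = j))) i"
      using unit_fun_expand[OF that(1)] by simp
    also have "\<dots> = (\<Sum>j<N. x j * T (\<lambda>i. of_bool (i = j)) i)"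
      by (simp add: clin_sum[OF lin] clin_smul[OF lin] sum_fun_apply)
    finally show ?thesis using that by (simp add: A_def mult.commute)
  qed
  obtain es where "char_poly A = (\<Prod>a\<leftarrow>es. [:- a, 1:])"
    using char_poly_factorized[OF A] by auto
  moreover obtain B P Q where "schur_decomposition A es = (B, P, Q)"
    by (cases "schur_decomposition A es") auto
  ultimately have "similar_mat_wit A B P Q" and ut: "upper_triangular B"
    using schur_decomposition[OF A] by blast+
  note sim = similar_mat_witD2[OF A this(1)]
  have AP: "A * P = P * B"
  proof -
    have "A * P = P * B * Q * P" using sim(3) by simp
    also have "\<dots> = P * B * (Q * P)"
      by (rule assoc_mult_mat) (use sim(5-7) in auto)
    also have "\<dots> = P * B" using sim(2,5,6) by simp
    finally show ?thesis .
  qed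
  define p where "p = (\<lambda>k i. if i < N then P $$ (i, k) else 0)"
  have p: "p k \<in> vsp N" for k by (simp add: p_def vsp_def)
  have "T (p k) = (\<Sum>j\<le>k. B $$ (j, k) *\<^sub>c p j)" if k: "k < N" for k
  proof
    fix i
    show "T (p k) i = (\<Sum>j\<le>k. B $$ (j, k) *\<^sub>c p j) i"
    proof (cases "i < N")
      case True
      have "T (p k) i = (A * P) $$ (i, k)"
        unfolding TA[OF p True] using True k A sim(6)
        by (auto simp: times_mat_def scalar_prod_def p_def atLeast0LessThan intro!: sum.cong)
      also have "\<dots> = (\<Sum>j<N. P $$ (i, j) * B $$ (j, k))"
        unfolding AP using True k sim(5,6)
        by (auto simp: times_mat_def scalar_prod_def atLeast0LessThan intro!: sum.cong)
      also have "\<dots> = (\<Sum>j\<le>k. P $$ (i, j) * B $$ (j, k))"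
        using k sim(5) ut by (intro sum.mono_neutral_right) (auto simp: upper_triangular_def)
      finally show ?thesis using True by (simp add: sum_fun_apply p_def mult.commute)
    next
      case False
      have "T (p k) \<in> vsp N" using T p by (auto simp: opr_def)
      with False show ?thesis by (simp add: vsp_def sum_fun_apply p_def)
    qed
  qed
  moreover have "\<exists>c. x = (\<Sum>k<N. c k *\<^sub>c p k)" if x: "x \<in> vsp N" for x
  proof (intro exI[of _ "\<lambda>k. \<Sum>j<N. Q $$ (k, j) * x j"] ext)
    fix i
    show "x i = (\<Sum>k<N. (\<Sum>j<N. Q $$ (k, j) * x j) *\<^sub>c p k) i"
    proof (cases "i < N")
      case True
      have PQ: "(\<Sum>k<N. P $$ (i, k) * Q $$ (k, j)) = (if i = j then 1 else 0)" if "j < N" for j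
      proof -
        have "(\<Sum>k<N. P $$ (i, k) * Q $$ (k, j)) = (P * Q) $$ (i, j)"
          using True that sim(6,7)
          by (auto simp: times_mat_def scalar_prod_def atLeast0LessThan intro!: sum.cong)
        with sim(1) True that show ?thesis by simp
      qed
      have "(\<Sum>k<N. (\<Sum>j<N. Q $$ (k, j) * x j) *\<^sub>c p k) i
          = (\<Sum>k<N. \<Sum>j<N. P $$ (i, k) * Q $$ (k, j) * x j)"
        using True by (simp add: sum_fun_apply p_def sum_distrib_left sum_distrib_right mult_ac)
      also have "\<dots> = (\<Sum>j<N. (\<Sum>k<N. P $$ (i, k) * Q $$ (k, j)) * x j)"
        by (subst sum.swap) (simp add: sum_distrib_right)
      also have "\<dots> = x i" using True by (simp add: PQ if_distrib if_distribR cong: if_cong)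
      finally show ?thesis by simp
    next
      case False
      with x show ?thesis by (simp add: vsp_def sum_fun_apply p_def)
    qed
  qed
  ultimately show ?thesis
    using p by (intro exI[of _ p] exI[of _ "\<lambda>j k. B $$ (j, k)"] conjI) simp_all
qed

text \<open>Gram-Schmidt along the flag \<open>p\<close>. The projection off an orthonormal list of
  eigenvectors commutes with \<open>T\<close>, so what survives of \<open>p k\<close> is an
  eigenvector with eigenvalue \<open>b k k\<close>, real because \<open>T\<close> is self-adjoint.
  Vanishing residues are skipped, so the length of the list is whatever results.\<close>

lemma spectral_theorem:
  assumes T: "selfadj N T"
  shows "\<exists>L e d. eigenbasis N T L e d"
proof -
  note lin = selfadjD(2)[OF T]
  obtain p b where p: "\<And>k. k < N \<Longrightarrow> p k \<in> vsp N"
    and Tp: "\<And>k. k < N \<Longrightarrow> T (p k) = (\<Sum>j\<le>k. b j k *\<^sub>c p j)"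
    and span: "\<And>x. x \<in> vsp N \<Longrightarrow> \<exists>c. x = (\<Sum>k<N. c k *\<^sub>c p k)"
    using triangular_basis[OF selfadjD(1)[OF T]] by blast
  define proj :: "nat \<Rightarrow> (nat \<Rightarrow> nat \<Rightarrow> complex) \<Rightarrow> (nat \<Rightarrow> complex) \<Rightarrow> nat \<Rightarrow> complex"
    where "proj = (\<lambda>L e x. x - (\<Sum>k<L. ip N (e k) x *\<^sub>c e k))"
  define good :: "nat \<Rightarrow> (nat \<Rightarrow> nat \<Rightarrow> complex) \<Rightarrow> (nat \<Rightarrow> real) \<Rightarrow> bool" where "good = (\<lambda>L e d.
    (\<forall>k<L. e k \<in> vsp N \<and> T (e k) = of_real (d k) *\<^sub>c e k) \<and>
    (\<forall>j<L. \<forall>k<L. ip N (e j) (e k) = (if j = k then 1 else 0)))"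
  have proj_lin: "clin (proj L e)" for L e
    unfolding clin_def proj_def
    by (auto simp: ip_simps smul_distribs sum.distrib smul_sum)
  have proj_T: "proj L e (T x) = T (proj L e x)" if "good L e d" "x \<in> vsp N" for L e d x
  proof -
    have "ip N (e k) (T x) *\<^sub>c e k = ip N (e k) x *\<^sub>c T (e k)" if "k < L" for k
    proof -
      have "ip N (e k) (T x) = ip N (T (e k)) x"
        using selfadjD(4)[OF T _ \<open>x \<in> vsp N\<close>, of "e k"] \<open>good L e d\<close> that
        by (simp add: good_def)
      then show ?thesis using \<open>good L e d\<close> that by (simp add: good_def ip_simps mult.commute)
    qed
    then show ?thesis
      by (simp add: proj_def clin_diff[OF lin] clin_sum[OF lin] clin_smul[OF lin])
  qed
  have "\<exists>L e d. good L e d \<and> (\<forall>i<k. proj L e (p i) = 0)" if "k \<le> N" for k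
    using that
  proof (induction k)
    case 0
    then show ?case by (intro exI[of _ 0]) (simp add: good_def)
  next
    case (Suc k)
    obtain L e d where g: "good L e d" and zero: "\<And>i. i < k \<Longrightarrow> proj L e (p i) = 0"
      using Suc by (metis Suc_leD)
    show ?case
    proof (cases "proj L e (p k) = 0")
      case True
      with zero have "proj L e (p i) = 0" if "i < Suc k" for i
        using that by (cases "i = k") auto
      with g show ?thesis by blast
    next
      case False
      have k: "k < N" using Suc by simp
      define v where "v = proj L e (p k)"
      have v: "v \<in> vsp N" unfolding v_def proj_def
        using p[OF k] g by (intro vsp_simps vsp_sum) (auto simp: good_def)
      have v0: "nrm N v \<noteq> 0" using False nrm_eq_0[OF v] by (simp add: v_def)
      \<comment> \<open>The triangular relation is projected: the earlier \<open>p j\<close> have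
        residue 0, so only the diagonal term remains.\<close>
      have "T v = proj L e (T (p k))"
        unfolding v_def using proj_T[OF g p[OF k]] by simp
      also have "\<dots> = (\<Sum>j\<le>k. b j k *\<^sub>c proj L e (p j))"
        by (simp add: Tp[OF k] clin_sum[OF proj_lin] clin_smul[OF proj_lin])
      also have "\<dots> = b k k *\<^sub>c v"
        using zero by (simp add: lessThan_Suc_atMost[symmetric] v_def)
      finally have Tv: "T v = b k k *\<^sub>c v" .
      have "cnj (b k k) * ip N v v = b k k * ip N v v"
        using selfadjD(4)[OF T v v] by (simp add: Tv ip_simps)
      then have "cnj (b k k) = b k k" using v0 by (simp add: ip_self)
      then have breal: "b k k = of_real (Re (b k k))"
        by (simp add: complex_eq_iff)
      have orth: "ip N (e j) v = 0" if "j < L" for j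
      proof -
        have "ip N (e j) v = ip N (e j) (p k) - (\<Sum>i<L. ip N (e i) (p k) * ip N (e j) (e i))"
          by (simp add: v_def proj_def ip_simps ip_sum_right)
        also have "(\<Sum>i<L. ip N (e i) (p k) * ip N (e j) (e i))
            = (\<Sum>i<L. if i = j then ip N (e j) (p k) else 0)"
          using g that by (intro sum.cong) (auto simp: good_def)
        also have "\<dots> = ip N (e j) (p k)" using that by simp
        finally show ?thesis by simp
      qed
      define w where "w = of_real (1 / nrm N v) *\<^sub>c v"
      define e' where "e' = e(L := w)"
      define d' where "d' = d(L := Re (b k k))"
      have w: "w \<in> vsp N" "T w = of_real (Re (b k k)) *\<^sub>c w"
        using v Tv breal by (simp_all add: w_def clin_smul[OF lin] mult.commute)
      have "nrm N w = 1"
        using v0 by (simp add: w_def nrm_smul norm_divide)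
      then have ww: "ip N w w = 1"
        by (simp add: ip_self)
      have ew: "ip N (e j) w = 0" "ip N w (e j) = 0" if "j < L" for j
      proof -
        show "ip N (e j) w = 0" using orth[OF that] by (simp add: w_def ip_simps)
        then show "ip N w (e j) = 0" by (metis cnj_ip complex_cnj_zero)
      qed
      have "good (Suc L) e' d'"
        using g w ww ew by (auto simp: good_def e'_def d'_def less_Suc_eq)
      moreover have pr: "proj (Suc L) e' x = proj L e x - ip N w x *\<^sub>c w" for x
      proof -
        have "(\<Sum>k<L. ip N (e' k) x *\<^sub>c e' k) = (\<Sum>k<L. ip N (e k) x *\<^sub>c e k)"
          by (intro sum.cong) (auto simp: e'_def)
        then show ?thesis by (simp add: proj_def e'_def)
      qed
      have "proj (Suc L) e' (p i) = 0" if "i < Suc k" for i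
      proof (cases "i < k")
        case True
        have "p i = (\<Sum>k<L. ip N (e k) (p i) *\<^sub>c e k)" using zero[OF True] by (simp add: proj_def)
        then have "ip N w (p i) = ip N w (\<Sum>k<L. ip N (e k) (p i) *\<^sub>c e k)" by simp
        also have "\<dots> = 0" using ew by (simp add: ip_sum_right ip_simps)
        finally show ?thesis using zero[OF True] by (simp add: pr)
      next
        case False
        then have i: "i = k" using that by simp
        have "p k = v + (\<Sum>k<L. ip N (e k) (p i) *\<^sub>c e k)" by (simp add: v_def proj_def i)
        then have "ip N w (p k) = ip N w v + ip N w (\<Sum>k<L. ip N (e k) (p i) *\<^sub>c e k)"
          by (metis ip_simps(1))
        also have "\<dots> = ip N w v" using ew by (simp add: ip_sum_right ip_simps)
        also have "\<dots> = of_real (nrm N v)"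
          unfolding w_def ip_simps ip_self using v0 by (simp add: power2_eq_square)
        finally show ?thesis unfolding i pr using v0 by (simp add: v_def[symmetric] w_def)
      qed
      ultimately show ?thesis by blast
    qed
  qed
  from this[of N] obtain L e d where g: "good L e d" and zero: "\<And>i. i < N \<Longrightarrow> proj L e (p i) = 0"
    by auto
  have "proj L e x = 0" if x: "x \<in> vsp N" for x
  proof -
    obtain c where "x = (\<Sum>k<N. c k *\<^sub>c p k)" using span[OF x] by blast
    then show ?thesis by (simp add: clin_sum[OF proj_lin] clin_smul[OF proj_lin] zero)
  qed
  then have "x = (\<Sum>k<L. ip N (e k) x *\<^sub>c e k)" if "x \<in> vsp N" for x
    using that unfolding proj_def by (metis eq_iff_diff_eq_0)
  then have "eigenbasis N T L e d"
    using g selfadjD(1)[OF T] by unfold_locales (auto simp: good_def)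
  then show ?thesis by blast
qed

section \<open>Energy tails\<close>

context eigenbasis
begin

lemma coef_sum: "k < L \<Longrightarrow> ip N (e k) (\<Sum>j<L. c j *\<^sub>c e j) = c k"
  by (simp add: ip_sum_right ip_simps ortho if_distrib cong: if_cong)

lemma T_clin: "clin T" and T_vsp: "x \<in> vsp N \<Longrightarrow> T x \<in> vsp N"
  using opr by (auto simp: opr_def)

lemma coef_T: "x \<in> vsp N \<Longrightarrow> k < L \<Longrightarrow> ip N (e k) (T x) = of_real (d k) * ip N (e k) x"
proof -
  assume x: "x \<in> vsp N" and k: "k < L"
  have "T x = T (\<Sum>j<L. ip N (e j) x *\<^sub>c e j)" using expand[OF x] by simp
  also have "\<dots> = (\<Sum>j<L. (ip N (e j) x * of_real (d j)) *\<^sub>c e j)"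
    by (simp add: clin_sum[OF T_clin] clin_smul[OF T_clin] eigen)
  finally show ?thesis using coef_sum[OF k] by simp
qed

lemma ip_coef: "x \<in> vsp N \<Longrightarrow> ip N x y = (\<Sum>k<L. cnj (ip N (e k) x) * ip N (e k) y)"
  by (subst expand[of x]) (auto simp: ip_sum_left ip_simps)

lemma parseval: "x \<in> vsp N \<Longrightarrow> (nrm N x)\<^sup>2 = (\<Sum>k<L. (cmod (ip N (e k) x))\<^sup>2)"
proof -
  assume x: "x \<in> vsp N"
  have "of_real ((nrm N x)\<^sup>2) = complex_of_real (\<Sum>k<L. (cmod (ip N (e k) x))\<^sup>2)"
    unfolding ip_self[symmetric] ip_coef[OF x] of_real_sum
    by (intro sum.cong refl) (simp only: complex_norm_square mult.commute)
  then show ?thesis by (simp only: of_real_eq_iff)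
qed

lemma nrm_le_coef:
  assumes "x \<in> vsp N" "y \<in> vsp N" "0 \<le> c"
    and "\<And>k. k < L \<Longrightarrow> cmod (ip N (e k) x) \<le> c * cmod (ip N (e k) y)"
  shows "nrm N x \<le> c * nrm N y"
proof (rule power2_le_imp_le)
  have "(nrm N x)\<^sup>2 \<le> (\<Sum>k<L. (c * cmod (ip N (e k) y))\<^sup>2)"
    unfolding parseval[OF assms(1)] by (intro sum_mono power_mono) (auto simp: assms)
  also have "\<dots> = (c * nrm N y)\<^sup>2"
    by (simp add: power_mult_distrib parseval[OF assms(2)] sum_distrib_left)
  finally show "(nrm N x)\<^sup>2 \<le> (c * nrm N y)\<^sup>2" .
qed (use assms in auto)

lemma eq_coef:
  assumes "x \<in> vsp N" "y \<in> vsp N" "\<And>k. k < L \<Longrightarrow> ip N (e k) x = ip N (e k) y"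
  shows "x = y"
proof -
  have "x = (\<Sum>k<L. ip N (e k) x *\<^sub>c e k)" by (rule expand[OF assms(1)])
  also have "\<dots> = (\<Sum>k<L. ip N (e k) y *\<^sub>c e k)" using assms(3) by (intro sum.cong) auto
  also have "\<dots> = y" using expand[OF assms(2)] by simp
  finally show ?thesis .
qed

text \<open>The spectral projection of \<open>T\<close> for the eigenvalues in
  \<open>A\<close>.\<close>

definition sp :: "real set \<Rightarrow> (nat \<Rightarrow> complex) \<Rightarrow> nat \<Rightarrow> complex"
  where "sp A x = (\<Sum>k<L. (if d k \<in> A then ip N (e k) x else 0) *\<^sub>c e k)"

lemma sp_vsp [simp]: "sp A x \<in> vsp N"
  unfolding sp_def by (intro vsp_sum vsp_simps) auto

lemma coef_sp: "k < L \<Longrightarrow> ip N (e k) (sp A x) = (if d k \<in> A then ip N (e k) x else 0)"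
  unfolding sp_def by (rule coef_sum)

lemma sp_clin: "clin (sp A)"
proof (rule clinI)
  show "sp A (f + g) = sp A f + sp A g" for f g
    by (rule eq_coef) (auto simp: coef_sp ip_simps)
  show "sp A (a *\<^sub>c f) = a *\<^sub>c sp A f" for a f
    by (rule eq_coef) (auto simp: coef_sp ip_simps)
qed

lemma nrm_sp: "x \<in> vsp N \<Longrightarrow> nrm N (sp A x) \<le> nrm N x"
  using nrm_le_coef[of "sp A x" x 1] by (auto simp: coef_sp)

lemma ip_sp: "x \<in> vsp N \<Longrightarrow> ip N (sp A x) y = ip N (sp A x) (sp A y)"
  by (subst (1 2) ip_coef) (auto simp: coef_sp intro!: sum.cong)

text \<open>Commuting with \<open>T\<close> makes the matrix element
  \<open>ip N (e i) (D (e j))\<close> vanish unless \<open>d i = d j\<close>, so the selection by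
  eigenvalue may be made on either index.\<close>

lemma sp_commute:
  assumes D: "opr N D" and comm: "\<And>x. x \<in> vsp N \<Longrightarrow> D (T x) = T (D x)" and x: "x \<in> vsp N"
  shows "sp A (D x) = D (sp A x)"
proof (rule eq_coef)
  have lin: "clin D" and Dv: "\<And>x. x \<in> vsp N \<Longrightarrow> D x \<in> vsp N" using D by (auto simp: opr_def)
  show "D (sp A x) \<in> vsp N" using Dv by simp
  fix i assume i: "i < L"
  have off: "ip N (e i) (D (e j)) = 0" if "j < L" "d i \<noteq> d j" for j
  proof -
    have "of_real (d j) * ip N (e i) (D (e j)) = ip N (e i) (D (T (e j)))"
      using that by (simp add: eigen clin_smul[OF lin] ip_simps)
    also have "\<dots> = of_real (d i) * ip N (e i) (D (e j))"
      using that i by (simp add: comm coef_T Dv)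
    finally show ?thesis using that by simp
  qed
  have "ip N (e i) (D (sp A x))
      = (\<Sum>j<L. (if d j \<in> A then ip N (e j) x else 0) * ip N (e i) (D (e j)))"
    by (simp add: sp_def clin_sum[OF lin] clin_smul[OF lin] ip_sum_right ip_simps)
  also have "\<dots> = (\<Sum>j<L. (if d i \<in> A then ip N (e j) x else 0) * ip N (e i) (D (e j)))"
  proof (intro sum.cong refl)
    fix j assume "j \<in> {..<L}"
    then show "(if d j \<in> A then ip N (e j) x else 0) * ip N (e i) (D (e j))
        = (if d i \<in> A then ip N (e j) x else 0) * ip N (e i) (D (e j))"
      using off[of j] by (cases "d i = d j") auto
  qed
  also have "\<dots> = (if d i \<in> A then ip N (e i) (D (\<Sum>j<L. ip N (e j) x *\<^sub>c e j)) else 0)"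
    by (simp add: clin_sum[OF lin] clin_smul[OF lin] ip_sum_right ip_simps)
  also have "\<dots> = ip N (e i) (sp A (D x))"
    using i expand[OF x] by (simp add: coef_sp)
  finally show "ip N (e i) (sp A (D x)) = ip N (e i) (D (sp A x))" by (rule sym)
qed simp

text \<open>The range of the spectral projection for eigenvalues at most \<open>t\<close>, described
  by vanishing coefficients so that closure properties are immediate.\<close>

definition low :: "real \<Rightarrow> (nat \<Rightarrow> complex) set"
  where "low t = {x \<in> vsp N. \<forall>k<L. t < d k \<longrightarrow> ip N (e k) x = 0}"

lemma low_vsp: "x \<in> low t \<Longrightarrow> x \<in> vsp N"
  by (simp add: low_def)

lemma low_remainder: "x \<in> vsp N \<Longrightarrow> x - sp {t<..} x \<in> low t"
  by (auto simp: low_def ip_simps coef_sp)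

lemma sp_low: "x \<in> low t \<Longrightarrow> sp {t<..} x = 0"
  by (rule eq_coef) (auto simp: low_def coef_sp ip_simps)

text \<open>A selection rule: \<open>X\<close> raises the \<open>T\<close>-energy by at most
  \<open>s\<close>, while lowering is unrestricted.\<close>

definition shift :: "real \<Rightarrow> ((nat \<Rightarrow> complex) \<Rightarrow> nat \<Rightarrow> complex) \<Rightarrow> bool"
  where "shift s X \<longleftrightarrow> (\<forall>t. \<forall>y\<in>low t. X y \<in> low (t + s))"

text \<open>The ladder relation makes \<open>X (e j)\<close> zero or an eigenvector for
  \<open>d j + \<mu>\<close>, hence orthogonal to \<open>e i\<close> unless
  \<open>d i = d j + \<mu>\<close>.\<close>

lemma shift_ladder:
  assumes X: "opr N X" and s: "\<mu> \<le> s"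
    and comm: "\<And>x. x \<in> vsp N \<Longrightarrow> T (X x) = X (T x) + of_real \<mu> *\<^sub>c X x"
  shows "shift s X"
  unfolding shift_def
proof (intro allI ballI)
  have lin: "clin X" and Xv: "\<And>x. x \<in> vsp N \<Longrightarrow> X x \<in> vsp N" using X by (auto simp: opr_def)
  fix t y assume y: "y \<in> low t"
  have "ip N (e i) (X y) = 0" if i: "i < L" "t + s < d i" for i
  proof -
    have off: "ip N (e i) (X (e j)) = 0" if j: "j < L" "d j \<le> t" for j
    proof -
      have "of_real (d i) * ip N (e i) (X (e j)) = ip N (e i) (T (X (e j)))"
        using i j by (simp add: coef_T Xv)
      also have "\<dots> = of_real (d j + \<mu>) * ip N (e i) (X (e j))"
        using j by (simp add: comm eigen clin_smul[OF lin] ip_simps algebra_simps)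
      finally show ?thesis using i j s by (simp del: of_real_add)
    qed
    have "ip N (e i) (X y) = ip N (e i) (X (\<Sum>j<L. ip N (e j) y *\<^sub>c e j))"
      using expand[OF low_vsp[OF y]] by simp
    also have "\<dots> = (\<Sum>j<L. ip N (e j) y * ip N (e i) (X (e j)))"
      by (simp add: clin_sum[OF lin] clin_smul[OF lin] ip_sum_right ip_simps)
    also have "\<dots> = 0"
    proof (intro sum.neutral ballI)
      fix j assume "j \<in> {..<L}"
      then show "ip N (e j) y * ip N (e i) (X (e j)) = 0"
        using y off[of j] by (cases "t < d j") (auto simp: low_def)
    qed
    finally show ?thesis .
  qed
  with Xv[OF low_vsp[OF y]] show "X y \<in> low (t + s)" by (simp add: low_def)
qed

lemma low_sum: "(\<And>k. k \<in> A \<Longrightarrow> f k \<in> low t) \<Longrightarrow> (\<Sum>k\<in>A. f k) \<in> low t"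
  by (auto simp: low_def ip_sum_right)

lemma low_smul: "x \<in> low t \<Longrightarrow> a *\<^sub>c x \<in> low t"
  by (auto simp: low_def ip_simps)

lemma low_add: "x \<in> low t \<Longrightarrow> y \<in> low t \<Longrightarrow> x + y \<in> low t"
  by (auto simp: low_def ip_simps)

lemma low_mono: "x \<in> low t \<Longrightarrow> t \<le> s \<Longrightarrow> x \<in> low s"
  by (auto simp: low_def)

lemma low_T: "x \<in> low t \<Longrightarrow> T x \<in> low t"
  by (auto simp: low_def coef_T T_vsp)

lemma nrm_T_low:
  assumes x: "x \<in> low t" and "0 \<le> t" and nonneg: "\<And>k. k < L \<Longrightarrow> 0 \<le> d k"
  shows "nrm N (T x) \<le> t * nrm N x"
proof (rule nrm_le_coef)
  note xv = low_vsp[OF x]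
  show "x \<in> vsp N" "T x \<in> vsp N" using xv T_vsp by auto
  fix k assume k: "k < L"
  show "cmod (ip N (e k) (T x)) \<le> t * cmod (ip N (e k) x)"
  proof (cases "t < d k")
    case False
    then show ?thesis
      using k nonneg xv by (simp add: coef_T norm_mult mult_right_mono)
  qed (use k x xv in \<open>simp add: coef_T low_def\<close>)
qed (rule \<open>0 \<le> t\<close>)

lemma nrm_sp_T:
  assumes x: "x \<in> vsp N" and "0 \<le> t"
  shows "t * nrm N (sp {t<..} x) \<le> nrm N (sp {t<..} (T x))"
proof (cases "t = 0")
  case False
  have t: "0 < t" using assms False by simp
  have "nrm N (sp {t<..} x) \<le> (1 / t) * nrm N (sp {t<..} (T x))"
  proof (rule nrm_le_coef)
    fix k assume k: "k < L"
    show "cmod (ip N (e k) (sp {t<..} x)) \<le> 1 / t * cmod (ip N (e k) (sp {t<..} (T x)))"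
    proof (cases "t < d k")
      case True
      then have "t * cmod (ip N (e k) x) \<le> d k * cmod (ip N (e k) x)"
        by (intro mult_right_mono) auto
      with True k t x show ?thesis
        by (simp add: coef_sp coef_T norm_mult pos_le_divide_eq mult.commute)
    qed (use k in \<open>simp add: coef_sp\<close>)
  qed (use t in auto)
  then show ?thesis using False assms by (simp add: field_simps)
qed simp

section \<open>Recursions for high-energy tails\<close>

text \<open>Project \<open>(T + D - E) psi = - V psi\<close> to energies above \<open>t\<close>; by the shift property \<open>V\<close> only
  feeds this component from energies above \<open>t - 1\<close>.\<close>

lemma tail_recursion:
  assumes D: "opr N D" "\<And>x. x \<in> vsp N \<Longrightarrow> D (T x) = T (D x)"
    and D_lower: "\<And>x. x \<in> vsp N \<Longrightarrow> (E - c) * (nrm N x)\<^sup>2 \<le> Re (ip N x (D x))"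
    and V: "opr N V" "shift 1 V" and V_bound: "\<And>x. x \<in> vsp N \<Longrightarrow> nrm N (V x) \<le> c * nrm N x"
    and psi: "psi \<in> vsp N" "T psi + V psi + D psi = of_real E *\<^sub>c psi" and "0 \<le> c"
  shows "(t - c) * nrm N (sp {t<..} psi) \<le> c * nrm N (sp {t - 1<..} psi)"
proof (cases "nrm N (sp {t<..} psi) = 0")
  case False
  define x where "x = sp {t<..} psi"
  have Vlin: "clin V" and Vv: "\<And>x. x \<in> vsp N \<Longrightarrow> V x \<in> vsp N" using V by (auto simp: opr_def)
  have x: "x \<in> vsp N" by (simp add: x_def)
  have "sp {t<..} (V (psi - sp {t - 1<..} psi)) = 0"
  proof (rule sp_low)
    show "V (psi - sp {t - 1<..} psi) \<in> low t"
      using V(2) low_remainder[OF psi(1), of "t - 1"] unfolding shift_def by fastforce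
  qed
  then have PV: "sp {t<..} (V psi) = sp {t<..} (V (sp {t - 1<..} psi))"
    by (simp add: clin_diff[OF Vlin] clin_diff[OF sp_clin])
  have T: "t * (nrm N x)\<^sup>2 \<le> Re (ip N x (T psi))"
  proof -
    have "t * (nrm N x)\<^sup>2 = (\<Sum>k<L. t * (cmod (ip N (e k) x))\<^sup>2)"
      by (simp add: parseval[OF x] sum_distrib_left)
    also have "\<dots> \<le> (\<Sum>k<L. Re (cnj (ip N (e k) x) * ip N (e k) (T psi)))"
    proof (intro sum_mono)
      fix k assume k: "k \<in> {..<L}"
      have "Re (cnj z * (of_real (d k) * z)) = d k * (cmod z)\<^sup>2" for z
        by (simp add: cmod_power2) (simp add: power2_eq_square algebra_simps)
      with k show "t * (cmod (ip N (e k) x))\<^sup>2 \<le> Re (cnj (ip N (e k) x) * ip N (e k) (T psi))"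
        by (auto simp: x_def coef_sp coef_T psi intro!: mult_right_mono)
    qed
    also have "\<dots> = Re (ip N x (T psi))" by (simp add: ip_coef[OF x])
    finally show ?thesis .
  qed
  have ipx: "ip N x y = ip N x (sp {t<..} y)" for y
    unfolding x_def by (rule ip_sp[OF psi(1)])
  have "sp {t<..} (D psi) = D x"
    unfolding x_def by (rule sp_commute[OF D psi(1)])
  then have "ip N x (D psi) = ip N x (D x)"
    by (subst ipx) simp
  then have Dx: "(E - c) * (nrm N x)\<^sup>2 \<le> Re (ip N x (D psi))" using D_lower[OF x] by simp
  have "ip N x (T psi) + ip N x (V psi) + ip N x (D psi) = of_real E * ip N x psi"
    using arg_cong[OF psi(2), of "ip N x"] by (simp add: ip_simps)
  moreover have "ip N x psi = of_real ((nrm N x)\<^sup>2)"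
    by (subst ipx) (simp add: x_def[symmetric] ip_self)
  ultimately have "Re (ip N x (T psi)) + Re (ip N x (V psi)) + Re (ip N x (D psi)) = E * (nrm N x)\<^sup>2"
    by (metis Re_complex_of_real plus_complex.sel(1) of_real_mult)
  \<comment> \<open>\<open>E\<close> cancels between the eigenvalue equation and the lower bound for
    \<open>D\<close>: only \<open>t - c\<close> is left, whatever the size of
    \<open>D\<close>.\<close>
  then have "(t - c) * (nrm N x)\<^sup>2 \<le> - Re (ip N x (V psi))"
    using T Dx by (simp add: algebra_simps)
  also have "\<dots> \<le> cmod (ip N x (V psi))"
    using abs_Re_le_cmod[of "ip N x (V psi)"] by linarith
  also have "ip N x (V psi) = ip N x (sp {t<..} (V (sp {t - 1<..} psi)))"
    by (subst ipx) (simp only: PV)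
  also have "cmod \<dots> \<le> nrm N x * (c * nrm N (sp {t - 1<..} psi))"
    by (rule order_trans[OF cauchy_schwarz])
      (auto intro!: mult_left_mono order_trans[OF nrm_sp] V_bound Vv)
  finally show ?thesis
    using False by (simp add: x_def[symmetric] power2_eq_square less_le mult_ac)
qed (use \<open>0 \<le> c\<close> in simp)

text \<open>The step is used at the levels \<open>t, t - 1, ..., t - k + 1\<close>; the last of them
  has to be at least \<open>t0\<close>, whence the \<open>+ 1\<close> in the hypothesis.\<close>

lemma tail_power:
  assumes "\<And>t. t0 \<le> t \<Longrightarrow> nrm N (sp {t<..} psi) \<le> r * nrm N (sp {t - 1<..} psi)"
    and "0 \<le> r" "psi \<in> vsp N" "t0 + real k \<le> t + 1"
  shows "nrm N (sp {t<..} psi) \<le> r ^ k * nrm N psi"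
  using assms(4)
proof (induction k arbitrary: t)
  case 0
  then show ?case using nrm_sp[OF assms(3)] by simp
next
  case (Suc k)
  have "nrm N (sp {t<..} psi) \<le> r * nrm N (sp {t - 1<..} psi)"
    using Suc.prems by (intro assms(1)) simp
  also have "\<dots> \<le> r * (r ^ k * nrm N psi)"
    using Suc.prems assms(2) by (intro mult_left_mono Suc.IH) auto
  finally show ?case by (simp add: mult_ac)
qed

text \<open>Here \<open>R\<close> plays the spectral projection of \<open>T + V\<close> above \<open>\<tau>\<close>: the two energies can only be
  reconciled through \<open>V\<close>, which raises \<open>T\<close>-energy by at most one.\<close>

lemma cross_recursion:
  assumes R: "clin R" "\<And>x. x \<in> vsp N \<Longrightarrow> nrm N (R x) \<le> nrm N x"
    and R_energy: "\<And>x. x \<in> vsp N \<Longrightarrow> \<tau> * nrm N (R x) \<le> nrm N (R (T x + V x))"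
    and V: "opr N V" "shift 1 V" and V_bound: "\<And>x. x \<in> vsp N \<Longrightarrow> nrm N (V x) \<le> c * nrm N x"
    and nonneg: "\<And>k. k < L \<Longrightarrow> 0 \<le> d k"
    and X: "\<And>z. z \<in> low (t + 1) \<Longrightarrow> nrm N (R z) \<le> X * nrm N z"
    and t: "0 \<le> t" "t < \<tau>" and c: "0 \<le> c" "0 \<le> X" and y: "y \<in> low t"
  shows "nrm N (R y) \<le> X * c / (\<tau> - t) * nrm N y"
proof -
  \<comment> \<open>\<open>q\<close> is the fixed point of the map taking b to
    \<open>(b * t + X * c) / \<tau>\<close>, the improvement that one use of \<open>R_energy\<close>
    gives to a bound b for \<open>R\<close> on \<open>low t\<close>.\<close>
  define q where "q = X * c / (\<tau> - t)"
  have q: "0 \<le> q" using t c by (simp add: q_def)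
  have qeq: "q * t + X * c = q * \<tau>" using t by (simp add: q_def field_simps)
  \<comment> \<open>\<open>T y\<close> stays in \<open>low t\<close>, so a bound on
    \<open>low t\<close> improves itself. Starting from the trivial bound, weakened to
    \<open>1 + q\<close>, the excess over \<open>q\<close> shrinks by \<open>t / \<tau>\<close> in
    each round.\<close>
  have step: "nrm N (R y) \<le> ((t / \<tau>) ^ j + q) * nrm N y" if "y \<in> low t" for j y
    using that
  proof (induction j arbitrary: y)
    case 0
    then show ?case
      using R(2)[OF low_vsp[OF 0]] mult_right_mono[of 1 "1 + q" "nrm N y"] q by simp
  next
    case (Suc j)
    have yv: "y \<in> vsp N" by (rule low_vsp[OF Suc.prems])
    have "\<tau> * nrm N (R y) \<le> nrm N (R (T y)) + nrm N (R (V y))"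
      using R_energy[OF yv] nrm_triangle[of N "R (T y)" "R (V y)"] by (simp add: clin_add[OF R(1)])
    also have "nrm N (R (T y)) \<le> ((t / \<tau>) ^ j + q) * nrm N (T y)"
      by (rule Suc.IH[OF low_T[OF Suc.prems]])
    also have "\<dots> \<le> ((t / \<tau>) ^ j + q) * (t * nrm N y)"
      using t q by (intro mult_left_mono nrm_T_low[OF Suc.prems] nonneg) auto
    also have "nrm N (R (V y)) \<le> X * (c * nrm N y)"
      using V(2) Suc.prems c V_bound[OF yv]
      by (intro order_trans[OF X] mult_left_mono) (auto simp: shift_def)
    finally have "\<tau> * nrm N (R y) \<le> ((t / \<tau>) ^ j * t + (q * t + X * c)) * nrm N y"
      by (simp add: algebra_simps)
    also have "\<dots> = \<tau> * (((t / \<tau>) ^ Suc j + q) * nrm N y)"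
      unfolding qeq using t by (simp add: field_simps)
    finally show ?case using t by (simp add: mult_le_cancel_left_pos)
  qed
  have "(\<lambda>j. ((t / \<tau>) ^ j + q) * nrm N y) \<longlonglongrightarrow> (0 + q) * nrm N y"
    using t by (intro tendsto_intros LIMSEQ_realpow_zero) auto
  then show ?thesis
    using step[OF y] by (auto simp: q_def intro: LIMSEQ_le_const)
qed

text \<open>\<open>cross_recursion\<close> is used at the thresholds
  \<open>t, ..., t + k - 1\<close>, all at most \<open>\<tau> - s\<close>, so each use gains a
  factor of at most \<open>c / s\<close>; at \<open>t + k\<close> the bound is merely that
  \<open>R\<close> is a contraction.\<close>

lemma cross_power:
  assumes R: "clin R" "\<And>x. x \<in> vsp N \<Longrightarrow> nrm N (R x) \<le> nrm N x"
    and R_energy: "\<And>x. x \<in> vsp N \<Longrightarrow> \<tau> * nrm N (R x) \<le> nrm N (R (T x + V x))"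
    and V: "opr N V" "shift 1 V" "\<And>x. x \<in> vsp N \<Longrightarrow> nrm N (V x) \<le> c * nrm N x"
    and nonneg: "\<And>k. k < L \<Longrightarrow> 0 \<le> d k"
    and c: "0 \<le> c" "0 < s" "c \<le> r * s" "0 \<le> r"
    and t: "0 \<le> t" "t + real k \<le> \<tau> - s + 1" and y: "y \<in> low t"
  shows "nrm N (R y) \<le> r ^ k * nrm N y"
  using t y
proof (induction k arbitrary: t y)
  case 0
  then show ?case using R(2) low_vsp by simp
next
  case (Suc k)
  have ts: "s \<le> \<tau> - t" using Suc.prems by simp
  have IH: "nrm N (R z) \<le> r ^ k * nrm N z" if "z \<in> low (t + 1)" for z
    using Suc.prems that by (intro Suc.IH) auto
  have "nrm N (R y) \<le> r ^ k * c / (\<tau> - t) * nrm N y"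
    by (rule cross_recursion[OF R R_energy V nonneg IH]) (use Suc.prems ts c in auto)
  also have "\<dots> \<le> r ^ Suc k * nrm N y"
  proof (rule mult_right_mono)
    have "c \<le> r * (\<tau> - t)" using c(3) mult_left_mono[OF ts c(4)] by linarith
    then have "c / (\<tau> - t) \<le> r" using ts c by (simp add: divide_le_eq)
    then show "r ^ k * c / (\<tau> - t) \<le> r ^ Suc k"
      using mult_left_mono[of "c / (\<tau> - t)" r "r ^ k"] c by (simp add: mult.commute)
  qed simp
  finally show ?case .
qed

text \<open>The two recursions meet here. No bound on the norm of \<open>D\<close> occurs: it enters
  through commutation, \<open>D_lower\<close> and the eigenvalue equation.\<close>

lemma energy_tail:
  assumes D: "opr N D" "\<And>x. x \<in> vsp N \<Longrightarrow> D (T x) = T (D x)"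
    and D_lower: "\<And>x. x \<in> vsp N \<Longrightarrow> (E - c) * (nrm N x)\<^sup>2 \<le> Re (ip N x (D x))"
    and V: "opr N V" "shift 1 V" "\<And>x. x \<in> vsp N \<Longrightarrow> nrm N (V x) \<le> c * nrm N x"
    and nonneg: "\<And>k. k < L \<Longrightarrow> 0 \<le> d k"
    and R: "clin R" "\<And>x. x \<in> vsp N \<Longrightarrow> nrm N (R x) \<le> nrm N x"
      "\<And>x. x \<in> vsp N \<Longrightarrow> \<tau> * nrm N (R x) \<le> nrm N (R (T x + V x))"
    and psi: "psi \<in> vsp N" "T psi + V psi + D psi = of_real E *\<^sub>c psi" "nrm N psi = 1"
    and c: "0 < c" and \<tau>: "8 * exp 1 * c \<le> \<tau>"
  shows "nrm N (R psi) \<le> 2 * exp (- (\<tau> / 4) * ln (\<tau> / (8 * exp 1 * c)))"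
proof -
  \<comment> \<open>\<open>r\<close> is the base in the final bound. As \<open>r \<le> 1\<close>,
    rounding the exponent up to \<open>k\<close> keeps \<open>r ^ k\<close> below
    \<open>r powr (\<tau> / 4)\<close>.\<close>
  define r where "r = 8 * exp 1 * c / \<tau>"
  define k where "k = nat \<lceil>\<tau> / 4\<rceil>"
  have e2: "(2::real) \<le> exp 1" using exp_ge_add_one_self[of "1::real"] by simp
  have "16 * c \<le> 8 * exp 1 * c" using e2 c by simp
  then have \<tau>c: "16 * c \<le> \<tau>" and \<tau>0: "0 < \<tau>" using \<tau> c by linarith+
  have r: "0 < r" "r \<le> 1" using c \<tau> \<tau>0 by (auto simp: r_def)
  have k: "\<tau> / 4 \<le> real k" "real k \<le> \<tau> / 4 + 1"
    unfolding k_def using \<tau>0 by linarith+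
  \<comment> \<open>One inequality serves both recursions, whose ratios are at most
    \<open>8 * c / \<tau>\<close> and \<open>4 * c / \<tau>\<close> on the ranges used
    below.\<close>
  have r16: "16 * c \<le> r * \<tau>" using \<open>16 * c \<le> 8 * exp 1 * c\<close> \<tau>0 by (simp add: r_def)
  have pow: "r ^ k \<le> exp (- (\<tau> / 4) * ln (\<tau> / (8 * exp 1 * c)))"
  proof -
    have "r ^ k = r powr real k" using r by (simp add: powr_realpow)
    also have "\<dots> \<le> r powr (\<tau> / 4)" using r k by (intro powr_mono') auto
    also have "\<dots> = exp (- (\<tau> / 4) * ln (\<tau> / (8 * exp 1 * c)))"
      using c \<tau>0 r by (simp add: powr_def r_def ln_div algebra_simps)
    finally show ?thesis .
  qed
  have "nrm N (sp {\<tau> / 2<..} psi) \<le> r ^ k * nrm N psi"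
  \<comment> \<open>The levels run from \<open>\<tau> / 2\<close> down to \<open>\<tau> / 4\<close>;
    \<open>k \<le> \<tau> / 4 + 1\<close> fits because of the \<open>+ 1\<close> in
    \<open>tail_power\<close>.\<close>
  proof (rule tail_power[of "\<tau> / 4"])
    fix t assume t: "\<tau> / 4 \<le> t"
    have "c \<le> r * (t - c)"
    proof -
      have "c \<le> r * (\<tau> / 8)" using r16 c by simp
      also have "\<dots> \<le> r * (t - c)" using r t \<tau>c \<tau>0 by (intro mult_left_mono) auto
      finally show ?thesis .
    qed
    moreover have "(t - c) * nrm N (sp {t<..} psi) \<le> c * nrm N (sp {t - 1<..} psi)"
      by (rule tail_recursion[OF D D_lower V psi(1,2)]) (use c in auto)
    ultimately have "(t - c) * nrm N (sp {t<..} psi) \<le> r * (t - c) * nrm N (sp {t - 1<..} psi)"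
      by (meson mult_right_mono nrm_nonneg order_trans)
    moreover have "0 < t - c" using t \<tau>c c by linarith
    ultimately show "nrm N (sp {t<..} psi) \<le> r * nrm N (sp {t - 1<..} psi)"
      by (metis mult.assoc mult.commute mult_le_cancel_left_pos)
  qed (use r psi k in auto)
  moreover have "nrm N (R (psi - sp {\<tau> / 2<..} psi)) \<le> r ^ k * nrm N (psi - sp {\<tau> / 2<..} psi)"
  \<comment> \<open>The thresholds run from \<open>\<tau> / 2\<close> up to
    \<open>3 * \<tau> / 4\<close>, keeping the distance \<open>s = \<tau> / 4\<close> from
    \<open>\<tau>\<close>.\<close>
  proof (rule cross_power[where V = V and c = c and \<tau> = \<tau> and s = "\<tau> / 4" and t = "\<tau> / 2"])
    show "c \<le> r * (\<tau> / 4)" using r16 c by simp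
    show "\<tau> / 2 + real k \<le> \<tau> - \<tau> / 4 + 1" using k by simp
    show "psi - sp {\<tau> / 2<..} psi \<in> low (\<tau> / 2)" by (rule low_remainder[OF psi(1)])
    show "0 \<le> c" "0 < \<tau> / 4" "0 \<le> r" "0 \<le> \<tau> / 2" using c r \<tau>0 by auto
  qed (fact R V nonneg)+
  moreover have "nrm N (psi - sp {\<tau> / 2<..} psi) \<le> 1 * nrm N psi"
    by (rule nrm_le_coef) (auto simp: psi ip_simps coef_sp)
  moreover have "nrm N (R (sp {\<tau> / 2<..} psi)) \<le> nrm N (sp {\<tau> / 2<..} psi)"
    by (rule R(2)) simp
  moreover have "R psi = R (psi - sp {\<tau> / 2<..} psi) + R (sp {\<tau> / 2<..} psi)"
    by (metis R(1) clin_add diff_add_cancel)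
  moreover have "r ^ k * nrm N (psi - sp {\<tau> / 2<..} psi) \<le> r ^ k * 1"
    using calculation(3) r psi by (intro mult_left_mono) auto
  ultimately have "nrm N (R psi) \<le> r ^ k + r ^ k"
    using nrm_triangle[of N "R (psi - sp {\<tau> / 2<..} psi)" "R (sp {\<tau> / 2<..} psi)"] psi(3) by simp
  with pow show ?thesis by linarith
qed

end

section \<open>Majorana operators\<close>

text \<open>The Jordan-Wigner string as a sign: the parity of the occupied modes below
  \<open>i\<close>.\<close>

definition jw :: "nat \<Rightarrow> nat \<Rightarrow> complex"
  where "jw i r = (\<Prod>l<i. if bit r l then -1 else 1)"

text \<open>The Majorana operator \<open>c\<^bsub>q+1\<^esub>\<close>, with indices starting from 0, flips mode \<open>q div 2\<close> and
  multiplies by the following phase.\<close>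

definition phase :: "nat \<Rightarrow> nat \<Rightarrow> complex"
  where "phase q r = (if even q then 1 else if bit r (q div 2) then \<i> else -\<i>) * jw (q div 2) r"

definition cop :: "nat \<Rightarrow> (nat \<Rightarrow> complex) \<Rightarrow> nat \<Rightarrow> complex"
  where "cop q f = (\<lambda>r. phase q r * f (flip_bit (q div 2) r))"

lemma flip_flip [simp]: "flip_bit i (flip_bit i r) = r" for r :: nat
  by (rule bit_eqI) (auto simp: bit_simps)

lemma flip_commute: "flip_bit i (flip_bit j r) = flip_bit j (flip_bit i r)" for r :: nat
  by (rule bit_eqI) (auto simp: bit_simps)

lemma flip_less:
  fixes r :: nat
  assumes "i < n"
  shows "flip_bit i r < 2 ^ n \<longleftrightarrow> r < 2 ^ n"
proof -
  have "flip_bit i r < 2 ^ n" if "r < 2 ^ n" for r :: nat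
  proof -
    have "take_bit n (flip_bit i r) = flip_bit i (take_bit n r)"
      using assms by (simp add: take_bit_flip_bit_eq)
    then show ?thesis using that by (metis take_bit_nat_eq_self_iff)
  qed
  then show ?thesis by (metis flip_flip)
qed

text \<open>Only the strings of later modes see a flip of mode \<open>j\<close>: this is the source
  of the anticommutation of different modes.\<close>

lemma jw_flip: "jw i (flip_bit j r) = (if j < i then - jw i r else jw i r)"
proof (cases "j < i")
  case True
  have "jw i (flip_bit j r)
      = (if bit r j then 1 else -1) * (\<Prod>l\<in>{..<i} - {j}. if bit r l then -1 else 1)"
    unfolding jw_def using True
    by (subst prod.remove[of _ j]) (auto simp: bit_simps intro!: prod.cong)
  moreover have "jw i r
      = (if bit r j then -1 else 1) * (\<Prod>l\<in>{..<i} - {j}. if bit r l then -1 else 1)"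
    unfolding jw_def using True by (subst prod.remove[of _ j]) auto
  ultimately show ?thesis using True by simp
next
  case False
  then show ?thesis by (auto simp: jw_def bit_simps intro!: prod.cong)
qed

lemma jw_sq: "jw i r * jw i r = 1"
  by (simp add: jw_def prod.distrib[symmetric] if_distrib if_distribR cong: if_cong)

lemma cnj_jw: "cnj (jw i r) = jw i r"
  by (simp add: jw_def if_distrib cong: if_cong)

lemma cop_clin: "clin (cop q)"
  by (rule clinI) (auto simp: cop_def fun_eq_iff algebra_simps)

lemma cop_car: "cop p (cop q f) + cop q (cop p f) = (if p = q then 2 else 0) *\<^sub>c f"
proof
  fix r
  define i where "i = p div 2"
  define j where "j = q div 2"
  have pq: "p = q" if "i = j" "even p = even q"
    using that by (auto simp: i_def j_def elim!: evenE oddE)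
  have [simp]: "jw i r * (a * jw i r) = a" "jw i r * (jw i r * a) = a" for i r a
    by (subst mult.left_commute, simp add: jw_sq) (simp add: jw_sq flip: mult.assoc)
  \<comment> \<open>The two Majoranas of one mode anticommute because the phase plus or minus
    \<open>\<i>\<close> changes sign under the flip; for different modes the string of the later
    mode changes sign.\<close>
  consider "p = q" | "i = j" "even p \<noteq> even q" | "i < j" | "j < i"
    using pq by linarith
  then show "(cop p (cop q f) + cop q (cop p f)) r = ((if p = q then 2 else 0) *\<^sub>c f) r"
  proof cases
    case 1
    then show ?thesis
      by (auto simp: cop_def phase_def jw_flip bit_simps jw_sq)
  next
    case 2
    then have "p \<noteq> q" by auto
    with 2 show ?thesis
      by (auto simp: cop_def phase_def i_def[symmetric] j_def[symmetric] jw_flip bit_simps jw_sq)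
  next
    case 3
    then have "p \<noteq> q" by (auto simp: i_def j_def)
    with 3 show ?thesis
      by (auto simp: cop_def phase_def i_def[symmetric] j_def[symmetric] jw_flip bit_simps
        flip_commute[of i j])
  next
    case 4
    then have "p \<noteq> q" by (auto simp: i_def j_def)
    with 4 show ?thesis
      by (auto simp: cop_def phase_def i_def[symmetric] j_def[symmetric] jw_flip bit_simps
        flip_commute[of i j])
  qed
qed

lemma cop_vsp: "q < 2 * n \<Longrightarrow> f \<in> vsp (2 ^ n) \<Longrightarrow> cop q f \<in> vsp (2 ^ n)"
  using flip_less[of "q div 2" n] by (auto simp: vsp_def cop_def not_less[symmetric])

lemma cop_opr: "q < 2 * n \<Longrightarrow> opr (2 ^ n) (cop q)"
  by (simp add: opr_def cop_clin cop_vsp)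

text \<open>The flip is an involution and conjugates \<open>phase\<close>, so reindexing by it moves
  the operator across.\<close>

lemma cop_adj:
  assumes "q < 2 * n"
  shows "ip (2 ^ n) (cop q f) g = ip (2 ^ n) f (cop q g)"
  unfolding ip_def
proof (rule sum.reindex_bij_witness[where i = "flip_bit (q div 2)" and j = "flip_bit (q div 2)"])
  show "cnj (f (flip_bit (q div 2) r)) * cop q g (flip_bit (q div 2) r) = cnj (cop q f r) * g r" for r
    by (simp add: cop_def phase_def jw_flip bit_simps cnj_jw)
qed (use assms flip_less[of "q div 2" n] in auto)

section \<open>Agreement with the Jordan-Wigner matrices\<close>

lemma maj_carrier: "maj n p \<in> carrier_mat (2 ^ n) (2 ^ n)"
  by (auto simp: maj_def cre_def ann_def mat_adjoint_def)

lemma sign_occ: "(-1) ^ (\<Sum>l<i. occ r l) = jw i r"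
  by (auto simp: power_sum jw_def occ_def bit_iff_odd intro!: prod.cong)

lemma occ_bit: "occ c i = of_bool (bit c i)"
  by (simp add: occ_def bit_iff_odd mod_2_eq_odd)

text \<open>\<open>ann\<close> lowers the index by \<open>2 ^ i\<close>; with bit \<open>i\<close>
  set there is no borrow, so this is the flip used by \<open>cop\<close>.\<close>

lemma flip_eq_diff: "r = c - 2 ^ i \<and> occ c i = 1 \<longleftrightarrow> r = flip_bit i c \<and> bit c i"
proof (cases "bit c i")
  case True
  have "set_bit i (flip_bit i c) = c"
    using True by (intro bit_eqI) (auto simp: bit_simps)
  moreover have "\<not> bit (flip_bit i c) i" using True by (simp add: bit_simps)
  ultimately have "c = flip_bit i c + 2 ^ i" using set_bit_eq[of i "flip_bit i c"] by simp
  then have "c - 2 ^ i = flip_bit i c" by linarith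
  with True show ?thesis by (simp add: occ_bit)
qed (simp add: occ_bit)

lemma mat_adjoint_index:
  fixes A :: "complex mat"
  shows "A \<in> carrier_mat a b \<Longrightarrow> i < b \<Longrightarrow> j < a \<Longrightarrow> mat_adjoint A $$ (i, j) = cnj (A $$ (j, i))"
  by (auto simp: mat_adjoint_def mat_of_rows_def)

text \<open>For two states related by the flip, exactly one of \<open>ann\<close> and
  \<open>cre\<close> has a nonzero entry. Bit \<open>q div 2\<close> of \<open>r\<close> tells
  which, and this is the case distinction in \<open>phase\<close>.\<close>

lemma maj_index:
  assumes q: "q < 2 * n" and r: "r < 2 ^ n" and c: "c < 2 ^ n"
  shows "maj n (Suc q) $$ (r, c) = (if c = flip_bit (q div 2) r then phase q r else 0)"
proof -
  define i where "i = q div 2"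
  have ann: "ann n (Suc i) $$ (r, c) = (if r = flip_bit i c \<and> bit c i then jw i c else 0)"
    if "r < 2 ^ n" "c < 2 ^ n" for r c
    using that flip_eq_diff[of r c i] by (auto simp: ann_def sign_occ)
  have cre: "cre n (Suc i) $$ (r, c) = cnj (ann n (Suc i) $$ (c, r))" if "r < 2 ^ n" "c < 2 ^ n" for r c
    unfolding cre_def by (rule mat_adjoint_index[of _ "2 ^ n" "2 ^ n"]) (use that in \<open>auto simp: ann_def\<close>)
  have flip: "c = flip_bit i r \<longleftrightarrow> r = flip_bit i c" by auto
  have i1: "(Suc q + 1) div 2 = Suc i" if "even q" using that by (simp add: i_def)
  have i2: "Suc q div 2 = Suc i" if "odd q" using that by (simp add: i_def)
  have dims: "ann n (Suc i) \<in> carrier_mat (2 ^ n) (2 ^ n)" "cre n (Suc i) \<in> carrier_mat (2 ^ n) (2 ^ n)"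
    by (auto simp: ann_def cre_def mat_adjoint_def)
  show ?thesis
  proof (cases "even q")
    case True
    have "maj n (Suc q) $$ (r, c) = ann n (Suc i) $$ (r, c) + cnj (ann n (Suc i) $$ (c, r))"
      using True i1 dims r c cre by (simp add: maj_def)
    then show ?thesis unfolding ann[OF r c] ann[OF c r] i_def[symmetric]
      using True by (auto simp: phase_def jw_flip cnj_jw bit_simps i_def[symmetric])
  next
    case False
    have "maj n (Suc q) $$ (r, c) = - \<i> * (ann n (Suc i) $$ (r, c) - cnj (ann n (Suc i) $$ (c, r)))"
      using False i2 dims r c cre by (simp add: maj_def)
    then show ?thesis unfolding ann[OF r c] ann[OF c r] i_def[symmetric]
      using False by (auto simp: phase_def jw_flip cnj_jw bit_simps i_def[symmetric])
  qed
qed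

section \<open>Field operators with complex coefficients\<close>

lemma sum_smul: "(\<Sum>k\<in>A. a k) *\<^sub>c f = (\<Sum>k\<in>A. a k *\<^sub>c f)"
  by (auto simp: fun_eq_iff sum_fun_apply sum_distrib_right)

text \<open>A field operator, linear in \<open>u\<close> without conjugation. Hence the
  anticommutator in \<open>cc_car\<close> is bilinear, and the adjoint in \<open>cc_adj\<close>
  conjugates \<open>u\<close>.\<close>

definition cc :: "nat \<Rightarrow> (nat \<Rightarrow> complex) \<Rightarrow> (nat \<Rightarrow> complex) \<Rightarrow> nat \<Rightarrow> complex"
  where "cc n u f = (\<Sum>q<2 * n. u q *\<^sub>c cop q f)"

lemma cc_clin: "clin (cc n u)"
  by (rule clinI)
    (simp_all add: cc_def clin_add[OF cop_clin] clin_smul[OF cop_clin] smul_distribs smul_sum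
      sum.distrib mult.commute)

lemma cc_vsp: "f \<in> vsp (2 ^ n) \<Longrightarrow> cc n u f \<in> vsp (2 ^ n)"
  unfolding cc_def by (intro vsp_sum vsp_simps cop_vsp) auto

lemma cc_opr: "opr (2 ^ n) (cc n u)"
  by (simp add: opr_def cc_clin cc_vsp)

lemma cc_add: "cc n (u + v) f = cc n u f + cc n v f"
  by (simp add: cc_def smul_distribs sum.distrib)

lemma cc_smul: "cc n (a *\<^sub>c u) f = a *\<^sub>c cc n u f"
  by (simp add: cc_def smul_sum)

lemma cc_zero: "cc n 0 f = 0"
  by (simp add: cc_def)

lemma cc_sum: "cc n (\<Sum>k\<in>A. u k) f = (\<Sum>k\<in>A. cc n (u k) f)"
  by (induction A rule: infinite_finite_induct)
    (simp_all add: cc_add cc_zero del: plus_fun_apply zero_fun_apply)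

lemma cc_single: "q < 2 * n \<Longrightarrow> cc n (\<lambda>p. of_bool (p = q)) f = cop q f"
proof -
  assume q: "q < 2 * n"
  have "cc n (\<lambda>p. of_bool (p = q)) f = (\<Sum>p<2 * n. if p = q then cop q f else 0)"
    unfolding cc_def by (intro sum.cong) auto
  with q show ?thesis by simp
qed

lemma cop_cc: "p < 2 * n \<Longrightarrow> cop p (cc n u f) = (2 * u p) *\<^sub>c f - cc n u (cop p f)"
proof -
  assume p: "p < 2 * n"
  have "cop p (cc n u f) + cc n u (cop p f) = (\<Sum>q<2 * n. u q *\<^sub>c (cop p (cop q f) + cop q (cop p f)))"
    by (simp add: cc_def clin_sum[OF cop_clin] clin_smul[OF cop_clin] smul_distribs sum.distrib)
  also have "\<dots> = (\<Sum>q<2 * n. if q = p then (2 * u p) *\<^sub>c f else 0)"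
    unfolding cop_car by (intro sum.cong) auto
  also have "\<dots> = (2 * u p) *\<^sub>c f" using p by simp
  finally show ?thesis by (simp add: eq_diff_eq)
qed

lemma cc_car: "cc n u (cc n v f) + cc n v (cc n u f) = (2 * (\<Sum>q<2 * n. u q * v q)) *\<^sub>c f"
proof -
  have "cc n u (cc n v f) = (\<Sum>p<2 * n. u p *\<^sub>c ((2 * v p) *\<^sub>c f - cc n v (cop p f)))"
    unfolding cc_def[of n u] by (intro sum.cong) (auto simp: cop_cc)
  also have "\<dots> = (\<Sum>p<2 * n. (2 * (u p * v p)) *\<^sub>c f) - cc n v (cc n u f)"
    by (simp add: cc_def[of n u] clin_sum[OF cc_clin] clin_smul[OF cc_clin] smul_distribs
        sum_subtractf mult_ac)
  finally show ?thesis
    by (simp add: fun_eq_iff sum_fun_apply sum_distrib_left sum_distrib_right)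
qed

lemma cc_adj: "ip (2 ^ n) (cc n u f) g = ip (2 ^ n) f (cc n (\<lambda>q. cnj (u q)) g)"
  unfolding cc_def ip_sum_left ip_sum_right
  by (intro sum.cong refl) (simp add: ip_simps cop_adj)

text \<open>For real coefficients the field operator is self-adjoint and squares to a scalar, so it
  is a multiple of an isometry.\<close>

lemma nrm_cc_real:
  "nrm (2 ^ n) (cc n (\<lambda>q. of_real (y q)) f) = sqrt (\<Sum>q<2 * n. (y q)\<^sup>2) * nrm (2 ^ n) f"
proof (rule power2_eq_imp_eq)
  let ?c = "cc n (\<lambda>q. complex_of_real (y q))"
  have "2 *\<^sub>c ?c (?c f) = (2 * (\<Sum>q<2 * n. of_real (y q) * of_real (y q))) *\<^sub>c f"
    unfolding cc_car[symmetric] by (simp add: fun_eq_iff)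
  then have sq: "?c (?c f) = of_real (\<Sum>q<2 * n. (y q)\<^sup>2) *\<^sub>c f"
    by (simp add: fun_eq_iff power2_eq_square mult.assoc)
  have "complex_of_real ((nrm (2 ^ n) (?c f))\<^sup>2) = ip (2 ^ n) f (?c (?c f))"
    unfolding ip_self[symmetric] cc_adj by simp
  also have "\<dots> = of_real ((\<Sum>q<2 * n. (y q)\<^sup>2) * (nrm (2 ^ n) f)\<^sup>2)"
    unfolding sq by (simp add: ip_simps ip_self del: of_real_sum)
  finally show "(nrm (2 ^ n) (?c f))\<^sup>2 = (sqrt (\<Sum>q<2 * n. (y q)\<^sup>2) * nrm (2 ^ n) f)\<^sup>2"
    unfolding of_real_eq_iff by (simp add: power_mult_distrib sum_nonneg)
qed (auto simp: sum_nonneg)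

section \<open>Quadratic Hamiltonians\<close>

definition quad :: "nat \<Rightarrow> (nat \<Rightarrow> nat \<Rightarrow> real) \<Rightarrow> (nat \<Rightarrow> complex) \<Rightarrow> nat \<Rightarrow> complex"
  where "quad n h f = (\<Sum>p<2 * n. \<Sum>q<2 * n. (\<i> / 4 * of_real (h p q)) *\<^sub>c cop p (cop q f))"

text \<open>The single-particle matrix i h, Hermitian for real antisymmetric \<open>h\<close>. The
  value 0 outside keeps the result in \<open>vsp (2 * n)\<close>.\<close>

definition ih :: "nat \<Rightarrow> (nat \<Rightarrow> nat \<Rightarrow> real) \<Rightarrow> (nat \<Rightarrow> complex) \<Rightarrow> nat \<Rightarrow> complex"
  where "ih n h u = (\<lambda>p. if p < 2 * n then \<Sum>q<2 * n. \<i> * of_real (h p q) * u q else 0)"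

definition antisym_on :: "nat \<Rightarrow> (nat \<Rightarrow> nat \<Rightarrow> real) \<Rightarrow> bool"
  where "antisym_on n h \<longleftrightarrow> (\<forall>p<2 * n. \<forall>q<2 * n. h p q = - h q p)"

lemma antisym_onD: "antisym_on n h \<Longrightarrow> p < 2 * n \<Longrightarrow> q < 2 * n \<Longrightarrow> h p q = - h q p"
  unfolding antisym_on_def by blast

lemma quad_clin: "clin (quad n h)"
  by (rule clinI)
    (simp_all add: quad_def clin_add[OF cop_clin] clin_smul[OF cop_clin] smul_distribs smul_sum
      sum.distrib mult_ac)

lemma quad_vsp: "f \<in> vsp (2 ^ n) \<Longrightarrow> quad n h f \<in> vsp (2 ^ n)"
  unfolding quad_def by (intro vsp_sum vsp_simps cop_vsp) auto

lemma quad_opr: "opr (2 ^ n) (quad n h)"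
  by (simp add: opr_def quad_clin quad_vsp)

lemma quad_selfadj:
  assumes h: "antisym_on n h"
  shows "selfadj (2 ^ n) (quad n h)"
  unfolding selfadj_def
proof (intro conjI ballI quad_opr)
  fix x y
  have "ip (2 ^ n) (quad n h x) y
      = (\<Sum>p<2 * n. \<Sum>q<2 * n. (\<i> / 4 * of_real (h q p)) * ip (2 ^ n) x (cop q (cop p y)))"
    unfolding quad_def ip_sum_left
  proof (intro sum.cong refl)
    fix p q assume pq: "p \<in> {..<2 * n}" "q \<in> {..<2 * n}"
    then have "h p q = - h q p" by (intro antisym_onD[OF h]) auto
    with pq show "ip (2 ^ n) ((\<i> / 4 * of_real (h p q)) *\<^sub>c cop p (cop q x)) y
        = \<i> / 4 * of_real (h q p) * ip (2 ^ n) x (cop q (cop p y))"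
      by (simp add: ip_simps cop_adj)
  qed
  also have "\<dots> = ip (2 ^ n) x (quad n h y)"
    unfolding quad_def ip_sum_right by (subst sum.swap) (simp add: ip_simps)
  finally show "ip (2 ^ n) x (quad n h y) = ip (2 ^ n) (quad n h x) y" by simp
qed

lemma ih_selfadj:
  assumes h: "antisym_on n h"
  shows "selfadj (2 * n) (ih n h)"
  unfolding selfadj_def opr_def
proof (intro conjI ballI clinI)
  fix x y :: "nat \<Rightarrow> complex" and a
  show "ih n h (x + y) = ih n h x + ih n h y" "ih n h (a *\<^sub>c x) = a *\<^sub>c ih n h x"
    by (auto simp: ih_def fun_eq_iff algebra_simps sum.distrib sum_distrib_left)
  show "ih n h x \<in> vsp (2 * n)" by (auto simp: ih_def vsp_def)
  have "ip (2 * n) x (ih n h y) = (\<Sum>p<2 * n. \<Sum>q<2 * n. cnj (x p) * (\<i> * of_real (h p q) * y q))"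
    by (simp add: ip_def ih_def sum_distrib_left)
  also have "\<dots> = (\<Sum>q<2 * n. \<Sum>p<2 * n. cnj (x p) * (\<i> * of_real (h p q) * y q))"
    by (rule sum.swap)
  also have "\<dots> = (\<Sum>q<2 * n. \<Sum>p<2 * n. cnj (\<i> * of_real (h q p) * x p) * y q)"
  proof (intro sum.cong refl)
    fix p q assume "q \<in> {..<2 * n}" "p \<in> {..<2 * n}"
    then have "h p q = - h q p" by (intro antisym_onD[OF h]) auto
    then show "cnj (x p) * (\<i> * of_real (h p q) * y q) = cnj (\<i> * of_real (h q p) * x p) * y q"
      by simp
  qed
  also have "\<dots> = ip (2 * n) (ih n h x) y"
    by (simp add: ip_def ih_def sum_distrib_right)
  finally show "ip (2 * n) x (ih n h y) = ip (2 * n) (ih n h x) y" .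
qed

text \<open>The commutator of a quadratic Hamiltonian with a field operator is again a field
  operator, so eigenvectors of \<open>ih\<close> give ladder operators.\<close>

lemma quad_cc:
  assumes h: "antisym_on n h"
  shows "quad n h (cc n u f) = cc n u (quad n h f) + cc n (ih n h u) f"
proof -
  have step: "cop p (cop q (cc n u f)) =
      cc n u (cop p (cop q f)) + ((2 * u q) *\<^sub>c cop p f - (2 * u p) *\<^sub>c cop q f)"
    if "p < 2 * n" "q < 2 * n" for p q
    using that
    by (simp add: cop_cc clin_diff[OF cop_clin] clin_smul[OF cop_clin])
  have "quad n h (cc n u f) = (\<Sum>p<2 * n. \<Sum>q<2 * n. (\<i> / 4 * of_real (h p q)) *\<^sub>c
      (cc n u (cop p (cop q f)) + ((2 * u q) *\<^sub>c cop p f - (2 * u p) *\<^sub>c cop q f)))"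
    unfolding quad_def by (intro sum.cong refl) (simp add: step)
  also have "\<dots> = cc n u (quad n h f)
      + ((\<Sum>p<2 * n. \<Sum>q<2 * n. (\<i> / 2 * of_real (h p q) * u q) *\<^sub>c cop p f)
        - (\<Sum>p<2 * n. \<Sum>q<2 * n. (\<i> / 2 * of_real (h p q) * u p) *\<^sub>c cop q f))"
    by (simp add: quad_def clin_sum[OF cc_clin] clin_smul[OF cc_clin] smul_distribs sum.distrib
        sum_subtractf mult_ac)
  \<comment> \<open>Antisymmetry makes the second sum the negative of the first; their difference
    doubles the prefactor \<open>\<i> / 2\<close> to the \<open>\<i>\<close> of
    \<open>ih\<close>.\<close>
  also have "(\<Sum>p<2 * n. \<Sum>q<2 * n. (\<i> / 2 * of_real (h p q) * u p) *\<^sub>c cop q f)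
      = (\<Sum>q<2 * n. \<Sum>p<2 * n. (- (\<i> / 2 * of_real (h q p) * u p)) *\<^sub>c cop q f)"
  proof (subst sum.swap, intro sum.cong refl)
    fix p q assume "q \<in> {..<2 * n}" "p \<in> {..<2 * n}"
    then have "h p q = - h q p" by (intro antisym_onD[OF h]) auto
    then show "(\<i> / 2 * of_real (h p q) * u p) *\<^sub>c cop q f
        = (- (\<i> / 2 * of_real (h q p) * u p)) *\<^sub>c cop q f"
      by simp
  qed
  also have "(\<Sum>p<2 * n. \<Sum>q<2 * n. (\<i> / 2 * of_real (h p q) * u q) *\<^sub>c cop p f) - \<dots>
      = cc n (ih n h u) f"
    unfolding cc_def
  proof (subst sum_subtractf[symmetric], intro sum.cong refl)
    fix p assume p: "p \<in> {..<2 * n}"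
    define A where "A = (\<lambda>q. \<i> / 2 * of_real (h p q) * u q)"
    have "(\<Sum>q<2 * n. A q *\<^sub>c cop p f) - (\<Sum>q<2 * n. (- A q) *\<^sub>c cop p f)
        = ((\<Sum>q<2 * n. A q) - (\<Sum>q<2 * n. - A q)) *\<^sub>c cop p f"
      by (simp only: sum_smul smul_distribs)
    also have "(\<Sum>q<2 * n. A q) - (\<Sum>q<2 * n. - A q) = ih n h u p"
      using p by (simp add: ih_def A_def sum_subtractf[symmetric] mult_ac)
    finally show "(\<Sum>q<2 * n. (\<i> / 2 * of_real (h p q) * u q) *\<^sub>c cop p f)
        - (\<Sum>q<2 * n. (- (\<i> / 2 * of_real (h p q) * u q)) *\<^sub>c cop p f) = ih n h u p *\<^sub>c cop p f"
      by (simp only: A_def)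
  qed
  finally show ?thesis .
qed

section \<open>Free fermions\<close>

context eigenbasis
begin

lemma exists_coef: "x \<in> vsp N \<Longrightarrow> x \<noteq> 0 \<Longrightarrow> \<exists>k<L. ip N (e k) x \<noteq> 0"
  using eq_coef[of x 0] by (auto simp: ip_simps)

lemma rayleigh:
  assumes x: "x \<in> vsp N" and d: "\<And>k. k < L \<Longrightarrow> \<delta> \<le> d k"
  shows "\<delta> * (nrm N x)\<^sup>2 \<le> Re (ip N x (T x))"
proof -
  have z: "Re (cnj z * (of_real a * z)) = a * (cmod z)\<^sup>2" for a z
    by (simp add: cmod_power2) (simp add: power2_eq_square algebra_simps)
  have "\<delta> * (nrm N x)\<^sup>2 = (\<Sum>k<L. \<delta> * (cmod (ip N (e k) x))\<^sup>2)"
    by (simp add: parseval[OF x] sum_distrib_left)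
  also have "\<dots> \<le> (\<Sum>k<L. d k * (cmod (ip N (e k) x))\<^sup>2)"
    using d by (intro sum_mono mult_right_mono) auto
  also have "\<dots> = Re (ip N x (T x))"
    unfolding ip_coef[OF x] Re_sum by (intro sum.cong refl) (simp only: coef_T[OF x] z lessThan_iff)
  finally show ?thesis .
qed

lemma d_nonneg:
  assumes "\<And>x. x \<in> vsp N \<Longrightarrow> 0 \<le> Re (ip N x (T x))" "k < L"
  shows "0 \<le> d k"
  using assms(1)[of "e k"] assms(2) by (simp add: eigen ip_simps ortho)

end

lemma lowest_eigenvector:
  assumes D: "selfadj N D" and "0 < N"
  shows "\<exists>\<delta> x. x \<in> vsp N \<and> x \<noteq> 0 \<and> D x = of_real \<delta> *\<^sub>c x \<and>
    (\<forall>y\<in>vsp N. \<delta> * (nrm N y)\<^sup>2 \<le> Re (ip N y (D y)))"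
proof -
  obtain L e d where "eigenbasis N D L e d" using spectral_theorem[OF D] by blast
  then interpret eigenbasis N D L e d .
  define v :: "nat \<Rightarrow> complex" where "v = (\<lambda>i. of_bool (i = 0))"
  have "v \<in> vsp N" "v \<noteq> 0" using \<open>0 < N\<close> by (auto simp: v_def vsp_def fun_eq_iff)
  then obtain k0 where "k0 < L" using exists_coef by blast
  then have ne: "d ` {..<L} \<noteq> {}" by auto
  obtain j where j: "j < L" "d j = Min (d ` {..<L})"
    using Min_in[OF _ ne] by auto
  have "e j \<noteq> 0" using ortho[of j j] j by (auto simp: ip_simps)
  moreover have "d j * (nrm N y)\<^sup>2 \<le> Re (ip N y (D y))" if "y \<in> vsp N" for y
    using that by (rule rayleigh) (simp add: j)
  ultimately show ?thesis using j eigen e_vsp by blast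
qed

locale free_fermions = eigenbasis "2 * n" "ih n h" L u lam
  for n :: nat and h :: "nat \<Rightarrow> nat \<Rightarrow> real" and L u lam +
  assumes antisym: "antisym_on n h"
begin

text \<open>Conjugating an eigenvector of \<open>ih\<close> negates its eigenvalue, since
  \<open>ih\<close> is \<open>\<i>\<close> times a real matrix. So \<open>w k\<close> always has
  eigenvalue \<open>- \<bar>lam k\<bar>\<close>, and its field operator lowers the energy.\<close>

definition w :: "nat \<Rightarrow> nat \<Rightarrow> complex"
  where "w k = (if 0 < lam k then \<lambda>q. cnj (u k q) else u k)"

text \<open>Quasi-particle annihilation operators. Every positive mode appears twice, once for each sign of
  the eigenvalue of \<open>\<i>h\<close>; this is harmless and avoids pairing eigenvectors.\<close>

definition lower :: "nat \<Rightarrow> (nat \<Rightarrow> complex) \<Rightarrow> nat \<Rightarrow> complex"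
  where "lower k = cc n (w k)"

definition raise :: "nat \<Rightarrow> (nat \<Rightarrow> complex) \<Rightarrow> nat \<Rightarrow> complex"
  where "raise k = cc n (\<lambda>q. cnj (w k q))"

text \<open>Minus the lowest eigenvalue of \<open>quad n h\<close>: by \<open>ham_nonneg\<close> and
  \<open>joint_vacuum\<close> the lowest eigenvalue of \<open>ham\<close> is 0.\<close>

definition vac :: real
  where "vac = (\<Sum>k<L. \<bar>lam k\<bar>) / 4"

definition ham :: "(nat \<Rightarrow> complex) \<Rightarrow> nat \<Rightarrow> complex"
  where "ham f = quad n h f + of_real vac *\<^sub>c f"

lemma ih_entry:
  assumes "p < 2 * n" "q < 2 * n"
  shows "\<i> * of_real (h p q) = (\<Sum>k<L. of_real (lam k) * u k p * cnj (u k q))"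
proof -
  define v :: "nat \<Rightarrow> complex" where "v = (\<lambda>i. of_bool (i = q))"
  have v: "v \<in> vsp (2 * n)" using assms by (simp add: v_def vsp_def)
  have coef: "ip (2 * n) (u k) v = cnj (u k q)" for k
    using assms by (simp add: ip_def v_def of_bool_def if_distrib cong: if_cong)
  have "\<i> * of_real (h p q) = ih n h v p"
    using assms by (simp add: ih_def v_def of_bool_def if_distrib cong: if_cong)
  also have "\<dots> = (\<Sum>k<L. ip (2 * n) (u k) (ih n h v) *\<^sub>c u k) p"
    using expand[OF T_vsp[OF v]] by simp
  also have "\<dots> = (\<Sum>k<L. of_real (lam k) * u k p * cnj (u k q))"
    unfolding sum_fun_apply
    by (intro sum.cong refl) (simp add: coef_T[OF v] coef)
  finally show ?thesis .
qed

lemma cc_cc: "cc n a (cc n b f) = (\<Sum>p<2 * n. \<Sum>q<2 * n. (a p * b q) *\<^sub>c cop p (cop q f))"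
  by (simp add: cc_def clin_sum[OF cop_clin] clin_smul[OF cop_clin] smul_sum)

lemma u_unit: "k < L \<Longrightarrow> (\<Sum>q<2 * n. u k q * cnj (u k q)) = 1"
  using ortho[of k k] by (simp add: ip_def mult.commute)

text \<open>The spectral decomposition of \<open>ih\<close> writes
  \<open>4 *\<^sub>c quad n h f\<close> as the sum of \<open>lam k\<close> times \<open>X k\<close>,
  and antisymmetry gives the same with \<open>Y k\<close> and a minus sign. Averaging both and using
  \<open>X k + Y k = 2 *\<^sub>c f\<close> leaves a nonnegative multiple of
  \<open>raise k (lower k f)\<close> for each \<open>k\<close>, and constants cancelled by
  \<open>vac\<close>.\<close>

lemma ham_normal_form:
  "ham f = (\<Sum>k<L. of_real (\<bar>lam k\<bar> / 4) *\<^sub>c raise k (lower k f))"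
proof -
  define X where "X = (\<lambda>k. cc n (u k) (cc n (\<lambda>q. cnj (u k q)) f))"
  define Y where "Y = (\<lambda>k. cc n (\<lambda>q. cnj (u k q)) (cc n (u k) f))"
  have XY: "X k + Y k = 2 *\<^sub>c f" if "k < L" for k
    unfolding X_def Y_def cc_car using u_unit[OF that] by simp
  have X: "(\<Sum>k<L. of_real (lam k) *\<^sub>c X k) = 4 *\<^sub>c quad n h f"
  proof -
    have "(\<Sum>k<L. of_real (lam k) *\<^sub>c X k) = (\<Sum>k<L. \<Sum>p<2 * n. \<Sum>q<2 * n.
        (of_real (lam k) * u k p * cnj (u k q)) *\<^sub>c cop p (cop q f))"
      by (simp add: X_def cc_cc smul_sum mult_ac)
    also have "\<dots> = (\<Sum>p<2 * n. \<Sum>q<2 * n.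
        (\<Sum>k<L. of_real (lam k) * u k p * cnj (u k q)) *\<^sub>c cop p (cop q f))"
      unfolding sum_smul by (rule trans[OF sum.swap sum.cong[OF refl sum.swap]])
    also have "\<dots> = 4 *\<^sub>c quad n h f"
      unfolding quad_def smul_sum by (intro sum.cong refl) (simp add: ih_entry[symmetric])
    finally show ?thesis .
  qed
  have Y: "(\<Sum>k<L. of_real (lam k) *\<^sub>c Y k) = (-4) *\<^sub>c quad n h f"
  proof -
    have "(\<Sum>k<L. of_real (lam k) *\<^sub>c Y k) = (\<Sum>k<L. \<Sum>p<2 * n. \<Sum>q<2 * n.
        (of_real (lam k) * u k q * cnj (u k p)) *\<^sub>c cop p (cop q f))"
      by (simp add: Y_def cc_cc smul_sum mult_ac)
    also have "\<dots> = (\<Sum>p<2 * n. \<Sum>q<2 * n.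
        (\<Sum>k<L. of_real (lam k) * u k q * cnj (u k p)) *\<^sub>c cop p (cop q f))"
      unfolding sum_smul by (rule trans[OF sum.swap sum.cong[OF refl sum.swap]])
    also have "\<dots> = (-4) *\<^sub>c quad n h f"
      unfolding quad_def smul_sum
    proof (intro sum.cong refl)
      fix p q assume pq: "p \<in> {..<2 * n}" "q \<in> {..<2 * n}"
      then have "h p q = - h q p" by (intro antisym_onD[OF antisym]) auto
      with pq show "(\<Sum>k<L. of_real (lam k) * u k q * cnj (u k p)) *\<^sub>c cop p (cop q f)
          = (-4) *\<^sub>c (\<i> / 4 * of_real (h p q)) *\<^sub>c cop p (cop q f)"
        by (simp add: ih_entry[symmetric])
    qed
    finally show ?thesis .
  qed
  \<comment> \<open>The sign of \<open>lam k\<close> decides which of \<open>X k\<close> and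
    \<open>Y k\<close> is \<open>raise k (lower k f)\<close>; the other one is eliminated.\<close>
  have one: "2 * (\<bar>lam k\<bar> / 4 * raise k (lower k f) r) = lam k / 4 * (X k r - Y k r) + \<bar>lam k\<bar> / 2 * f r"
    if "k < L" for k r
  proof (cases "0 < lam k")
    case True
    have "Y k r = 2 * f r - X k r" using fun_cong[OF XY[OF that], of r] by (simp add: algebra_simps)
    moreover have "raise k (lower k f) r = X k r" using True by (simp add: raise_def lower_def w_def X_def)
    ultimately show ?thesis using True by (simp only: abs_of_pos) (simp add: field_simps)
  next
    case False
    have "X k r = 2 * f r - Y k r" using fun_cong[OF XY[OF that], of r] by (simp add: algebra_simps)
    moreover have "raise k (lower k f) r = Y k r" using False by (simp add: raise_def lower_def w_def Y_def)
    moreover have "\<bar>lam k\<bar> = - lam k" using False by simp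
    ultimately show ?thesis by (simp only:) (simp add: field_simps)
  qed
  show ?thesis
  proof
    fix r
    have "2 * (\<Sum>k<L. of_real (\<bar>lam k\<bar> / 4) *\<^sub>c raise k (lower k f)) r
        = (\<Sum>k<L. lam k / 4 * (X k r - Y k r) + \<bar>lam k\<bar> / 2 * f r)"
      unfolding sum_fun_apply sum_distrib_left by (intro sum.cong refl) (use one in simp)
    also have "\<dots> = ((\<Sum>k<L. of_real (lam k) *\<^sub>c X k) r - (\<Sum>k<L. of_real (lam k) *\<^sub>c Y k) r) / 4
        + 2 * of_real vac * f r"
      by (simp add: sum_fun_apply sum.distrib sum_subtractf[symmetric] sum_divide_distrib vac_def
          sum_distrib_right sum_distrib_left algebra_simps)
    also have "\<dots> = 2 * ham f r"
      unfolding X Y by (simp add: ham_def algebra_simps)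
    finally show "ham f r = (\<Sum>k<L. of_real (\<bar>lam k\<bar> / 4) *\<^sub>c raise k (lower k f)) r" by simp
  qed
qed

lemma ham_opr: "opr (2 ^ n) ham"
  unfolding opr_def
proof (intro conjI ballI clinI)
  fix f g a
  show "ham (f + g) = ham f + ham g" "ham (a *\<^sub>c f) = a *\<^sub>c ham f"
    by (auto simp: ham_def clin_add[OF quad_clin] clin_smul[OF quad_clin] smul_distribs mult.commute)
  show "f \<in> vsp (2 ^ n) \<Longrightarrow> ham f \<in> vsp (2 ^ n)" by (simp add: ham_def quad_vsp)
qed

lemma ham_selfadj: "selfadj (2 ^ n) ham"
  using quad_selfadj[OF antisym] ham_opr by (auto simp: selfadj_def ham_def ip_simps)

lemma ham_nonneg: "0 \<le> Re (ip (2 ^ n) x (ham x))"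
proof -
  have "ip (2 ^ n) x (raise k (lower k x)) = of_real ((nrm (2 ^ n) (lower k x))\<^sup>2)" for k
    unfolding ip_self[symmetric] by (simp add: raise_def lower_def cc_adj)
  then have "ip (2 ^ n) x (ham x) = of_real (\<Sum>k<L. \<bar>lam k\<bar> / 4 * (nrm (2 ^ n) (lower k x))\<^sup>2)"
    unfolding ham_normal_form by (simp add: ip_sum_right ip_simps)
  then show ?thesis by (simp add: sum_nonneg del: of_real_sum)
qed

lemma ih_w: "k < L \<Longrightarrow> ih n h (w k) = of_real (- \<bar>lam k\<bar>) *\<^sub>c w k"
proof -
  assume k: "k < L"
  have "ih n h (\<lambda>q. cnj (u k q)) p = - cnj (ih n h (u k) p)" for p
    by (simp add: ih_def sum_negf)
  then have "ih n h (\<lambda>q. cnj (u k q)) = of_real (- lam k) *\<^sub>c (\<lambda>q. cnj (u k q))"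
    using k by (simp add: fun_eq_iff eigen)
  with k show ?thesis by (simp add: w_def eigen)
qed

lemma ham_lower: "k < L \<Longrightarrow> ham (lower k f) = lower k (ham f) - of_real \<bar>lam k\<bar> *\<^sub>c lower k f"
  by (simp add: ham_def lower_def quad_cc[OF antisym] ih_w cc_smul clin_add[OF cc_clin]
      clin_smul[OF cc_clin]) (simp add: fun_eq_iff)

text \<open>Within a common eigenspace, a vector of least \<open>ham\<close>-energy is annihilated by every \<open>lower k\<close>.\<close>

lemma joint_vacuum:
  assumes D: "selfadj (2 ^ n) D"
    and D_quad: "\<And>f. f \<in> vsp (2 ^ n) \<Longrightarrow> D (quad n h f) = quad n h (D f)"
    and D_lower: "\<And>k f. k < L \<Longrightarrow> lam k \<noteq> 0 \<Longrightarrow> f \<in> vsp (2 ^ n) \<Longrightarrow> D (lower k f) = lower k (D f)"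
  shows "\<exists>\<phi> \<delta>. \<phi> \<in> vsp (2 ^ n) \<and> nrm (2 ^ n) \<phi> = 1 \<and> ham \<phi> = 0 \<and> D \<phi> = of_real \<delta> *\<^sub>c \<phi> \<and>
    (\<forall>y\<in>vsp (2 ^ n). \<delta> * (nrm (2 ^ n) y)\<^sup>2 \<le> Re (ip (2 ^ n) y (D y)))"
proof -
  let ?N = "2 ^ n :: nat"
  note Dlin = selfadjD(2)[OF D]
  have llin: "clin (lower k)" and lv: "\<And>f. f \<in> vsp ?N \<Longrightarrow> lower k f \<in> vsp ?N" for k
    by (simp_all add: lower_def cc_clin cc_vsp)
  have rlin: "clin (raise k)" for k by (simp add: raise_def cc_clin)
  have D_ham: "D (ham f) = ham (D f)" if "f \<in> vsp ?N" for f
    using D_quad[OF that] by (simp add: ham_def clin_add[OF Dlin] clin_smul[OF Dlin])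
  obtain \<delta> x where x: "x \<in> vsp ?N" "x \<noteq> 0" "D x = of_real \<delta> *\<^sub>c x"
    and \<delta>: "\<forall>y\<in>vsp ?N. \<delta> * (nrm ?N y)\<^sup>2 \<le> Re (ip ?N y (D y))"
    using lowest_eigenvector[OF D] by auto
  obtain L2 e2 d2 where "eigenbasis ?N ham L2 e2 d2" using spectral_theorem[OF ham_selfadj] by blast
  then interpret B: eigenbasis ?N ham L2 e2 d2 .
  \<comment> \<open>The levels of \<open>ham\<close> that occur inside the
    \<open>\<delta>\<close>-eigenspace of \<open>D\<close>; finiteness allows a least one to be
    picked.\<close>
  define K where "K = {k. k < L2 \<and> (\<exists>y\<in>vsp ?N. y \<noteq> 0 \<and> D y = of_real \<delta> *\<^sub>c y \<and> ham y = of_real (d2 k) *\<^sub>c y)}"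
  have fin: "finite K" by (simp add: K_def)
  obtain k1 where k1: "k1 < L2" "ip ?N (e2 k1) x \<noteq> 0" using B.exists_coef x by blast
  have "k1 \<in> K"
  proof -
    \<comment> \<open>The component of \<open>x\<close> in one eigenspace of \<open>ham\<close>
      still belongs to the \<open>\<delta>\<close>-eigenspace, since \<open>D\<close> commutes with
      \<open>ham\<close>.\<close>
    define y where "y = B.sp {d2 k1} x"
    have y: "y \<in> vsp ?N" by (simp add: y_def)
    have "D y = B.sp {d2 k1} (D x)"
      unfolding y_def by (rule B.sp_commute[OF selfadjD(1)[OF D] D_ham x(1), symmetric])
    also have "\<dots> = of_real \<delta> *\<^sub>c y" by (simp add: x y_def clin_smul[OF B.sp_clin])
    finally have Dy: "D y = of_real \<delta> *\<^sub>c y" .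
    have "ip ?N (e2 k1) y \<noteq> 0" using k1 by (simp add: y_def B.coef_sp)
    then have "y \<noteq> 0" by (auto simp: ip_simps)
    moreover have "ham y = of_real (d2 k1) *\<^sub>c y"
      by (rule B.eq_coef) (auto simp: y B.T_vsp B.coef_T[OF y] ip_simps, auto simp: y_def B.coef_sp)
    ultimately show ?thesis using y Dy k1 by (auto simp: K_def)
  qed
  then have "K \<noteq> {}" by auto
  obtain k0 where k0: "k0 \<in> K" "\<And>k. k \<in> K \<Longrightarrow> d2 k0 \<le> d2 k"
    using arg_min_if_finite[OF fin \<open>K \<noteq> {}\<close>, of d2] by (meson not_le)
  then obtain y where y: "y \<in> vsp ?N" "y \<noteq> 0" "D y = of_real \<delta> *\<^sub>c y" "ham y = of_real (d2 k0) *\<^sub>c y"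
    by (auto simp: K_def)
  have low0: "lower j y = 0" if j: "j < L" "lam j \<noteq> 0" for j
  proof (rule ccontr)
    \<comment> \<open>Then \<open>lower j y\<close> is a common eigenvector with energy less by
      \<open>\<bar>lam j\<bar>\<close>, against the choice of \<open>k0\<close>.\<close>
    assume z0: "lower j y \<noteq> 0"
    obtain k where k: "k < L2" "ip ?N (e2 k) (lower j y) \<noteq> 0"
      using B.exists_coef[OF lv[OF y(1)] z0] by blast
    have hz: "ham (lower j y) = of_real (d2 k0 - \<bar>lam j\<bar>) *\<^sub>c lower j y"
      by (simp add: ham_lower[OF j(1)] y clin_smul[OF llin] smul_distribs)
    have "of_real (d2 k) * ip ?N (e2 k) (lower j y) = of_real (d2 k0 - \<bar>lam j\<bar>) * ip ?N (e2 k) (lower j y)"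
      using B.coef_T[OF lv[OF y(1)] k(1), of j] by (simp only: hz ip_simps)
    then have dk: "d2 k = d2 k0 - \<bar>lam j\<bar>" using k by (simp only: mult_cancel_right of_real_eq_iff) auto
    have "D (lower j y) = of_real \<delta> *\<^sub>c lower j y"
      using j by (simp add: D_lower y clin_smul[OF llin])
    then have "k \<in> K" using k z0 lv[OF y(1)] hz unfolding K_def dk[symmetric] by blast
    then show False using k0(2)[of k] dk j by simp
  qed
  have "ham y = 0"
    unfolding ham_normal_form
  proof (intro sum.neutral ballI)
    \<comment> \<open>Modes with \<open>lam k = 0\<close> disappear through their coefficient; the
      others annihilate \<open>y\<close>.\<close>
    fix k assume "k \<in> {..<L}"
    then show "of_real (\<bar>lam k\<bar> / 4) *\<^sub>c raise k (lower k y) = 0"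
      using low0[of k] by (cases "lam k = 0") (auto simp: clin_zero[OF rlin])
  qed
  moreover have "nrm ?N y \<noteq> 0" using nrm_eq_0 y by blast
  ultimately show ?thesis
    using y \<delta>
    by (intro exI[of _ "of_real (1 / nrm ?N y) *\<^sub>c y"] exI[of _ \<delta>])
      (auto simp: nrm_smul norm_divide clin_smul[OF B.T_clin] clin_smul[OF Dlin] mult.commute)
qed

end

section \<open>Impurities\<close>

lemma nrm_cop: "q < 2 * n \<Longrightarrow> nrm (2 ^ n) (cop q f) = nrm (2 ^ n) f"
proof -
  assume q: "q < 2 * n"
  have "cop q (cop q f) = f" using cop_car[of q q f] by (auto simp: fun_eq_iff)
  then have "complex_of_real ((nrm (2 ^ n) (cop q f))\<^sup>2) = of_real ((nrm (2 ^ n) f)\<^sup>2)"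
    unfolding ip_self[symmetric] by (simp add: cop_adj[OF q])
  then show ?thesis by (simp only: of_real_eq_iff) (simp add: power2_eq_iff_nonneg)
qed

definition mono :: "bool list \<Rightarrow> (nat \<Rightarrow> complex) \<Rightarrow> nat \<Rightarrow> complex"
  where "mono x f = foldr (\<lambda>i g. if x ! i then cop i g else g) [0..<length x] f"

definition imp :: "nat \<Rightarrow> (bool list \<Rightarrow> complex) \<Rightarrow> (nat \<Rightarrow> complex) \<Rightarrow> nat \<Rightarrow> complex"
  where "imp m g f = (\<Sum>x\<in>{x. length x = m \<and> even (hamming_weight x)}. g x *\<^sub>c mono x f)"

lemma mono_clin: "clin (mono x)"
proof -
  have "clin (\<lambda>f. foldr (\<lambda>i g. if x ! i then cop i g else g) is f)" for "is"
    by (induction "is") (auto simp: clin_def clin_add[OF cop_clin] clin_smul[OF cop_clin])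
  then show ?thesis by (simp add: mono_def[abs_def])
qed

lemma mono_vsp: "f \<in> vsp (2 ^ n) \<Longrightarrow> length x \<le> 2 * n \<Longrightarrow> mono x f \<in> vsp (2 ^ n)"
proof -
  assume f: "f \<in> vsp (2 ^ n)" and x: "length x \<le> 2 * n"
  have "foldr (\<lambda>i g. if x ! i then cop i g else g) is f \<in> vsp (2 ^ n)" if "set is \<subseteq> {..<2 * n}" for "is"
    using that f by (induction "is") (auto simp: cop_vsp)
  moreover have "set [0..<length x] \<subseteq> {..<2 * n}" using x by auto
  ultimately show ?thesis unfolding mono_def by blast
qed

lemma imp_opr: "m \<le> 2 * n \<Longrightarrow> opr (2 ^ n) (imp m g)"
  unfolding opr_def
proof (intro conjI ballI clinI)
  fix f h a
  show "imp m g (f + h) = imp m g f + imp m g h" "imp m g (a *\<^sub>c f) = a *\<^sub>c imp m g f"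
    by (simp_all add: imp_def clin_add[OF mono_clin] clin_smul[OF mono_clin] smul_distribs smul_sum
        sum.distrib mult.commute)
  show "m \<le> 2 * n \<Longrightarrow> f \<in> vsp (2 ^ n) \<Longrightarrow> imp m g f \<in> vsp (2 ^ n)"
    unfolding imp_def by (intro vsp_sum vsp_simps mono_vsp) auto
qed

lemma hamming_weight_nth: "hamming_weight x = length (filter (\<lambda>i. x ! i) [0..<length x])"
proof -
  have "filter id x = filter id (map ((!) x) [0..<length x])" by (simp add: map_nth)
  then show ?thesis by (simp add: hamming_weight_def filter_map o_def)
qed

text \<open>\<open>u\<close> vanishes on the indices that \<open>x\<close> can use, so each Majorana
  of the monomial anticommutes past \<open>cc n u\<close>; an even number of signs cancels.\<close>

lemma mono_cc:
  assumes x: "length x \<le> m" "m \<le> 2 * n" "even (hamming_weight x)" and u: "\<And>p. p < m \<Longrightarrow> u p = 0"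
  shows "mono x (cc n u f) = cc n u (mono x f)"
proof -
  have "foldr (\<lambda>i g. if x ! i then cop i g else g) is (cc n u f)
      = (-1) ^ length (filter (\<lambda>i. x ! i) is) *\<^sub>c cc n u (foldr (\<lambda>i g. if x ! i then cop i g else g) is f)"
    if "set is \<subseteq> {..<m}" for "is"
    using that
  proof (induction "is")
    case (Cons i "is")
    have "i < 2 * n" "u i = 0" using Cons.prems x u by auto
    then have "cop i (cc n u z) = (-1) *\<^sub>c cc n u (cop i z)" for z
      by (simp add: cop_cc) (simp add: fun_eq_iff)
    moreover have "set is \<subseteq> {..<m}" using Cons.prems by simp
    note Cons.IH[OF this]
    ultimately show ?case by (simp add: clin_smul[OF cop_clin] del: smul_apply)
  qed simp
  moreover have "set [0..<length x] \<subseteq> {..<m}" using x by auto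
  ultimately show ?thesis
    unfolding mono_def using x(3) by (simp only: hamming_weight_nth[symmetric]) simp
qed

lemma imp_cc:
  assumes "m \<le> 2 * n" "\<And>p. p < m \<Longrightarrow> u p = 0"
  shows "imp m g (cc n u f) = cc n u (imp m g f)"
  unfolding imp_def clin_sum[OF cc_clin] clin_smul[OF cc_clin]
  by (intro sum.cong refl) (use assms in \<open>simp add: mono_cc[of _ m]\<close>)

lemma imp_cop: "m \<le> q \<Longrightarrow> q < 2 * n \<Longrightarrow> imp m g (cop q f) = cop q (imp m g f)"
  using imp_cc[of m n "\<lambda>p. of_bool (p = q)" g f] by (simp add: cc_single)

section \<open>Decoupling the impurity\<close>

definition bath :: "nat \<Rightarrow> (nat \<Rightarrow> nat \<Rightarrow> real) \<Rightarrow> nat \<Rightarrow> nat \<Rightarrow> real"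
  where "bath m h p q = (if p < m \<or> q < m then 0 else h p q)"

lemma bath_antisym:
  assumes "antisym_on n h"
  shows "antisym_on n (bath m h)"
  unfolding antisym_on_def
proof (intro allI impI)
  fix p q assume "p < 2 * n" "q < 2 * n"
  then have "h p q = - h q p" by (rule antisym_onD[OF assms])
  then show "bath m h p q = - bath m h q p" by (simp add: bath_def)
qed

lemma imp_quad_bath:
  assumes m: "m \<le> 2 * n"
  shows "imp m g (quad n (bath m h) f) = quad n (bath m h) (imp m g f)"
proof -
  have lin: "clin (imp m g)" using imp_opr[OF m] by (simp add: opr_def)
  show ?thesis
    unfolding quad_def clin_sum[OF lin] clin_smul[OF lin]
  proof (intro sum.cong refl)
    fix p q assume "p \<in> {..<2 * n}" "q \<in> {..<2 * n}"
    then show "(\<i> / 4 * of_real (bath m h p q)) *\<^sub>c imp m g (cop p (cop q f))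
        = (\<i> / 4 * of_real (bath m h p q)) *\<^sub>c cop p (cop q (imp m g f))"
      by (cases "p < m \<or> q < m") (auto simp: bath_def imp_cop)
  qed
qed

definition contraction :: "nat \<Rightarrow> (nat \<Rightarrow> nat \<Rightarrow> real) \<Rightarrow> bool"
  where "contraction N h \<longleftrightarrow> (\<forall>y. (\<Sum>p<N. (\<Sum>q<N. h p q * y q)\<^sup>2) \<le> (\<Sum>q<N. (y q)\<^sup>2))"

text \<open>\<open>bath m h\<close> is \<open>h\<close> compressed by a coordinate projection on
  both sides, which does not increase the norm.\<close>

lemma contraction_bath:
  assumes "contraction N h"
  shows "contraction N (bath m h)"
  unfolding contraction_def
proof
  fix y :: "nat \<Rightarrow> real"
  define z where "z = (\<lambda>q. if q < m then 0 else y q)"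
  have "(\<Sum>p<N. (\<Sum>q<N. bath m h p q * y q)\<^sup>2) \<le> (\<Sum>p<N. (\<Sum>q<N. h p q * z q)\<^sup>2)"
  proof (rule sum_mono)
    fix p
    show "(\<Sum>q<N. bath m h p q * y q)\<^sup>2 \<le> (\<Sum>q<N. h p q * z q)\<^sup>2"
    proof (cases "p < m")
      case False
      then have "(\<Sum>q<N. bath m h p q * y q) = (\<Sum>q<N. h p q * z q)"
        by (intro sum.cong) (auto simp: bath_def z_def)
      then show ?thesis by simp
    qed (simp add: bath_def)
  qed
  also have "\<dots> \<le> (\<Sum>q<N. (z q)\<^sup>2)" using assms by (simp add: contraction_def)
  also have "\<dots> \<le> (\<Sum>q<N. (y q)\<^sup>2)" by (intro sum_mono) (simp add: z_def)
  finally show "(\<Sum>p<N. (\<Sum>q<N. bath m h p q * y q)\<^sup>2) \<le> (\<Sum>q<N. (y q)\<^sup>2)" .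
qed

lemma contraction_column:
  assumes "contraction N h" "q < N"
  shows "(\<Sum>p<N. (h p q)\<^sup>2) \<le> 1"
proof -
  have "(\<Sum>p<N. (\<Sum>i<N. h p i * of_bool (i = q))\<^sup>2) \<le> (\<Sum>i<N. (of_bool (i = q))\<^sup>2)"
    by (rule assms(1)[unfolded contraction_def, THEN spec, of "\<lambda>i. of_bool (i = q)"])
  moreover have "(\<Sum>i<N. h p i * of_bool (i = q)) = h p q" for p
    using assms(2) by (simp add: of_bool_def if_distrib cong: if_cong)
  moreover have "(\<Sum>i<N. (of_bool (i = q))\<^sup>2) = (\<Sum>i<N. if i = q then 1 else 0 :: real)"
    by (intro sum.cong) auto
  ultimately show ?thesis using assms(2) by simp
qed

text \<open>\<open>contraction\<close> speaks of real vectors; a real matrix acts separately on real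
  and imaginary parts, so the bound extends to complex ones.\<close>

lemma nrm_ih:
  assumes h: "contraction (2 * n) h"
  shows "nrm (2 * n) (ih n h x) \<le> nrm (2 * n) x"
proof (rule power2_le_imp_le)
  have ihx: "ih n h x p = \<i> * Complex (\<Sum>q<2 * n. h p q * Re (x q)) (\<Sum>q<2 * n. h p q * Im (x q))"
    if "p < 2 * n" for p
  proof -
    have "\<i> * of_real (h p q) * x q = \<i> * Complex (h p q * Re (x q)) (h p q * Im (x q))" for q
      by (simp add: complex_eq_iff)
    then have "ih n h x p = \<i> * (\<Sum>q<2 * n. Complex (h p q * Re (x q)) (h p q * Im (x q)))"
      using that by (simp only: ih_def if_True sum_distrib_left)
    also have "(\<Sum>q<2 * n. Complex (h p q * Re (x q)) (h p q * Im (x q)))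
        = Complex (\<Sum>q<2 * n. h p q * Re (x q)) (\<Sum>q<2 * n. h p q * Im (x q))"
      by (simp add: complex_eq_iff)
    finally show ?thesis .
  qed
  have "(nrm (2 * n) (ih n h x))\<^sup>2
      = (\<Sum>p<2 * n. (\<Sum>q<2 * n. h p q * Re (x q))\<^sup>2) + (\<Sum>p<2 * n. (\<Sum>q<2 * n. h p q * Im (x q))\<^sup>2)"
    unfolding nrm_sq sum.distrib[symmetric]
    by (intro sum.cong refl) (simp only: ihx lessThan_iff norm_mult cmod_power2 complex.sel norm_ii mult_1)
  also have "\<dots> \<le> (\<Sum>q<2 * n. (Re (x q))\<^sup>2) + (\<Sum>q<2 * n. (Im (x q))\<^sup>2)"
    using h unfolding contraction_def by (intro add_mono) auto
  also have "\<dots> = (nrm (2 * n) x)\<^sup>2"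
    by (simp add: nrm_sq cmod_power2 sum.distrib)
  finally show "(nrm (2 * n) (ih n h x))\<^sup>2 \<le> (nrm (2 * n) x)\<^sup>2" .
qed simp

text \<open>Grouping by rows here, and by columns in \<open>quad_columns\<close>, leaves one product
  of an isometric Majorana and a real field operator per index, whose norm
  \<open>nrm_cc_real\<close> gives exactly.\<close>

lemma quad_rows: "quad n h f = (\<Sum>p<2 * n. (\<i> / 4) *\<^sub>c cop p (cc n (\<lambda>q. of_real (h p q)) f))"
  by (simp add: quad_def cc_def clin_sum[OF cop_clin] clin_smul[OF cop_clin] smul_sum)

lemma quad_columns: "quad n h f = (\<Sum>q<2 * n. (\<i> / 4) *\<^sub>c cc n (\<lambda>p. of_real (h p q)) (cop q f))"
  unfolding quad_def by (subst sum.swap) (simp add: cc_def smul_sum)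

lemma quad_add: "quad n (\<lambda>p q. h p q + h' p q) f = quad n h f + quad n h' f"
  by (simp add: quad_def smul_distribs sum.distrib distrib_left)

text \<open>Removing the first \<open>m\<close> rows and columns of \<open>h\<close> changes the Hamiltonian by \<open>2m\<close> products of
  two fermionic fields, each of norm at most \<open>1/4\<close>.\<close>

lemma nrm_quad_impurity:
  assumes h: "antisym_on n h" "contraction (2 * n) h" and m: "m \<le> 2 * n"
  shows "nrm (2 ^ n) (quad n (\<lambda>p q. h p q - bath m h p q) f) \<le> real m / 2 * nrm (2 ^ n) f"
proof -
  let ?N = "2 ^ n :: nat"
  \<comment> \<open>Full rows go to \<open>a\<close>, the remaining part of the columns to
    \<open>b\<close>: the corner is counted once, and truncating a column only decreases its
    norm.\<close>
  define a where "a = (\<lambda>p q. if p < m then h p q else 0)"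
  define b where "b = (\<lambda>p q. if q < m \<and> \<not> p < m then h p q else 0)"
  have split: "(\<lambda>p q. h p q - bath m h p q) = (\<lambda>p q. a p q + b p q)"
    by (auto simp: fun_eq_iff a_def b_def bath_def)
  have col: "(\<Sum>p<2 * n. (h p q)\<^sup>2) \<le> 1" if "q < 2 * n" for q
    by (rule contraction_column[OF h(2) that])
  have row: "(\<Sum>q<2 * n. (h p q)\<^sup>2) \<le> 1" if p: "p < 2 * n" for p
  proof -
    have "(\<Sum>q<2 * n. (h p q)\<^sup>2) = (\<Sum>q<2 * n. (h q p)\<^sup>2)"
    proof (intro sum.cong refl)
      fix q assume "q \<in> {..<2 * n}"
      then have "h p q = - h q p" using p by (intro antisym_onD[OF h(1)]) auto
      then show "(h p q)\<^sup>2 = (h q p)\<^sup>2" by simp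
    qed
    then show ?thesis using col[OF p] by simp
  qed
  have count: "(\<Sum>p<2 * n. if p < m then 1 / 4 * nrm ?N f else 0) = real m / 4 * nrm ?N f"
  proof -
    have "{..<2 * n} \<inter> {p. p < m} = {..<m}" using m by auto
    then show ?thesis by (simp add: sum.If_cases)
  qed
  have "nrm ?N (quad n a f) \<le> (\<Sum>p<2 * n. if p < m then 1 / 4 * nrm ?N f else 0)"
    unfolding quad_rows
  proof (rule order_trans[OF nrm_sum sum_mono])
    fix p assume p: "p \<in> {..<2 * n}"
    have "sqrt (\<Sum>q<2 * n. (a p q)\<^sup>2) \<le> (if p < m then 1 else 0)"
      using row p by (simp add: a_def)
    then have "sqrt (\<Sum>q<2 * n. (a p q)\<^sup>2) * nrm ?N f \<le> (if p < m then 1 else 0) * nrm ?N f"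
      by (rule mult_right_mono) simp
    then show "nrm ?N ((\<i> / 4) *\<^sub>c cop p (cc n (\<lambda>q. of_real (a p q)) f)) \<le> (if p < m then 1 / 4 * nrm ?N f else 0)"
      using p by (simp add: nrm_smul nrm_cop nrm_cc_real norm_divide split: if_splits)
  qed
  moreover have "nrm ?N (quad n b f) \<le> (\<Sum>p<2 * n. if p < m then 1 / 4 * nrm ?N f else 0)"
    unfolding quad_columns
  proof (rule order_trans[OF nrm_sum sum_mono])
    fix q assume q: "q \<in> {..<2 * n}"
    have "(\<Sum>p<2 * n. (b p q)\<^sup>2) \<le> (\<Sum>p<2 * n. (h p q)\<^sup>2)"
      by (intro sum_mono) (simp add: b_def)
    then have "(\<Sum>p<2 * n. (b p q)\<^sup>2) \<le> 1" using col[of q] q by (meson lessThan_iff order_trans)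
    then have "sqrt (\<Sum>p<2 * n. (b p q)\<^sup>2) \<le> (if q < m then 1 else 0)"
      by (cases "q < m") (simp_all add: b_def)
    then have "sqrt (\<Sum>p<2 * n. (b p q)\<^sup>2) * nrm ?N f \<le> (if q < m then 1 else 0) * nrm ?N f"
      by (rule mult_right_mono) simp
    then show "nrm ?N ((\<i> / 4) *\<^sub>c cc n (\<lambda>p. of_real (b p q)) (cop q f)) \<le> (if q < m then 1 / 4 * nrm ?N f else 0)"
      using q by (simp add: nrm_smul nrm_cop nrm_cc_real norm_divide split: if_splits)
  qed
  ultimately show ?thesis
    unfolding split quad_add count using nrm_triangle[of ?N "quad n a f" "quad n b f"] by simp
qed

text \<open>A unit vector is expanded in eigenvectors \<open>u k\<close> of \<open>ih\<close>. Each
  \<open>cc n (u k)\<close> changes the energy by \<open>lam k\<close>, which is at most 1 because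
  \<open>ih\<close> is a contraction.\<close>

lemma (in free_fermions) cop_shift:
  assumes h: "contraction (2 * n) h" and B: "eigenbasis (2 ^ n) ham L2 e2 d2" and q: "q < 2 * n"
  shows "eigenbasis.shift (2 ^ n) L2 e2 d2 1 (cop q)"
proof -
  interpret B: eigenbasis "2 ^ n" ham L2 e2 d2 by (rule B)
  have lam: "lam k \<le> 1" if "k < L" for k
  proof -
    have "complex_of_real ((nrm (2 * n) (u k))\<^sup>2) = 1" using ortho[of k k] that unfolding ip_self by simp
    then have "(nrm (2 * n) (u k))\<^sup>2 = 1" by (metis of_real_eq_1_iff)
    then have u1: "nrm (2 * n) (u k) = 1"
      using nrm_nonneg[of "2 * n" "u k"] by (auto simp: power2_eq_1_iff simp del: nrm_nonneg)
    have "\<bar>lam k\<bar> = nrm (2 * n) (ih n h (u k))" by (simp add: eigen[OF that] nrm_smul u1)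
    then show ?thesis using nrm_ih[OF h, of "u k"] u1 by simp
  qed
  have step: "B.shift 1 (cc n (u k))" if k: "k < L" for k
  proof (rule B.shift_ladder[OF cc_opr lam[OF k]])
    show "ham (cc n (u k) f) = cc n (u k) (ham f) + of_real (lam k) *\<^sub>c cc n (u k) f" for f
      using k by (simp add: ham_def quad_cc[OF antisym] eigen cc_smul clin_add[OF cc_clin]
          clin_smul[OF cc_clin])
  qed
  define v :: "nat \<Rightarrow> complex" where "v = (\<lambda>p. of_bool (p = q))"
  have "v \<in> vsp (2 * n)" using q by (simp add: v_def vsp_def)
  note v = expand[OF this]
  have "cop q f = (\<Sum>k<L. ip (2 * n) (u k) v *\<^sub>c cc n (u k) f)" for f
  proof -
    have "cop q f = cc n v f" by (simp add: v_def cc_single[OF q])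
    also have "\<dots> = cc n (\<Sum>k<L. ip (2 * n) (u k) v *\<^sub>c u k) f"
      by (rule arg_cong[OF v])
    finally show ?thesis by (simp add: cc_sum cc_smul)
  qed
  then show ?thesis
    using step unfolding B.shift_def by (auto intro!: B.low_sum B.low_smul)
qed

text \<open>This is \<open>energy_tail\<close> for the bath Hamiltonian \<open>G.ham\<close>; the
  full free Hamiltonian \<open>F.ham\<close> determines \<open>V\<close> and supplies the projection
  \<open>R\<close>.\<close>

lemma impurity_tail:
  assumes h: "antisym_on n h" "contraction (2 * n) h" and m: "0 < m" "m \<le> 2 * n"
    and D: "selfadj (2 ^ n) (imp m g)"
    and F: "free_fermions n h L u lam"
    and basis: "eigenbasis (2 ^ n) (free_fermions.ham n h L lam) LF eF dF"
    and psi: "psi \<in> vsp (2 ^ n)" "nrm (2 ^ n) psi = 1"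
      "free_fermions.ham n h L lam psi + imp m g psi = of_real E *\<^sub>c psi"
    and E: "\<And>x. x \<in> vsp (2 ^ n) \<Longrightarrow>
      E * (nrm (2 ^ n) x)\<^sup>2 \<le> Re (ip (2 ^ n) x (free_fermions.ham n h L lam x + imp m g x))"
    and \<tau>: "8 * exp 1 * real m \<le> \<tau>"
  shows "nrm (2 ^ n) (eigenbasis.sp (2 ^ n) LF eF dF {\<tau><..} psi)
    \<le> 2 * exp (- (\<tau> / 4) * ln (\<tau> / (8 * exp 1 * real m)))"
proof -
  let ?N = "2 ^ n :: nat"
  let ?D = "imp m g"
  interpret F: free_fermions n h L u lam by (rule F)
  interpret FB: eigenbasis ?N F.ham LF eF dF by (rule basis)
  let ?h = "bath m h"
  note h' = bath_antisym[OF h(1), of m] contraction_bath[OF h(2), of m]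
  obtain L' u' lam' where "eigenbasis (2 * n) (ih n ?h) L' u' lam'"
    using spectral_theorem[OF ih_selfadj[OF h'(1)]] by blast
  then interpret G: free_fermions n ?h L' u' lam'
    using h'(1) by (simp add: free_fermions_def free_fermions_axioms_def)
  obtain LB eB dB where "eigenbasis ?N G.ham LB eB dB"
    using spectral_theorem[OF G.ham_selfadj] by blast
  then interpret B: eigenbasis ?N G.ham LB eB dB .
  define W where "W = quad n (\<lambda>p q. h p q - ?h p q)"
  define V where "V = (\<lambda>f. W f + of_real (F.vac - G.vac) *\<^sub>c f)"
  have W: "nrm ?N (W f) \<le> real m / 2 * nrm ?N f" for f
    unfolding W_def by (rule nrm_quad_impurity[OF h m(2)])
  have quad_split: "quad n h f = quad n ?h f + W f" for f
    using quad_add[of n ?h "\<lambda>p q. h p q - ?h p q" f] by (simp add: W_def)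
  have ham_split: "F.ham f = G.ham f + V f" for f
    by (simp add: F.ham_def G.ham_def V_def quad_split fun_eq_iff algebra_simps)
  have ReW: "\<bar>Re (ip ?N f (W f))\<bar> \<le> real m / 2" if "nrm ?N f = 1" for f
    using abs_Re_le_cmod[of "ip ?N f (W f)"] cauchy_schwarz[of ?N f "W f"] W[of f] that by simp
  \<comment> \<open>With the zero operator as \<open>D\<close>, \<open>joint_vacuum\<close> yields a
    plain vacuum vector.\<close>
  have zero: "selfadj ?N (\<lambda>f. 0)" by (simp add: selfadj_def opr_def clin_def ip_simps)
  have nrm1: "Re (ip ?N f (of_real a *\<^sub>c f)) = a" if "nrm ?N f = 1" for f a
    using that by (simp add: ip_simps ip_self)
  \<comment> \<open>Each vacuum serves as a trial state for the other Hamiltonian, so the ground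
    energies differ by at most the bound for \<open>W\<close>.\<close>
  have "F.vac - G.vac \<le> real m / 2"
  proof -
    obtain \<phi> where \<phi>: "nrm ?N \<phi> = 1" "F.ham \<phi> = 0"
      using F.joint_vacuum[OF zero] by (auto simp: clin_zero[OF quad_clin] F.lower_def clin_zero[OF cc_clin])
    have "0 \<le> Re (ip ?N \<phi> (G.ham \<phi>))" by (rule G.ham_nonneg)
    also have "G.ham \<phi> = F.ham \<phi> - V \<phi>" unfolding ham_split by (rule add_diff_cancel_right'[symmetric])
    also have "\<dots> = 0 - V \<phi>" unfolding \<phi> ..
    finally have "Re (ip ?N \<phi> (W \<phi>)) + (F.vac - G.vac) \<le> 0"
      using nrm1[OF \<phi>(1)] unfolding V_def ip_simps(1,3,8) by (simp del: of_real_diff)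
    then show ?thesis using ReW[OF \<phi>(1)] by linarith
  qed
  moreover have "G.vac - F.vac \<le> real m / 2"
  proof -
    obtain \<phi> where \<phi>: "nrm ?N \<phi> = 1" "G.ham \<phi> = 0"
      using G.joint_vacuum[OF zero] by (auto simp: clin_zero[OF quad_clin] G.lower_def clin_zero[OF cc_clin])
    have "0 \<le> Re (ip ?N \<phi> (F.ham \<phi>))" by (rule F.ham_nonneg)
    also have "F.ham \<phi> = V \<phi>" using ham_split[of \<phi>] \<phi> by simp
    finally have "0 \<le> Re (ip ?N \<phi> (W \<phi>)) + (F.vac - G.vac)"
      using nrm1[OF \<phi>(1)] unfolding V_def ip_simps(1) by (simp del: of_real_diff)
    then show ?thesis using ReW[OF \<phi>(1)] by linarith
  qed
  ultimately have vac: "\<bar>F.vac - G.vac\<bar> \<le> real m / 2" by linarith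
  have V_bound: "nrm ?N (V f) \<le> real m * nrm ?N f" for f
  proof -
    have "nrm ?N (V f) \<le> real m / 2 * nrm ?N f + \<bar>F.vac - G.vac\<bar> * nrm ?N f"
      unfolding V_def by (rule order_trans[OF nrm_triangle add_mono[OF W]]) (simp add: nrm_smul flip: of_real_diff)
    also have "\<dots> \<le> real m / 2 * nrm ?N f + real m / 2 * nrm ?N f"
      using vac by (intro add_mono mult_right_mono) auto
    finally show ?thesis by simp
  qed
  have V_opr: "opr ?N V"
    unfolding opr_def
  proof (intro conjI ballI clinI)
    fix f f' a
    show "V (f + f') = V f + V f'" "V (a *\<^sub>c f) = a *\<^sub>c V f"
      by (simp_all add: V_def W_def clin_add[OF quad_clin] clin_smul[OF quad_clin] smul_distribs mult.commute)
    show "f \<in> vsp ?N \<Longrightarrow> V f \<in> vsp ?N" by (simp add: V_def W_def quad_vsp)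
  qed
  have cop1: "cop q f \<in> B.low (t + 1)" if "f \<in> B.low t" "q < 2 * n" for q t f
    using G.cop_shift[OF h'(2) B.eigenbasis_axioms that(2)] that(1) by (simp add: B.shift_def)
  \<comment> \<open>An impurity index meets only zero entries of \<open>bath m h\<close>, so its
    Majorana commutes with \<open>G.ham\<close>.\<close>
  have cop0: "cop q f \<in> B.low t" if "f \<in> B.low t" "q < m" for q t f
  proof -
    define v :: "nat \<Rightarrow> complex" where "v = (\<lambda>p. of_bool (p = q))"
    have q: "q < 2 * n" using that m by simp
    have "ih n ?h v = 0" using that by (auto simp: ih_def v_def bath_def fun_eq_iff of_bool_def intro!: sum.neutral)
    then have "quad n ?h (cop q f) = cop q (quad n ?h f)" for f
      using quad_cc[OF h'(1), of v f] cc_single[OF q] by (simp add: v_def cc_zero)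
    then have "G.ham (cop q f) = cop q (G.ham f) + of_real 0 *\<^sub>c cop q f" for f
      by (simp add: G.ham_def clin_add[OF cop_clin] clin_smul[OF cop_clin])
    then have "B.shift 0 (cop q)"
      using B.shift_ladder[OF cop_opr[OF q], of 0 0] by blast
    then show ?thesis using that by (auto simp: B.shift_def)
  qed
  have V_shift: "B.shift 1 V"
    unfolding B.shift_def
  proof (intro allI ballI)
    fix t f assume f: "f \<in> B.low t"
    have "(\<i> / 4 * of_real (h p q - ?h p q)) *\<^sub>c cop p (cop q f) \<in> B.low (t + 1)"
      if "p < 2 * n" "q < 2 * n" for p q
    proof -
      \<comment> \<open>Every nonzero entry of the difference has an impurity index, so at most one
        of the two Majoranas raises the energy.\<close>
      consider "p < m" | "q < m" | "h p q - ?h p q = 0"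
        by (cases "p < m \<or> q < m") (auto simp: bath_def)
      then show ?thesis
      proof cases
        case 1
        then show ?thesis using that f by (intro B.low_smul cop0 cop1) auto
      next
        case 2
        then show ?thesis using that f by (intro B.low_smul cop1 cop0) auto
      next
        case 3
        then show ?thesis by (simp add: B.low_def ip_simps)
      qed
    qed
    then have "W f \<in> B.low (t + 1)" unfolding W_def quad_def by (intro B.low_sum) auto
    then show "V f \<in> B.low (t + 1)"
      unfolding V_def using f by (intro B.low_add B.low_smul B.low_mono[OF f]) auto
  qed
  \<comment> \<open>Zero modes may live on the impurity and fail to commute with \<open>?D\<close>;
    an eigenvector with nonzero eigenvalue vanishes there.\<close>
  have w0: "G.w k p = 0" if k: "k < L'" "lam' k \<noteq> 0" and p: "p < m" for k p
  proof -
    have "of_real (lam' k) * u' k p = ih n ?h (u' k) p" using k by (simp add: G.eigen)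
    also have "\<dots> = 0" using p by (simp add: ih_def bath_def)
    finally show ?thesis using k by (simp add: G.w_def)
  qed
  obtain \<phi> \<delta> where \<phi>: "\<phi> \<in> vsp ?N" "nrm ?N \<phi> = 1" "G.ham \<phi> = 0" "?D \<phi> = of_real \<delta> *\<^sub>c \<phi>"
    and \<delta>: "\<And>y. y \<in> vsp ?N \<Longrightarrow> \<delta> * (nrm ?N y)\<^sup>2 \<le> Re (ip ?N y (?D y))"
    using G.joint_vacuum[OF D] imp_quad_bath[OF m(2)] imp_cc[OF m(2)] w0 by (auto simp: G.lower_def)
  \<comment> \<open>\<open>\<phi>\<close> is a trial state for the full Hamiltonian: its bath energy
    vanishes, which leaves \<open>\<delta>\<close> plus the expectation of \<open>V\<close>.\<close>
  have "E - real m \<le> \<delta>"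
  proof -
    have "E \<le> Re (ip ?N \<phi> (V \<phi>)) + \<delta>"
      using E[OF \<phi>(1)] \<phi> by (simp add: ham_split ip_simps ip_self)
    moreover have "Re (ip ?N \<phi> (V \<phi>)) \<le> real m"
      using abs_Re_le_cmod[of "ip ?N \<phi> (V \<phi>)"] cauchy_schwarz[of ?N \<phi> "V \<phi>"] V_bound[of \<phi>] \<phi> by simp
    ultimately show ?thesis by simp
  qed
  then have D_lower: "(E - real m) * (nrm ?N y)\<^sup>2 \<le> Re (ip ?N y (?D y))" if "y \<in> vsp ?N" for y
    using \<delta>[OF that] mult_right_mono[of "E - real m" \<delta> "(nrm ?N y)\<^sup>2"] by simp
  show ?thesis
  proof (rule B.energy_tail[where D = ?D and V = V and c = "real m" and E = E
        and R = "FB.sp {\<tau><..}"])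
    show "opr ?N ?D" by (rule imp_opr[OF m(2)])
    show "?D (G.ham x) = G.ham (?D x)" for x
      using imp_opr[OF m(2), of g] imp_quad_bath[OF m(2), of g h x]
      by (simp add: G.ham_def opr_def clin_add clin_smul del: plus_fun_apply smul_apply)
    show "0 \<le> dB k" if "k < LB" for k
      using B.d_nonneg[OF _ that] G.ham_nonneg by blast
    show "clin (FB.sp {\<tau><..})" by (rule FB.sp_clin)
    show "nrm ?N (FB.sp {\<tau><..} x) \<le> nrm ?N x" if "x \<in> vsp ?N" for x
      by (rule FB.nrm_sp[OF that])
    have "0 \<le> \<tau>" using \<tau> by (rule order_trans[rotated]) simp
    then show "\<tau> * nrm ?N (FB.sp {\<tau><..} x) \<le> nrm ?N (FB.sp {\<tau><..} (G.ham x + V x))" if "x \<in> vsp ?N" for x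
      unfolding ham_split[symmetric] by (rule FB.nrm_sp_T[OF that])
    show "G.ham psi + V psi + ?D psi = of_real E *\<^sub>c psi"
      unfolding ham_split[symmetric] by (rule psi(3))
    show "0 < real m" using m by simp
    show "nrm ?N (V x) \<le> real m * nrm ?N x" for x by (rule V_bound)
  qed (fact D_lower V_opr V_shift psi \<tau>)+
qed

section \<open>The trace norm\<close>

definition mop :: "nat \<Rightarrow> (nat \<Rightarrow> nat \<Rightarrow> complex) \<Rightarrow> (nat \<Rightarrow> complex) \<Rightarrow> nat \<Rightarrow> complex"
  where "mop N a f = (\<lambda>i. if i < N then \<Sum>j<N. a i j * f j else 0)"

lemma mop_opr: "opr N (mop N a)"
  unfolding opr_def
proof (intro conjI ballI clinI)
  fix f g b
  show "mop N a (f + g) = mop N a f + mop N a g" "mop N a (b *\<^sub>c f) = b *\<^sub>c mop N a f"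
    by (auto simp: mop_def fun_eq_iff algebra_simps sum.distrib sum_distrib_left)
  show "mop N a f \<in> vsp N" by (simp add: mop_def vsp_def)
qed

lemma mop_comp: "mop N a (mop N b f) = mop N (\<lambda>i j. \<Sum>r<N. a i r * b r j) f"
proof
  fix i
  have "(\<Sum>r<N. a i r * (\<Sum>j<N. b r j * f j)) = (\<Sum>j<N. (\<Sum>r<N. a i r * b r j) * f j)"
    unfolding sum_distrib_left sum_distrib_right by (subst sum.swap) (simp add: mult.assoc)
  then show "mop N a (mop N b f) i = mop N (\<lambda>i j. \<Sum>r<N. a i r * b r j) f i"
    by (simp add: mop_def)
qed

lemma mop_selfadj:
  assumes a: "\<And>i j. i < N \<Longrightarrow> j < N \<Longrightarrow> a i j = cnj (a j i)"
  shows "selfadj N (mop N a)"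
  unfolding selfadj_def
proof (intro conjI ballI mop_opr)
  fix x y
  have "ip N x (mop N a y) = (\<Sum>i<N. \<Sum>j<N. cnj (x i) * (a i j * y j))"
    by (simp add: ip_def mop_def sum_distrib_left)
  also have "\<dots> = (\<Sum>j<N. \<Sum>i<N. cnj (x i) * (a i j * y j))" by (rule sum.swap)
  also have "\<dots> = (\<Sum>j<N. \<Sum>i<N. cnj (a j i * x i) * y j)"
  proof (intro sum.cong refl)
    fix i j assume "j \<in> {..<N}" "i \<in> {..<N}"
    then have "a i j = cnj (a j i)" by (intro a) auto
    then show "cnj (x i) * (a i j * y j) = cnj (a j i * x i) * y j" by simp
  qed
  also have "\<dots> = ip N (mop N a x) y"
    by (simp add: ip_def mop_def sum_distrib_right)
  finally show "ip N x (mop N a y) = ip N (mop N a x) y" .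
qed

lemma mop_cong: "(\<And>i j. i < N \<Longrightarrow> j < N \<Longrightarrow> a i j = b i j) \<Longrightarrow> mop N a f = mop N b f"
  by (auto simp: mop_def fun_eq_iff)

lemma mop_entry: "i < N \<Longrightarrow> j < N \<Longrightarrow> mop N a (\<lambda>k. of_bool (k = j)) i = a i j"
  by (simp add: mop_def of_bool_def if_distrib cong: if_cong)

lemma mop_inject:
  assumes "\<And>f. f \<in> vsp N \<Longrightarrow> mop N a f = mop N b f" "i < N" "j < N"
  shows "a i j = b i j"
proof -
  have "(\<lambda>k. of_bool (k = j)) \<in> vsp N" using assms(3) by (auto simp: vsp_def)
  from fun_cong[OF assms(1)[OF this], of i] show ?thesis using assms(2,3) by (simp add: mop_entry)
qed

lemma ih_mop: "ih n h = mop (2 * n) (\<lambda>p q. \<i> * of_real (h p q))"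
  by (auto simp: fun_eq_iff ih_def mop_def)

context eigenbasis
begin

text \<open>The matrix of g(T) in the sense of functional calculus.\<close>

definition kern :: "(real \<Rightarrow> real) \<Rightarrow> nat \<Rightarrow> nat \<Rightarrow> complex"
  where "kern g i j = (\<Sum>k<L. of_real (g (d k)) * e k i * cnj (e k j))"

lemma kern_apply: "mop N (kern g) f = (\<Sum>k<L. (of_real (g (d k)) * ip N (e k) f) *\<^sub>c e k)"
proof
  fix i
  show "mop N (kern g) f i = (\<Sum>k<L. (of_real (g (d k)) * ip N (e k) f) *\<^sub>c e k) i"
  proof (cases "i < N")
    case True
    have "mop N (kern g) f i = (\<Sum>j<N. \<Sum>k<L. of_real (g (d k)) * e k i * cnj (e k j) * f j)"
      using True by (simp add: mop_def kern_def sum_distrib_right)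
    also have "\<dots> = (\<Sum>k<L. \<Sum>j<N. of_real (g (d k)) * e k i * cnj (e k j) * f j)"
      by (rule sum.swap)
    also have "\<dots> = (\<Sum>k<L. of_real (g (d k)) * ip N (e k) f * e k i)"
      by (intro sum.cong refl) (simp add: ip_def sum_distrib_left sum_distrib_right mult_ac)
    finally show ?thesis by (simp add: sum_fun_apply)
  next
    case False
    then have "e k i = 0" if "k < L" for k using e_vsp[OF that] by (simp add: vsp_def)
    with False show ?thesis by (simp add: mop_def sum_fun_apply)
  qed
qed

lemma coef_kern: "k < L \<Longrightarrow> ip N (e k) (mop N (kern g) f) = of_real (g (d k)) * ip N (e k) f"
  unfolding kern_apply by (rule coef_sum)

lemma kern_hermitian: "kern g i j = cnj (kern g j i)"
  by (simp add: kern_def mult_ac)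

lemma kern_compose:
  assumes f: "f \<in> vsp N"
  shows "mop N (kern g) (mop N (kern g') f) = mop N (kern (\<lambda>x. g x * g' x)) f"
  by (rule eq_coef) (use mop_opr[of N] f in \<open>auto simp: opr_def coef_kern\<close>)

lemma kern_id:
  assumes f: "f \<in> vsp N"
  shows "mop N (kern (\<lambda>x. x)) f = T f"
  by (rule eq_coef) (use mop_opr[of N] f in \<open>auto simp: opr_def coef_kern T_vsp coef_T\<close>)

text \<open>Applied to the complex conjugate eigenbasis this shows that \<open>\<bar>\<i>h\<bar>\<close> is a real matrix; applied to
  \<open>(\<i>h)\<^sup>2\<close> it gives uniqueness of the positive square root.\<close>

lemma kern_unique:
  assumes "eigenbasis N T L' e' d'" and f: "f \<in> vsp N"
  shows "mop N (eigenbasis.kern L' e' d' g) f = mop N (kern g) f"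
proof -
  interpret E: eigenbasis N T L' e' d' by fact
  show ?thesis
  proof (rule eq_coef)
    show "mop N (E.kern g) f \<in> vsp N" "mop N (kern g) f \<in> vsp N"
      using mop_opr[of N] f by (auto simp: opr_def)
    fix j assume j: "j < L"
    \<comment> \<open>Eigenvectors from the two bases overlap only at equal eigenvalues, where
      \<open>g\<close> takes equal values.\<close>
    have off: "of_real (g (d' k)) * ip N (e j) (e' k) = of_real (g (d j)) * ip N (e j) (e' k)"
      if "k < L'" for k
    proof -
      have "of_real (d j) * ip N (e j) (e' k) = of_real (d' k) * ip N (e j) (e' k)"
        using coef_T[OF E.e_vsp[OF that] j] unfolding E.eigen[OF that] ip_simps by (rule sym)
      then show ?thesis by auto
    qed
    have "ip N (e j) (mop N (E.kern g) f)
        = (\<Sum>k<L'. of_real (g (d j)) * (ip N (e' k) f * ip N (e j) (e' k)))"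
      unfolding E.kern_apply ip_sum_right
    proof (intro sum.cong refl)
      fix k assume "k \<in> {..<L'}"
      then show "ip N (e j) ((of_real (g (d' k)) * ip N (e' k) f) *\<^sub>c e' k)
          = of_real (g (d j)) * (ip N (e' k) f * ip N (e j) (e' k))"
        using off[of k] by (simp add: ip_simps mult_ac)
    qed
    also have "\<dots> = of_real (g (d j)) * ip N (e j) (\<Sum>k<L'. ip N (e' k) f *\<^sub>c e' k)"
      by (simp add: ip_sum_right ip_simps sum_distrib_left)
    also have "\<dots> = ip N (e j) (mop N (kern g) f)"
      using E.expand[OF f] by (simp add: coef_kern[OF j])
    finally show "ip N (e j) (mop N (E.kern g) f) = ip N (e j) (mop N (kern g) f)" .
  qed
qed

lemma square_basis: "eigenbasis N (\<lambda>f. T (T f)) L e (\<lambda>k. (d k)\<^sup>2)"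
proof unfold_locales
  show "opr N (\<lambda>f. T (T f))"
    using opr by (auto simp: opr_def clin_def)
  show "T (T (e k)) = of_real ((d k)\<^sup>2) *\<^sub>c e k" if "k < L" for k
    using that by (simp add: eigen clin_smul[OF T_clin] power2_eq_square)
qed (use ortho expand in auto)

end

definition fun_mat :: "'a mat \<Rightarrow> nat \<Rightarrow> nat \<Rightarrow> 'a"
  where "fun_mat A i j = A $$ (i, j)"

lemma psd_real_form:
  fixes P :: "real mat"
  assumes P: "P \<in> carrier_mat N N" and psd: "\<forall>v\<in>carrier_vec N. 0 \<le> v \<bullet> (P *\<^sub>v v)"
  shows "0 \<le> (\<Sum>i<N. \<Sum>j<N. P $$ (i, j) * (y i * y j))"
proof -
  have "0 \<le> vec N y \<bullet> (P *\<^sub>v vec N y)" using psd by simp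
  also have "\<dots> = (\<Sum>i<N. \<Sum>j<N. P $$ (i, j) * (y i * y j))"
    using P by (simp add: scalar_prod_def atLeast0LessThan sum_distrib_left mult_ac)
  finally show ?thesis .
qed

text \<open>\<open>transpose_mat h * h\<close> is the square of i h, so the matrix in the definite
  description must be the absolute value of i h, that is \<open>kern abs\<close>, whose trace is the
  sum of the \<open>\<bar>lam k\<bar>\<close>. Its being real and its uniqueness both come from
  \<open>kern_unique\<close>.\<close>

lemma trace_norm_eq:
  assumes h: "h \<in> carrier_mat (2 * n) (2 * n)" and anti: "antisym_on n (fun_mat h)"
    and basis: "eigenbasis (2 * n) (ih n (fun_mat h)) L u lam"
  shows "trace_norm h = (\<Sum>k<L. \<bar>lam k\<bar>)"
proof -
  let ?N = "2 * n"
  interpret eigenbasis ?N "ih n (fun_mat h)" L u lam by (rule basis)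
  define a where "a = kern abs"
  have hh: "(transpose_mat h * h) $$ (i, j) = (\<Sum>r<?N. h $$ (r, i) * h $$ (r, j))"
    if "i < ?N" "j < ?N" for i j
    using that h by (simp add: scalar_prod_def atLeast0LessThan)
  have ih2: "ih n (fun_mat h) (ih n (fun_mat h) f)
      = mop ?N (\<lambda>i j. of_real ((transpose_mat h * h) $$ (i, j))) f" for f
    unfolding ih_mop mop_comp
  proof (rule mop_cong)
    fix i j assume ij: "i < ?N" "j < ?N"
    have "\<i> * of_real (fun_mat h i r) * (\<i> * of_real (fun_mat h r j))
        = of_real (h $$ (r, i) * h $$ (r, j))" if "r < ?N" for r
    proof -
      have "fun_mat h i r = - fun_mat h r i" by (rule antisym_onD[OF anti ij(1) that])
      then show ?thesis by (simp add: fun_mat_def complex_eq_iff)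
    qed
    then show "(\<Sum>r<?N. \<i> * of_real (fun_mat h i r) * (\<i> * of_real (fun_mat h r j)))
        = of_real ((transpose_mat h * h) $$ (i, j))"
      by (simp add: hh[OF ij])
  qed
  have conj_basis: "eigenbasis ?N (ih n (fun_mat h)) L (\<lambda>k i. cnj (u k i)) (\<lambda>k. - lam k)"
  proof unfold_locales
    fix k assume k: "k < L"
    show "(\<lambda>i. cnj (u k i)) \<in> vsp ?N" using e_vsp[OF k] by (simp add: vsp_def)
    have "ih n (fun_mat h) (\<lambda>q. cnj (u k q)) p = - cnj (ih n (fun_mat h) (u k) p)" for p
      by (simp add: ih_def sum_negf)
    then show "ih n (fun_mat h) (\<lambda>i. cnj (u k i)) = of_real (- lam k) *\<^sub>c (\<lambda>i. cnj (u k i))"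
      using k by (simp add: fun_eq_iff eigen)
  next
    fix j k assume "j < L" "k < L"
    have "ip ?N (\<lambda>i. cnj (u j i)) (\<lambda>i. cnj (u k i)) = cnj (ip ?N (u j) (u k))"
      by (simp add: ip_def)
    then show "ip ?N (\<lambda>i. cnj (u j i)) (\<lambda>i. cnj (u k i)) = (if j = k then 1 else 0)"
      using ortho \<open>j < L\<close> \<open>k < L\<close> by simp
  next
    fix x assume x: "x \<in> vsp ?N"
    have "(\<lambda>i. cnj (x i)) \<in> vsp ?N" using x by (simp add: vsp_def)
    from expand[OF this] have "cnj (x i) = (\<Sum>k<L. ip ?N (u k) (\<lambda>i. cnj (x i)) * u k i)" for i
      by (metis (no_types, lifting) smul_apply sum.cong sum_fun_apply)
    then have "x i = (\<Sum>k<L. cnj (ip ?N (u k) (\<lambda>i. cnj (x i))) * cnj (u k i))" for i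
      by (metis (no_types, lifting) cnj_sum complex_cnj_cnj complex_cnj_mult sum.cong)
    moreover have "cnj (ip ?N (u k) (\<lambda>i. cnj (x i))) = ip ?N (\<lambda>i. cnj (u k i)) x" for k
      by (simp add: ip_def)
    ultimately show "x = (\<Sum>k<L. ip ?N (\<lambda>i. cnj (u k i)) x *\<^sub>c (\<lambda>i. cnj (u k i)))"
      by (simp add: fun_eq_iff sum_fun_apply)
  qed (rule opr)
  \<comment> \<open>Conjugation negates the eigenvalues, which \<open>abs\<close> does not see:
    \<open>kern abs\<close> equals its own conjugate.\<close>
  have a_real: "a i j = of_real (Re (a i j))" if ij: "i < ?N" "j < ?N" for i j
  proof -
    have "eigenbasis.kern L (\<lambda>k i. cnj (u k i)) (\<lambda>k. - lam k) abs i j = a i j"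
      unfolding a_def by (rule mop_inject[OF kern_unique[OF conj_basis] ij])
    moreover have "eigenbasis.kern L (\<lambda>k i. cnj (u k i)) (\<lambda>k. - lam k) abs i j = cnj (a i j)"
      by (simp add: eigenbasis.kern_def[OF conj_basis] a_def kern_def)
    ultimately show ?thesis by (simp add: complex_eq_iff)
  qed
  define P where "P = mat ?N ?N (\<lambda>(i, j). Re (a i j))"
  have P: "P \<in> carrier_mat ?N ?N" by (simp add: P_def)
  have Pa: "of_real (P $$ (i, j)) = a i j" if "i < ?N" "j < ?N" for i j
    using a_real[OF that] that by (simp add: P_def)
  have a_herm: "a i j = cnj (a j i)" for i j unfolding a_def by (rule kern_hermitian)
  have "trace_norm h = mtrace P"
    unfolding trace_norm_def
  proof (rule arg_cong[where f = mtrace], rule the_equality)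
    have dim: "dim_col h = ?N" using h by simp
    show "P \<in> carrier_mat (dim_col h) (dim_col h) \<and> transpose_mat P = P
      \<and> (\<forall>v\<in>carrier_vec (dim_col h). 0 \<le> v \<bullet> (P *\<^sub>v v)) \<and> P * P = transpose_mat h * h"
      unfolding dim
    proof (intro conjI ballI P)
      show "transpose_mat P = P"
      proof (rule eq_matI)
        fix i j assume ij: "i < dim_row P" "j < dim_col P"
        then have "a j i = cnj (a i j)" by (intro a_herm)
        then have "Re (a j i) = Re (a i j)" by simp
        then show "transpose_mat P $$ (i, j) = P $$ (i, j)" using ij by (simp add: P_def)
      qed (simp_all add: P_def)
      fix v :: "real vec" assume v: "v \<in> carrier_vec ?N"
      define x where "x = (\<lambda>i. if i < ?N then complex_of_real (v $ i) else 0)"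
      have x: "x \<in> vsp ?N" by (simp add: x_def vsp_def)
      have "complex_of_real (v \<bullet> (P *\<^sub>v v)) = ip ?N x (mop ?N a x)"
        using v P by (simp add: scalar_prod_def atLeast0LessThan ip_def mop_def x_def Pa)
      also have "\<dots> = (\<Sum>k<L. cnj (ip ?N (u k) x) * (of_real \<bar>lam k\<bar> * ip ?N (u k) x))"
        unfolding ip_coef[OF x] a_def by (intro sum.cong refl) (simp add: coef_kern)
      also have "\<dots> = of_real (\<Sum>k<L. \<bar>lam k\<bar> * (cmod (ip ?N (u k) x))\<^sup>2)"
        unfolding of_real_sum
        by (intro sum.cong refl) (simp only: of_real_mult complex_norm_square mult_ac)
      finally have "v \<bullet> (P *\<^sub>v v) = (\<Sum>k<L. \<bar>lam k\<bar> * (cmod (ip ?N (u k) x))\<^sup>2)"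
        by (simp only: of_real_eq_iff)
      then show "0 \<le> v \<bullet> (P *\<^sub>v v)" by (simp add: sum_nonneg)
    next
      show "P * P = transpose_mat h * h"
      proof (rule eq_matI)
        fix i j assume "i < dim_row (transpose_mat h * h)" "j < dim_col (transpose_mat h * h)"
        then have ij: "i < ?N" "j < ?N" using h by auto
        have "(\<Sum>r<?N. a i r * a r j) = of_real ((transpose_mat h * h) $$ (i, j))"
        proof (rule mop_inject[OF _ ij])
          fix f assume f: "f \<in> vsp ?N"
          have "mop ?N (\<lambda>i j. \<Sum>r<?N. a i r * a r j) f = mop ?N (kern (\<lambda>x. \<bar>x\<bar> * \<bar>x\<bar>)) f"
            unfolding mop_comp[symmetric] a_def by (rule kern_compose[OF f])
          also have "\<dots> = mop ?N (kern (\<lambda>x. x * x)) f" by simp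
          also have "\<dots> = ih n (fun_mat h) (ih n (fun_mat h) f)"
            using kern_compose[OF f, of "\<lambda>x. x" "\<lambda>x. x"] by (simp add: kern_id f T_vsp)
          finally show "mop ?N (\<lambda>i j. \<Sum>r<?N. a i r * a r j) f
              = mop ?N (\<lambda>i j. of_real ((transpose_mat h * h) $$ (i, j))) f"
            unfolding ih2 .
        qed
        moreover have "of_real ((P * P) $$ (i, j)) = (\<Sum>r<?N. a i r * a r j)"
          using ij P by (simp add: scalar_prod_def atLeast0LessThan Pa)
        ultimately show "(P * P) $$ (i, j) = (transpose_mat h * h) $$ (i, j)"
          by (metis of_real_eq_iff)
      qed (use P h in auto)
    qed
  next
    fix R :: "real mat"
    assume "R \<in> carrier_mat (dim_col h) (dim_col h) \<and> transpose_mat R = R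
      \<and> (\<forall>v\<in>carrier_vec (dim_col h). 0 \<le> v \<bullet> (R *\<^sub>v v)) \<and> R * R = transpose_mat h * h"
    then have R: "R \<in> carrier_mat ?N ?N" and sym: "transpose_mat R = R"
      and psd: "\<forall>v\<in>carrier_vec ?N. 0 \<le> v \<bullet> (R *\<^sub>v v)" and sq: "R * R = transpose_mat h * h"
      using h by auto
    define b where "b = (\<lambda>i j. complex_of_real (R $$ (i, j)))"
    have symR: "R $$ (i, j) = R $$ (j, i)" if "i < ?N" "j < ?N" for i j
      using R that arg_cong[OF sym, of "\<lambda>A. A $$ (i, j)"] by simp
    have b: "selfadj ?N (mop ?N b)"
    proof (rule mop_selfadj)
      fix i j assume "i < ?N" "j < ?N"
      then show "b i j = cnj (b j i)" using symR[of i j] by (simp add: b_def)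
    qed
    \<comment> \<open>Positivity is given on real vectors; the real part of the complex form is the
      sum of the forms at the real and imaginary parts.\<close>
    have pos: "0 \<le> Re (ip ?N x (mop ?N b x))" for x
    proof -
      have re: "Re (cnj (x i) * (b i j * x j))
          = R $$ (i, j) * (Re (x i) * Re (x j)) + R $$ (i, j) * (Im (x i) * Im (x j))" for i j
        by (simp add: b_def algebra_simps)
      have "ip ?N x (mop ?N b x) = (\<Sum>i<?N. \<Sum>j<?N. cnj (x i) * (b i j * x j))"
        by (simp add: ip_def mop_def sum_distrib_left)
      then have "Re (ip ?N x (mop ?N b x)) = (\<Sum>i<?N. \<Sum>j<?N. R $$ (i, j) * (Re (x i) * Re (x j)))
          + (\<Sum>i<?N. \<Sum>j<?N. R $$ (i, j) * (Im (x i) * Im (x j)))"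
        by (simp only: Re_sum re sum.distrib)
      then show ?thesis using psd_real_form[OF R psd] by simp
    qed
    obtain L2 e2 d2 where "eigenbasis ?N (mop ?N b) L2 e2 d2" using spectral_theorem[OF b] by blast
    then interpret B: eigenbasis ?N "mop ?N b" L2 e2 d2 .
    have d2: "0 \<le> d2 k" if "k < L2" for k using B.d_nonneg[OF _ that] pos by blast
    have "(\<lambda>f. mop ?N b (mop ?N b f)) = (\<lambda>f. ih n (fun_mat h) (ih n (fun_mat h) f))"
    proof
      fix f
      show "mop ?N b (mop ?N b f) = ih n (fun_mat h) (ih n (fun_mat h) f)"
        unfolding ih2 mop_comp
      proof (rule mop_cong)
        fix i j assume ij: "i < ?N" "j < ?N"
        have "(R * R) $$ (i, j) = (\<Sum>r<?N. R $$ (i, r) * R $$ (r, j))"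
          using R ij by (simp add: scalar_prod_def atLeast0LessThan)
        then show "(\<Sum>r<?N. b i r * b r j) = of_real ((transpose_mat h * h) $$ (i, j))"
          unfolding sq[symmetric] by (simp add: b_def)
      qed
    qed
    then have sqb: "eigenbasis ?N (\<lambda>f. ih n (fun_mat h) (ih n (fun_mat h) f)) L2 e2 (\<lambda>k. (d2 k)\<^sup>2)"
      using B.square_basis by simp
    interpret S: eigenbasis ?N "\<lambda>f. ih n (fun_mat h) (ih n (fun_mat h) f)" L u "\<lambda>k. (lam k)\<^sup>2"
      by (rule square_basis)
    \<comment> \<open>As \<open>d2\<close> is nonnegative, \<open>sqrt\<close> of its squares
      recovers \<open>R\<close>; applied to the squares of \<open>lam\<close> it gives
      \<open>a\<close>. Both are the root of the same operator.\<close>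
    have k1: "eigenbasis.kern L2 e2 (\<lambda>k. (d2 k)\<^sup>2) sqrt = B.kern (\<lambda>x. x)"
      using d2 by (simp add: fun_eq_iff B.kern_def eigenbasis.kern_def[OF sqb])
    have k2: "S.kern sqrt = a"
      by (simp add: fun_eq_iff S.kern_def a_def kern_def)
    have "mop ?N b f = mop ?N a f" if f: "f \<in> vsp ?N" for f
      using S.kern_unique[OF sqb f, of sqrt] B.kern_id[OF f] unfolding k1 k2 by simp
    then have "b i j = a i j" if "i < ?N" "j < ?N" for i j
      using mop_inject that by blast
    then have "R $$ (i, j) = P $$ (i, j)" if "i < ?N" "j < ?N" for i j
      using that by (metis Pa b_def of_real_eq_iff)
    then show "R = P" using R P by (intro eq_matI) auto
  qed
  also have "mtrace P = (\<Sum>k<L. \<bar>lam k\<bar>)"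
  proof -
    have "complex_of_real (mtrace P) = (\<Sum>i<?N. a i i)"
      using P by (simp add: mtrace_def Pa)
    also have "\<dots> = (\<Sum>k<L. \<Sum>i<?N. of_real \<bar>lam k\<bar> * u k i * cnj (u k i))"
      unfolding a_def kern_def by (rule sum.swap)
    also have "\<dots> = (\<Sum>k<L. of_real \<bar>lam k\<bar> * ip ?N (u k) (u k))"
      by (intro sum.cong refl) (simp add: ip_def sum_distrib_left mult_ac)
    also have "\<dots> = of_real (\<Sum>k<L. \<bar>lam k\<bar>)"
      by (simp add: ortho)
    finally show ?thesis by (simp only: of_real_eq_iff)
  qed
  finally show ?thesis .
qed

section \<open>Matrices and spectral projections\<close>

text \<open>Agreement is asked on \<open>vsp N\<close> only: \<open>cop\<close> acts by bit flips on
  functions on all of \<open>nat\<close>, without a cutoff at \<open>N\<close>.\<close>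

definition rep :: "nat \<Rightarrow> complex mat \<Rightarrow> ((nat \<Rightarrow> complex) \<Rightarrow> nat \<Rightarrow> complex) \<Rightarrow> bool"
  where "rep N A T \<longleftrightarrow> A \<in> carrier_mat N N \<and> opr N T \<and> (\<forall>f\<in>vsp N. T f = mop N (fun_mat A) f)"

lemma rep_mult:
  assumes A: "rep N A S" and B: "rep N B T"
  shows "rep N (A * B) (\<lambda>f. S (T f))"
  unfolding rep_def
proof (intro conjI ballI)
  show "opr N (\<lambda>f. S (T f))" using A B by (auto simp: rep_def opr_def clin_def)
  fix f assume f: "f \<in> vsp N"
  have "S (T f) = mop N (fun_mat A) (mop N (fun_mat B) f)"
    using A B f by (auto simp: rep_def opr_def)
  also have "\<dots> = mop N (fun_mat (A * B)) f"
    unfolding mop_comp using A B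
    by (intro mop_cong) (auto simp: rep_def fun_mat_def scalar_prod_def atLeast0LessThan)
  finally show "S (T f) = mop N (fun_mat (A * B)) f" .
qed (use A B in \<open>auto simp: rep_def\<close>)

lemma rep_one: "rep N (1\<^sub>m N) (\<lambda>f. f)"
  by (auto simp: rep_def opr_def clin_def mop_def fun_mat_def vsp_def fun_eq_iff if_distrib
      if_distribR cong: if_cong)

lemma rep_lincomb:
  assumes M: "\<And>x. x \<in> X \<Longrightarrow> rep N (M x) (T x)"
  shows "rep N (mat N N (\<lambda>(r, s). \<Sum>x\<in>X. c x * M x $$ (r, s))) (\<lambda>f. \<Sum>x\<in>X. c x *\<^sub>c T x f)"
  unfolding rep_def
proof (intro conjI ballI)
  have lin: "clin (T x)" and Tv: "\<And>f. f \<in> vsp N \<Longrightarrow> T x f \<in> vsp N" if "x \<in> X" for x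
    using M[OF that] by (auto simp: rep_def opr_def)
  show "opr N (\<lambda>f. \<Sum>x\<in>X. c x *\<^sub>c T x f)"
    unfolding opr_def
  proof (intro conjI ballI clinI)
    fix f g a
    show "(\<Sum>x\<in>X. c x *\<^sub>c T x (f + g)) = (\<Sum>x\<in>X. c x *\<^sub>c T x f) + (\<Sum>x\<in>X. c x *\<^sub>c T x g)"
      unfolding sum.distrib[symmetric]
      by (intro sum.cong refl) (simp only: clin_add[OF lin] smul_distribs)
    show "(\<Sum>x\<in>X. c x *\<^sub>c T x (a *\<^sub>c f)) = a *\<^sub>c (\<Sum>x\<in>X. c x *\<^sub>c T x f)"
      unfolding smul_sum by (intro sum.cong refl) (simp add: clin_smul[OF lin] mult.commute)
    show "f \<in> vsp N \<Longrightarrow> (\<Sum>x\<in>X. c x *\<^sub>c T x f) \<in> vsp N"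
      by (intro vsp_sum vsp_simps Tv)
  qed
  fix f assume f: "f \<in> vsp N"
  show "(\<Sum>x\<in>X. c x *\<^sub>c T x f) = mop N (fun_mat (mat N N (\<lambda>(r, s). \<Sum>x\<in>X. c x * M x $$ (r, s)))) f"
  proof
    fix i
    have T: "T x f i = (if i < N then \<Sum>j<N. M x $$ (i, j) * f j else 0)" if "x \<in> X" for x
      using M[OF that] f by (simp add: rep_def mop_def fun_mat_def)
    have "(\<Sum>x\<in>X. c x * (\<Sum>j<N. M x $$ (i, j) * f j)) = (\<Sum>j<N. (\<Sum>x\<in>X. c x * M x $$ (i, j)) * f j)"
      unfolding sum_distrib_left sum_distrib_right by (subst sum.swap) (simp add: mult.assoc)
    then show "(\<Sum>x\<in>X. c x *\<^sub>c T x f) i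
        = mop N (fun_mat (mat N N (\<lambda>(r, s). \<Sum>x\<in>X. c x * M x $$ (r, s)))) f i"
      by (simp add: sum_fun_apply T mop_def fun_mat_def)
  qed
qed simp

lemma rep_add:
  assumes A: "rep N A S" and B: "rep N B T"
  shows "rep N (A + B) (\<lambda>f. S f + T f)"
  unfolding rep_def
proof (intro conjI ballI)
  show "opr N (\<lambda>f. S f + T f)"
    using A B by (auto simp: rep_def opr_def clin_def smul_distribs fun_eq_iff)
  fix f assume f: "f \<in> vsp N"
  then show "S f + T f = mop N (fun_mat (A + B)) f"
    using A B by (auto simp: rep_def mop_def fun_mat_def fun_eq_iff distrib_right sum.distrib)
qed (use A B in \<open>auto simp: rep_def\<close>)

lemma rep_smult:
  assumes A: "rep N A S"
  shows "rep N (c \<cdot>\<^sub>m A) (\<lambda>f. c *\<^sub>c S f)"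
  unfolding rep_def
proof (intro conjI ballI)
  show "opr N (\<lambda>f. c *\<^sub>c S f)"
    using A by (auto simp: rep_def opr_def clin_def smul_distribs mult.commute)
  fix f assume f: "f \<in> vsp N"
  then show "c *\<^sub>c S f = mop N (fun_mat (c \<cdot>\<^sub>m A)) f"
    using A by (auto simp: rep_def mop_def fun_mat_def fun_eq_iff sum_distrib_left mult.assoc)
qed (use A in \<open>auto simp: rep_def\<close>)

lemma rep_maj: "q < 2 * n \<Longrightarrow> rep (2 ^ n) (maj n (Suc q)) (cop q)"
  unfolding rep_def
proof (intro conjI ballI maj_carrier cop_opr ext)
  fix f and i :: nat assume q: "q < 2 * n" and f: "f \<in> vsp (2 ^ n)"
  have fl: "flip_bit (q div 2) i < 2 ^ n \<longleftrightarrow> i < 2 ^ n" using q by (intro flip_less) simp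
  show "cop q f i = mop (2 ^ n) (fun_mat (maj n (Suc q))) f i"
  proof (cases "i < 2 ^ n")
    case True
    have "(\<Sum>j<2 ^ n. maj n (Suc q) $$ (i, j) * f j)
        = (\<Sum>j<2 ^ n. if j = flip_bit (q div 2) i then phase q i * f j else 0)"
      using q True by (intro sum.cong refl) (auto simp: maj_index)
    then show ?thesis using True fl by (simp add: mop_def fun_mat_def cop_def)
  next
    case False
    then show ?thesis using f fl by (simp add: mop_def cop_def vsp_def)
  qed
qed

lemma rep_monomial:
  assumes x: "length x \<le> 2 * n"
  shows "rep (2 ^ n) (maj_monomial n x) (mono x)"
proof -
  have "rep (2 ^ n) (foldr (\<lambda>i M. (if x ! i then maj n (i + 1) else 1\<^sub>m (2 ^ n)) * M) is (1\<^sub>m (2 ^ n)))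
      (\<lambda>f. foldr (\<lambda>i g. if x ! i then cop i g else g) is f)" if "set is \<subseteq> {..<2 * n}" for "is"
    using that
  proof (induction "is")
    case Nil
    then show ?case by (simp add: rep_one)
  next
    case (Cons i "is")
    then have i: "i < 2 * n" and IH: "rep (2 ^ n)
        (foldr (\<lambda>i M. (if x ! i then maj n (i + 1) else 1\<^sub>m (2 ^ n)) * M) is (1\<^sub>m (2 ^ n)))
        (\<lambda>f. foldr (\<lambda>i g. if x ! i then cop i g else g) is f)" by auto
    have one: "rep (2 ^ n) (if x ! i then maj n (i + 1) else 1\<^sub>m (2 ^ n)) (\<lambda>f. if x ! i then cop i f else f)"
      using rep_maj[OF i] rep_one by (cases "x ! i") auto
    show ?case using rep_mult[OF one IH] by simp
  qed
  moreover have "set [0..<length x] \<subseteq> {..<2 * n}" using x by auto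
  ultimately show ?thesis unfolding maj_monomial_def mono_def[abs_def] by blast
qed

lemma rep_H_imp: "m \<le> 2 * n \<Longrightarrow> rep (2 ^ n) (H_imp n m g) (imp m g)"
  unfolding H_imp_def imp_def[abs_def] by (intro rep_lincomb rep_monomial) auto

lemma rep_H_free:
  "rep (2 ^ n) (H_free n h) (\<lambda>f. of_real (trace_norm h / 4) *\<^sub>c f + quad n (fun_mat h) f)"
proof -
  let ?X = "{..<2 * n} \<times> {..<2 * n}"
  have pairs: "rep (2 ^ n) (mat (2 ^ n) (2 ^ n) (\<lambda>(r, s). \<Sum>x\<in>?X. (\<i> / 4 * of_real (h $$ x)) *
      (maj n (Suc (fst x)) * maj n (Suc (snd x))) $$ (r, s)))
      (\<lambda>f. \<Sum>x\<in>?X. (\<i> / 4 * of_real (h $$ x)) *\<^sub>c cop (fst x) (cop (snd x) f))"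
    by (intro rep_lincomb rep_mult rep_maj) auto
  have op: "(\<Sum>x\<in>?X. (\<i> / 4 * of_real (h $$ x)) *\<^sub>c cop (fst x) (cop (snd x) f)) = quad n (fun_mat h) f"
    for f
    by (simp add: quad_def fun_mat_def sum.cartesian_product case_prod_beta)
  have entry: "(\<Sum>x\<in>?X. (\<i> / 4 * of_real (h $$ x)) * (maj n (Suc (fst x)) * maj n (Suc (snd x))) $$ (r, s))
      = (\<i> / 4) * (\<Sum>p\<in>{1..2*n}. \<Sum>q\<in>{1..2*n}. complex_of_real (h $$ (p - 1, q - 1)) *
            (maj n p * maj n q) $$ (r, s))" for r s
  proof -
    have shift: "(\<Sum>p\<in>{1..2*n}. F p) = (\<Sum>p<2*n. F (Suc p))" for F :: "nat \<Rightarrow> complex"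
      by (rule sum.reindex_bij_witness[where i = Suc and j = "\<lambda>p. p - 1"]) auto
    show ?thesis
      unfolding shift by (simp add: sum.cartesian_product case_prod_beta sum_distrib_left mult.assoc)
  qed
  show ?thesis
    unfolding H_free_def by (intro rep_add rep_smult rep_one pairs[unfolded op entry])
qed

section \<open>Vectors and orthogonal projections\<close>

definition fv :: "complex vec \<Rightarrow> nat \<Rightarrow> complex"
  where "fv v = (\<lambda>i. if i < dim_vec v then v $ i else 0)"

lemma fv_vsp: "v \<in> carrier_vec N \<Longrightarrow> fv v \<in> vsp N"
  by (auto simp: fv_def vsp_def)

lemma fv_vec: "f \<in> vsp N \<Longrightarrow> fv (vec N f) = f"
  by (auto simp: fv_def vsp_def fun_eq_iff)

lemma fv_inject: "v \<in> carrier_vec N \<Longrightarrow> w \<in> carrier_vec N \<Longrightarrow> fv v = fv w \<Longrightarrow> v = w"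
  by (rule eq_vecI) (auto simp: fv_def fun_eq_iff split: if_splits)

lemma fv_simps:
  "v \<in> carrier_vec N \<Longrightarrow> w \<in> carrier_vec N \<Longrightarrow> fv (v + w) = fv v + fv w"
  "fv (a \<cdot>\<^sub>v v) = a *\<^sub>c fv v" "fv (0\<^sub>v N) = 0"
  by (auto simp: fv_def fun_eq_iff)

lemma fv_diff: "v \<in> carrier_vec N \<Longrightarrow> w \<in> carrier_vec N \<Longrightarrow> fv (v - w) = fv v - fv w"
  by (auto simp: fv_def fun_eq_iff)

lemma fv_mult: "rep N A T \<Longrightarrow> v \<in> carrier_vec N \<Longrightarrow> fv (A *\<^sub>v v) = T (fv v)"
  using fv_vsp[of v N]
  by (auto simp: rep_def fv_def mop_def fun_mat_def fun_eq_iff scalar_prod_def atLeast0LessThan)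

lemma cvnorm_fv: "v \<in> carrier_vec N \<Longrightarrow> cvnorm v = nrm N (fv v)"
  by (auto simp: cvnorm_def nrm_def L2_set_def fv_def)

lemma rep_selfadj:
  assumes A: "rep N A T" and herm: "hermitian A"
  shows "selfadj N T"
proof -
  have "selfadj N (mop N (fun_mat A))"
  proof (rule mop_selfadj)
    fix i j assume ij: "i < N" "j < N"
    have "mat_adjoint A $$ (i, j) = cnj (A $$ (j, i))"
      using A ij by (intro mat_adjoint_index) (auto simp: rep_def)
    then show "fun_mat A i j = cnj (fun_mat A j i)" using herm by (simp add: hermitian_def fun_mat_def)
  qed
  with A show ?thesis by (auto simp: selfadj_def rep_def)
qed

text \<open>Projections \<open>Q\<close> and \<open>R\<close> with the same range fix each other's
  range: \<open>Q * R = R\<close> and \<open>R * Q = Q\<close>. Taking adjoints in the first gives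
  \<open>R = R * Q = Q\<close>.\<close>

lemma orth_proj_eq:
  assumes Q: "Q \<in> carrier_mat N N" "Q * Q = Q" "mat_adjoint Q = Q" "(\<lambda>v. Q *\<^sub>v v) ` carrier_vec N = W"
  shows "orth_proj N W = Q"
  unfolding orth_proj_def
proof (rule the_equality)
  fix R assume "R \<in> carrier_mat N N \<and> R * R = R \<and> mat_adjoint R = R \<and> (\<lambda>v. R *\<^sub>v v) ` carrier_vec N = W"
  then have R: "R \<in> carrier_mat N N" "R * R = R" "mat_adjoint R = R" "(\<lambda>v. R *\<^sub>v v) ` carrier_vec N = W"
    by auto
  have absorb: "A * B = B" if A: "A \<in> carrier_mat N N" "A * A = A" and B: "B \<in> carrier_mat N N"
    and img: "(\<lambda>v. B *\<^sub>v v) ` carrier_vec N \<subseteq> (\<lambda>v. A *\<^sub>v v) ` carrier_vec N" for A B :: "complex mat"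
  proof (rule mat_col_eqI)
    fix j assume "j < dim_col B"
    then have j: "j < N" using B by simp
    have cB: "col B j = B *\<^sub>v unit_vec N j" using B j by (intro eq_vecI) auto
    then obtain v where v: "v \<in> carrier_vec N" "col B j = A *\<^sub>v v" using img by fastforce
    have "col (A * B) j = A *\<^sub>v col B j" using A B j by (intro col_mult2) auto
    also have "\<dots> = (A * A) *\<^sub>v v" unfolding v(2) using A v by (intro assoc_mult_mat_vec[symmetric]) auto
    also have "\<dots> = col B j" using A v by simp
    finally show "col (A * B) j = col B j" .
  qed (use A B in auto)
  have QR: "Q * R = R" by (rule absorb) (use Q R in auto)
  have RQ: "R * Q = Q" by (rule absorb) (use Q R in auto)
  show "R = Q"
  proof (rule eq_matI)
    fix i j assume "i < dim_row Q" "j < dim_col Q"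
    then have ij: "i < N" "j < N" using Q by auto
    have adj: "A $$ (i, j) = cnj (A $$ (j, i))" if "A \<in> carrier_mat N N" "mat_adjoint A = A" "i < N" "j < N"
      for A i j using mat_adjoint_index[OF that(1,3,4)] that(2) by simp
    have "R $$ (i, j) = cnj ((Q * R) $$ (j, i))" unfolding QR by (rule adj[OF R(1,3) ij])
    also have "\<dots> = (\<Sum>k<N. cnj (R $$ (k, i)) * cnj (Q $$ (j, k)))"
      using Q R ij by (simp add: scalar_prod_def atLeast0LessThan mult.commute)
    also have "\<dots> = (\<Sum>k<N. R $$ (i, k) * Q $$ (k, j))"
      using adj[OF R(1,3)] adj[OF Q(1,3)] ij by (intro sum.cong refl) (metis lessThan_iff)
    also have "\<dots> = (R * Q) $$ (i, j)" using Q R ij by (simp add: scalar_prod_def atLeast0LessThan)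
    finally show "R $$ (i, j) = Q $$ (i, j)" unfolding RQ .
  qed (use Q R in auto)
qed (use Q in auto)

lemma fv_foldr:
  "set vs \<subseteq> carrier_vec N \<Longrightarrow> foldr (+) vs (0\<^sub>v N) \<in> carrier_vec N
    \<and> fv (foldr (+) vs (0\<^sub>v N)) i = (\<Sum>v\<leftarrow>vs. fv v i)"
  by (induction vs) (auto simp: fv_simps)

text \<open>The projection is the indicator function of eigenvalues at most \<open>\<tau>\<close>,
  applied to \<open>T\<close>. Its range has to be compared with sums of arbitrary eigenvectors, not
  only those of the basis \<open>e\<close>.\<close>

lemma (in eigenbasis) orth_proj_low_space:
  assumes A: "rep N A T" and v: "v \<in> carrier_vec N"
  shows "cvnorm ((1\<^sub>m N - orth_proj N (low_space A \<tau>)) *\<^sub>v v) = nrm N (sp {\<tau><..} (fv v))"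
proof -
  have dim: "dim_row A = N" using A by (auto simp: rep_def)
  have Ac: "A \<in> carrier_mat N N" using A by (simp add: rep_def)
  define g :: "real \<Rightarrow> real" where "g = (\<lambda>x. if x \<le> \<tau> then 1 else 0)"
  define Q where "Q = mat N N (\<lambda>(i, j). kern g i j)"
  have Q: "Q \<in> carrier_mat N N" by (simp add: Q_def)
  have mopQ: "mop N (fun_mat Q) f = mop N (kern g) f" for f
    by (rule mop_cong) (simp add: Q_def fun_mat_def)
  have repQ: "rep N Q (mop N (kern g))"
    using Q mop_opr by (auto simp: rep_def mopQ)
  have fvQ: "fv (Q *\<^sub>v v) = mop N (kern g) (fv v)" if "v \<in> carrier_vec N" for v
    by (rule fv_mult[OF repQ that])
  have mv: "mop N (kern g) f \<in> vsp N" for f by (simp add: mop_def vsp_def)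
  have Qfix: "mop N (kern g) f = f" if f: "f \<in> low \<tau>" for f
  proof (rule eq_coef[OF mv low_vsp[OF f]])
    fix k assume "k < L"
    then show "ip N (e k) (mop N (kern g) f) = ip N (e k) f"
      using f by (cases "d k \<le> \<tau>") (auto simp: coef_kern g_def low_def)
  qed
  have proj: "orth_proj N (low_space A \<tau>) = Q"
  proof (rule orth_proj_eq[OF Q])
    show "Q * Q = Q"
    proof (rule eq_matI)
      fix i j assume "i < dim_row Q" "j < dim_col Q"
      then have ij: "i < N" "j < N" using Q by auto
      have "(\<Sum>r<N. kern g i r * kern g r j) = kern g i j"
      proof (rule mop_inject[OF _ ij])
        fix f assume f: "f \<in> vsp N"
        have "(\<lambda>x. g x * g x) = g" by (auto simp: g_def)
        then show "mop N (\<lambda>i j. \<Sum>r<N. kern g i r * kern g r j) f = mop N (kern g) f"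
          unfolding mop_comp[symmetric] kern_compose[OF f] by simp
      qed
      then show "(Q * Q) $$ (i, j) = Q $$ (i, j)"
        using ij by (simp add: Q_def scalar_prod_def atLeast0LessThan)
    qed (use Q in auto)
    show "mat_adjoint Q = Q"
    proof (rule eq_matI)
      fix i j assume "i < dim_row Q" "j < dim_col Q"
      then have ij: "i < N" "j < N" using Q by auto
      have "mat_adjoint Q $$ (i, j) = cnj (Q $$ (j, i))" using Q ij by (intro mat_adjoint_index)
      also have "\<dots> = Q $$ (i, j)" using ij kern_hermitian[of g i j] by (simp add: Q_def)
      finally show "mat_adjoint Q $$ (i, j) = Q $$ (i, j)" .
    qed (auto simp: mat_adjoint_def Q_def)
    show "(\<lambda>v. Q *\<^sub>v v) ` carrier_vec N = low_space A \<tau>"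
    proof (intro equalityI subsetI)
      fix w assume "w \<in> (\<lambda>v. Q *\<^sub>v v) ` carrier_vec N"
      then obtain v where v: "v \<in> carrier_vec N" "w = Q *\<^sub>v v" by auto
      define c where "c = (\<lambda>k. of_real (g (d k)) * ip N (e k) (fv v))"
      define vs where "vs = map (\<lambda>k. vec N (c k *\<^sub>c e k)) [0..<L]"
      have vs: "set vs \<subseteq> carrier_vec N" by (auto simp: vs_def)
      have fvk: "fv (vec N (c k *\<^sub>c e k)) = c k *\<^sub>c e k" if "k < L" for k
        using that by (intro fv_vec) simp
      have "fv w i = (\<Sum>k<L. c k *\<^sub>c e k) i" for i
        using v by (simp add: fvQ kern_apply c_def)
      also have "\<dots> i = (\<Sum>v\<leftarrow>vs. fv v i)" for i
        by (simp add: vs_def sum_fun_apply fvk o_def interv_sum_list_conv_sum_set_nat atLeast0LessThan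
            cong: sum.cong_simp)
      finally have "w = foldr (+) vs (0\<^sub>v N)"
        using fv_foldr[OF vs] v Q by (intro fv_inject[of _ N]) (auto simp: fun_eq_iff)
      moreover have "\<exists>\<mu>::real. \<mu> \<le> \<tau> \<and> A *\<^sub>v x = complex_of_real \<mu> \<cdot>\<^sub>v x" if x: "x \<in> set vs" for x
      proof -
        obtain k where k: "k < L" "x = vec N (c k *\<^sub>c e k)" using x by (auto simp: vs_def)
        have xc: "x \<in> carrier_vec N" using k by simp
        \<comment> \<open>If \<open>d k > \<tau>\<close> then \<open>c k\<close> is 0, and the zero
          vector satisfies the equation for every eigenvalue; \<open>min\<close> picks one that is
          at most \<open>\<tau>\<close>.\<close>
        have "A *\<^sub>v x = complex_of_real (min (d k) \<tau>) \<cdot>\<^sub>v x"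
        proof (rule fv_inject[of _ N])
          have "fv (A *\<^sub>v x) = T (c k *\<^sub>c e k)" using fv_mult[OF A xc] fvk[OF k(1)] k(2) by simp
          also have "\<dots> = of_real (min (d k) \<tau>) *\<^sub>c c k *\<^sub>c e k"
            using k(1) by (cases "d k \<le> \<tau>") (auto simp: clin_smul[OF T_clin] clin_zero[OF T_clin] eigen c_def g_def min_def mult.commute)
          finally show "fv (A *\<^sub>v x) = fv (complex_of_real (min (d k) \<tau>) \<cdot>\<^sub>v x)"
            using fvk[OF k(1)] k(2) by (simp only: fv_simps)
        qed (use Ac xc in auto)
        then show ?thesis by (intro exI[of _ "min (d k) \<tau>"]) simp
      qed
      ultimately show "w \<in> low_space A \<tau>"
        unfolding low_space_def dim using vs by auto
    next
      fix w assume "w \<in> low_space A \<tau>"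
      then obtain vs where w: "w = foldr (+) vs (0\<^sub>v N)" and vs: "\<And>v. v \<in> set vs \<Longrightarrow> v \<in> carrier_vec N"
        and ev: "\<And>v. v \<in> set vs \<Longrightarrow> \<exists>\<mu>::real. \<mu> \<le> \<tau> \<and> A *\<^sub>v v = complex_of_real \<mu> \<cdot>\<^sub>v v"
        unfolding low_space_def dim by auto
      have low1: "fv v \<in> low \<tau>" if v: "v \<in> set vs" for v
      proof -
        obtain \<mu> where mu: "\<mu> \<le> \<tau>" "A *\<^sub>v v = complex_of_real \<mu> \<cdot>\<^sub>v v" using ev[OF v] by blast
        have fvv: "fv v \<in> vsp N" by (rule fv_vsp[OF vs[OF v]])
        have Tv: "T (fv v) = of_real \<mu> *\<^sub>c fv v"
          using fv_mult[OF A vs[OF v]] mu by (simp add: fv_simps)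
        have "of_real (d k) * ip N (e k) (fv v) = of_real \<mu> * ip N (e k) (fv v)" if "k < L" for k
          using coef_T[OF fvv that] unfolding Tv ip_simps by (rule sym)
        then show ?thesis using mu fvv by (fastforce simp: low_def)
      qed
      have "foldr (+) us (0\<^sub>v N) \<in> carrier_vec N \<and> fv (foldr (+) us (0\<^sub>v N)) \<in> low \<tau>"
        if "set us \<subseteq> set vs" for us
        using that
      proof (induction us)
        case Nil
        have "(0 :: nat \<Rightarrow> complex) \<in> low \<tau>" by (simp add: low_def ip_simps)
        then show ?case by (simp add: fv_simps(3) del: zero_fun_apply)
      next
        case (Cons u us)
        then have "u \<in> carrier_vec N" "fv u \<in> low \<tau>" using vs low1 by auto
        with Cons show ?case by (simp add: fv_simps(1)[of _ N] low_add del: plus_fun_apply)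
      qed
      then have wc: "w \<in> carrier_vec N" "fv w \<in> low \<tau>" unfolding w by auto
      have "Q *\<^sub>v w = w"
        using Q wc by (intro fv_inject[of _ N]) (auto simp: fvQ Qfix)
      then show "w \<in> (\<lambda>v. Q *\<^sub>v v) ` carrier_vec N" using wc by (metis imageI)
    qed
  qed
  have "(1\<^sub>m N - Q) *\<^sub>v v = v - Q *\<^sub>v v"
    using Q v by (simp add: minus_mult_distrib_mat_vec[of _ N N])
  also have "fv \<dots> = fv v - mop N (kern g) (fv v)"
    unfolding fvQ[OF v, symmetric] by (rule fv_diff[OF v mult_mat_vec_carrier[OF Q v]])
  also have "\<dots> = sp {\<tau><..} (fv v)"
    by (rule eq_coef[OF vsp_simps(3)[OF fv_vsp[OF v] mv] sp_vsp])
      (auto simp: ip_simps coef_kern coef_sp g_def)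
  finally have "fv ((1\<^sub>m N - Q) *\<^sub>v v) = sp {\<tau><..} (fv v)" .
  moreover have "(1\<^sub>m N - Q) *\<^sub>v v \<in> carrier_vec N"
    by (intro mult_mat_vec_carrier[OF _ v] minus_carrier_mat[OF Q])
  ultimately show ?thesis unfolding proj by (simp add: cvnorm_fv)
qed

lemma contraction_op_norm:
  assumes h: "h \<in> carrier_mat N N" and norm: "op_norm_le_one h"
  shows "contraction N (fun_mat h)"
  unfolding contraction_def
proof
  fix y :: "nat \<Rightarrow> real"
  have "rvnorm (h *\<^sub>v vec N y) \<le> rvnorm (vec N y)"
    using norm h unfolding op_norm_le_one_def by auto
  then show "(\<Sum>p<N. (\<Sum>q<N. fun_mat h p q * y q)\<^sup>2) \<le> (\<Sum>q<N. (y q)\<^sup>2)"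
    using h by (simp add: rvnorm_def scalar_prod_def atLeast0LessThan fun_mat_def power2_eq_square)
qed

lemma antisym_transpose:
  assumes h: "h \<in> carrier_mat (2 * n) (2 * n)" and anti: "transpose_mat h = - h"
  shows "antisym_on n (fun_mat h)"
  unfolding antisym_on_def fun_mat_def
proof (intro allI impI)
  fix p q assume "p < 2 * n" "q < 2 * n"
  then show "h $$ (p, q) = - h $$ (q, p)"
    using h arg_cong[OF anti, of "\<lambda>A. A $$ (q, p)"] by simp
qed

theorem theorem3:
  fixes n m :: nat and h :: "real mat" and g :: "bool list \<Rightarrow> complex"
    and psi :: "complex vec" and \<tau> :: real
  assumes h_dim: "h \<in> carrier_mat (2 * n) (2 * n)"
    and h_antisym: "transpose_mat h = - h"
    and h_norm: "op_norm_le_one h"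
    and m_le: "m \<le> 2 * n"
    and herm: "hermitian (H_imp n m g)"
    and gs: "ground_state (H_free n h + H_imp n m g) psi"
    and tau: "\<tau> \<ge> 8 * exp 1 * real m"
  shows "cvnorm ((1\<^sub>m (2 ^ n) - orth_proj (2 ^ n) (low_space (H_free n h) \<tau>)) *\<^sub>v psi)
           \<le> 2 * exp (- (\<tau> / 4) * ln (\<tau> / (8 * exp 1 * real m)))"
proof -
  let ?N = "2 ^ n :: nat"
  let ?h = "fun_mat h"
  have anti: "antisym_on n ?h" by (rule antisym_transpose[OF h_dim h_antisym])
  obtain L u lam where basis: "eigenbasis (2 * n) (ih n ?h) L u lam"
    using spectral_theorem[OF ih_selfadj[OF anti]] by blast
  then interpret F: free_fermions n ?h L u lam
    using anti by (simp add: free_fermions_def free_fermions_axioms_def)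
  obtain LF eF dF where "eigenbasis ?N F.ham LF eF dF"
    using spectral_theorem[OF F.ham_selfadj] by blast
  then interpret FB: eigenbasis ?N F.ham LF eF dF .
  \<comment> \<open>The constant in \<open>H_free\<close> is exactly the shift that makes the ground
    energy zero.\<close>
  have vac: "trace_norm h / 4 = F.vac" by (simp add: F.vac_def trace_norm_eq[OF h_dim anti basis])
  have rF: "rep ?N (H_free n h) F.ham"
    using rep_H_free[of n h] unfolding vac by (simp add: F.ham_def[abs_def] add.commute)
  have rD: "rep ?N (H_imp n m g) (imp m g)" by (rule rep_H_imp[OF m_le])
  let ?H = "H_free n h + H_imp n m g"
  let ?T = "\<lambda>f. F.ham f + imp m g f"
  have rH: "rep ?N ?H ?T" by (rule rep_add[OF rF rD])
  have dim: "dim_row ?H = ?N" using rH by (auto simp: rep_def)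
  have D: "selfadj ?N (imp m g)" by (rule rep_selfadj[OF rD herm])
  have T: "selfadj ?N ?T"
    unfolding selfadj_def
  proof (intro conjI ballI)
    show "opr ?N ?T" using rH by (simp add: rep_def)
    show "ip ?N x (?T y) = ip ?N (?T x) y" if "x \<in> vsp ?N" "y \<in> vsp ?N" for x y
      using that by (simp add: ip_simps selfadjD(4)[OF D] selfadjD(4)[OF F.ham_selfadj])
  qed
  obtain E where psi: "psi \<in> carrier_vec ?N" "cvnorm psi = 1" "?H *\<^sub>v psi = complex_of_real E \<cdot>\<^sub>v psi"
    and Emin: "\<And>\<mu> v. v \<in> carrier_vec ?N \<Longrightarrow> v \<noteq> 0\<^sub>v ?N \<Longrightarrow> ?H *\<^sub>v v = \<mu> \<cdot>\<^sub>v v \<Longrightarrow> E \<le> Re \<mu>"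
    using gs unfolding ground_state_def dim by blast
  have f: "fv psi \<in> vsp ?N" "nrm ?N (fv psi) = 1"
    using psi fv_vsp cvnorm_fv by auto
  have eq: "?T (fv psi) = of_real E *\<^sub>c fv psi"
    using fv_mult[OF rH psi(1)] psi(3) by (simp add: fv_simps)
  obtain LT eT dT where "eigenbasis ?N ?T LT eT dT" using spectral_theorem[OF T] by blast
  then interpret TB: eigenbasis ?N ?T LT eT dT .
  \<comment> \<open>\<open>ground_state\<close> compares \<open>E\<close> with eigenvalues only;
    diagonalising the whole Hamiltonian turns this into a variational bound.\<close>
  have EdT: "E \<le> dT k" if k: "k < LT" for k
  proof -
    let ?v = "vec ?N (eT k)"
    have fvv: "fv ?v = eT k" using k by (intro fv_vec) simp
    have "?H *\<^sub>v ?v = complex_of_real (dT k) \<cdot>\<^sub>v ?v"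
    proof (rule fv_inject[of _ ?N])
      show "fv (?H *\<^sub>v ?v) = fv (complex_of_real (dT k) \<cdot>\<^sub>v ?v)"
        using fv_mult[OF rH, of ?v] TB.eigen[OF k] by (simp only: fv_simps fvv vec_carrier)
    qed (use rH in \<open>auto simp: rep_def\<close>)
    moreover have "?v \<noteq> 0\<^sub>v ?N"
    proof
      assume "?v = 0\<^sub>v ?N"
      then have "eT k = 0" using fvv fv_simps(3)[of ?N] by simp
      then show False using TB.ortho[OF k k] by (simp add: ip_simps)
    qed
    ultimately show ?thesis using Emin[of ?v "complex_of_real (dT k)"] by simp
  qed
  have E: "E * (nrm ?N x)\<^sup>2 \<le> Re (ip ?N x (?T x))" if "x \<in> vsp ?N" for x
    by (rule TB.rayleigh[OF that EdT])
  have "cvnorm ((1\<^sub>m ?N - orth_proj ?N (low_space (H_free n h) \<tau>)) *\<^sub>v psi)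
      = nrm ?N (FB.sp {\<tau><..} (fv psi))"
    by (rule FB.orth_proj_low_space[OF rF psi(1)])
  also have "\<dots> \<le> 2 * exp (- (\<tau> / 4) * ln (\<tau> / (8 * exp 1 * real m)))"
  proof (cases "m = 0")
    case True
    \<comment> \<open>Junk values \<open>x / 0 = 0\<close> and \<open>ln 0 = 0\<close>: the bound is 2.\<close>
    then show ?thesis using FB.nrm_sp[OF f(1), of "{\<tau><..}"] f(2) by simp
  next
    case False
    show ?thesis
    proof (rule impurity_tail[where E = E])
      show "antisym_on n ?h" "m \<le> 2 * n" "selfadj ?N (imp m g)" by fact+
      show "contraction (2 * n) ?h" by (rule contraction_op_norm[OF h_dim h_norm])
      show "0 < m" using False by simp
      show "free_fermions n ?h L u lam" by (rule F.free_fermions_axioms)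
      show "eigenbasis ?N F.ham LF eF dF" by (rule FB.eigenbasis_axioms)
    qed (use f eq E tau in auto)
  qed
  finally show ?thesis .
qed

end
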